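(* Let $M,N$ be positive integers, and let $T\cong\mathfrak{gl}(M|N)$, its affinization $\widehat T=T\otimes\mathbb C[t,t^{-1}]\oplus\mathbb CK$, the space $V[\Gamma]\otimes\mathfrak F$ (with $\Gamma=\oplus_{i=1}^M\mathbb Ze_i$) and the operators on it be as defined in the context. The linear map given, for all $n\in\mathbb Z$, by $$T_{ii}(n)\mapsto e_i(n)\ (1\le i\le M),\qquad T_{ij}(n)\mapsto X_n(e_i-e_j)\ (1\le i\ne j\le M),$$ $$T_{i,j+M}(n)\mapsto S_{i,j+M}(n),\quad T_{j+M,i}(n)\mapsto S_{j+M,i}(n)\ (1\le i\le M,\ 1\le j\le N),$$ $$T_{i+M,j+M}(n)\mapsto S_{i+M,j+M}(n)\ (1\le i,j\le N),\qquad K\mapsto \mathrm{Id},$$ defines a representation of the Lie superalgebra $\widehat T\cong\widehat{\mathfrak{gl}}(M|N)$ on $V[\Gamma]\otimes\mathfrak F$.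
   Context: **Lattice and cocycle.** $\Gamma=\oplus_{i=1}^M\mathbb Ze_i$ with $(e_i,e_j)=\delta_{ij}$; $\alpha_{ij}=e_i-e_j$. $F:\Gamma\times\Gamma\to\{\pm1\}$ is the bimultiplicative map with $F(e_i,e_j)=1$ if $i\le j$ and $-1$ if $i>j$. **The Lie superalgebra $T$.** $T$ has basis $T_{ij}$, $1\le i,j\le M+N$; $T_{ij}$ is even if $i,j\le M$ or $i,j>M$, and odd otherwise. The superbracket satisfies $[Y,X]=-(-1)^{|X||Y|}[X,Y]$ and is given as follows. (T1) For $1\le i,j,k,l\le M$: if $i\ne j$, $k\neq l$, then $[T_{ij},T_{kl}]$ equals $0$ if $(\alpha_{ij},\alpha_{kl})\ge0$; $F(\alpha_{ij},\alpha_{kl})T_{il}$ if $j=k$, $l\ne i$; $F(\alpha_{ij},\alpha_{kl})T_{kj}$ if $l=i$, $j\ne k$; $F(\alpha_{ij},\alpha_{kl})(T_{ii}-T_{jj})$ if $l=i$, $j=k$. Moreover $[T_{ii},T_{kl}]=(e_i,\alpha_{kl})T_{kl}$ for $k\ne l$, and $[T_{ii},T_{kk}]=0$. (T2) For $1\le i,j,k,l\le N$: $[T_{i+M,j+M},T_{k+M,l+M}]=\delta_{jk}T_{i+M,l+M}-\delta_{il}T_{k+M,j+M}$. (T3) For $1\le i,j,l\le M$, $1\le k\le N$: $[T_{ij},T_{k+M,l}]=\delta_{il}F(e_j,e_i)T_{k+M,j}$ if $i\neq j$, and $[T_{ii},T_{k+M,l}]=-\delta_{il}T_{k+M,l}$.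 (T4) For $1\le i,j,k\le M$, $1\le l\le N$: $[T_{ij},T_{k,l+M}]=\delta_{jk}F(e_i,e_j)T_{i,l+M}$. (T5) For $1\le i,j,k\le N$, $1\le l\le M$: $[T_{i+M,j+M},T_{k+M,l}]=\delta_{jk}T_{i+M,l}$. (T6) For $1\le i,j,l\le N$, $1\le k\le M$: $[T_{i+M,j+M},T_{k,l+M}]=-\delta_{li}T_{k,j+M}$. (T7) For $1\le i,l\le N$, $1\le j,k\le M$: $[T_{i+M,j},T_{k,l+M}]=\delta_{jk}T_{i+M,l+M}+F(e_k,e_j)\delta_{li}T_{kj}$. (T8)–(T10) The brackets $[T_{ij},T_{k+M,l+M}]$ ($i,j\le M$; $k,l\le N$), $[T_{i+M,j},T_{k+M,l}]$ ($i,k\le N$; $j,l\le M$) and $[T_{i,j+M},T_{k,l+M}]$ ($i,k\le M$; $j,l\le N$) are $0$. ($T\cong\mathfrak{gl}(M|N)$.) The bilinear form $(\,,)_T$ (supersymmetric, invariant, even) is: $(T_{ij},T_{kl})_T=F(\alpha_{ij},\alpha_{kl})\delta_{jk}\delta_{li}$ for $i,j,k,l\le M$ (with $\alpha_{ii}=0$); $(T_{i+M,j},T_{k,l+M})_T=-\delta_{jk}\delta_{li}$ and $(T_{k,l+M},T_{i+M,j})_T=\delta_{jk}\delta_{li}$ for $j,k\le M$, $i,l\le N$; $(T_{i+M,j+M},T_{k+M,l+M})_T=-\delta_{jk}\delta_{li}$ for $i,j,k,l\le N$; all other pairings of basis vectors are $0$. **Affinization.** $\widehat T=T\otimes\mathbb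 C[t,t^{-1}]\oplus\mathbb CK$, $X(m)=X\otimes t^m$, $K$ even and central, $[X(m),Y(n)]=[X,Y](m+n)+(X,Y)_T\,m\,\delta_{m+n,0}K$. **Fock space $V[\Gamma]$.** Let $\mathfrak h=\mathbb C\otimes_{\mathbb Z}\Gamma$; the Heisenberg algebra is $\oplus_{k\in\mathbb Z}\mathfrak h(k)\oplus\mathbb CK$ with $[\alpha(k),\beta(m)]=k(\alpha,\beta)\delta_{k+m,0}K$ and $K$ central. Let $\mathfrak h_-=\oplus_{k<0}\mathfrak h(k)$, $V[\Gamma]=\mathbb C[\Gamma]\otimes S(\mathfrak h_-)$, where $\mathbb C[\Gamma]$ has basis $e^\gamma$, $\gamma\in\Gamma$. For $m>0$, $\alpha(-m)$ acts on $S(\mathfrak h_-)$ by multiplication and $\alpha(m)$ as the derivation with $\beta(-n)\mapsto\delta_{m,n}m(\alpha,\beta)$; $\alpha(0)(e^\gamma\otimes u)=(\alpha,\gamma)e^\gamma\otimes u$; $K=1$. Further $e^\alpha(e^\gamma\otimes u)=F(\alpha,\gamma)e^{\alpha+\gamma}\otimes u$ and $z^{\alpha(0)}(e^\gamma\otimes u)=z^{(\alpha,\gamma)}e^\gamma\otimes u$. **Vertex operators.** $T_\pm(\alpha,z)=-\sum_{n\in\mathbb Z,\,\pm n>0}\frac1n\alpha(n)z^{-n}$, $Y(\alpha,z)=e^\alpha z^{\alpha(0)}\exp T_-(\alpha,z)\exp T_+(\alpha,z)$ for $\alpha\in\Gamma$. If $(\alpha,\alpha)$ is even, $X(\alpha,z)=z^{(\alpha,\alpha)/2}Y(\alpha,z)=\sum_{n\in\mathbb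 Z}X_n(\alpha)z^{-n}$; if $(\alpha,\alpha)$ is odd, $X(\alpha,z)=Y(\alpha,z)=\sum_{n\in\mathbb Z}X_{n-\frac12}(\alpha)z^{-n}$. **Bosons.** $\mathfrak F$ is the Fock space with vacuum $|0\rangle$ for operators $\varphi^j_{r-\frac12},\varphi^{j*}_{r-\frac12}$ ($1\le j\le N$, $r\in\mathbb Z$) such that the $\varphi$'s commute among themselves, the $\varphi^*$'s commute among themselves, $\varphi^i_{r-\frac12}\varphi^{j*}_{s-\frac12}-\varphi^{j*}_{s-\frac12}\varphi^i_{r-\frac12}=-\delta_{r+s-1,0}\delta_{ij}$, those with $r,s>0$ annihilate $|0\rangle$, and those with $r,s\le0$ act freely and generate $\mathfrak F$ from $|0\rangle$. $:\varphi^i_{r-\frac12}\varphi^{j*}_{s-\frac12}:$ is $\varphi^i_{r-\frac12}\varphi^{j*}_{s-\frac12}$ if $r\le s$ and $\varphi^{j*}_{s-\frac12}\varphi^i_{r-\frac12}$ if $r>s$. **Operators on $V[\Gamma]\otimes\mathfrak F$.** Vertex operators act on the first factor, bosons on the second. The $\mathbb Z_2$-grading: $e^\gamma\otimes u\otimes v$ has parity $(\gamma,\gamma)$ mod $2$. For $1\le i\le M$, $1\le j\le N$: $S_{i,j+M}(n)=\sum_{r\in\mathbb Z}X_{r-\frac12}(e_i)\varphi^{j*}_{n-r+\frac12}$, $S_{j+M,i}(n)=\sum_{r\in\mathbb Z}X_{r-\frac12}(-e_i)\varphi^{j}_{n-r+\frac12}$; for $1\le i,j\le N$: $S_{i+M,j+M}(n)=\sum_{r\in\mathbb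 Z}:\varphi^i_{r-\frac12}\varphi^{j*}_{n-r+\frac12}:$. A representation of a Lie superalgebra is a parity-preserving linear map to endomorphisms taking the superbracket to the supercommutator $[X,Y]=XY-(-1)^{|X||Y|}YX$. *)

theory Defs
  imports
    "HOL-Analysis.Finite_Cartesian_Product"
    "HOL-Library.Poly_Mapping"
    "HOL-Library.Z2"
begin

section \<open>Complex vector spaces with a chosen basis\<close>

text \<open>
  Every vector space below is given by a basis, so it is the space of finitely supported
  functions \<open>'b \<Rightarrow>\<^sub>0 complex\<close> on the index type \<open>'b\<close> of that basis, and the tensor
  product of \<open>'b \<Rightarrow>\<^sub>0 complex\<close> and \<open>'c \<Rightarrow>\<^sub>0 complex\<close> is \<open>'b \<times> 'c \<Rightarrow>\<^sub>0 complex\<close>.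
\<close>

definition cscale :: "complex \<Rightarrow> ('b \<Rightarrow>\<^sub>0 complex) \<Rightarrow> ('b \<Rightarrow>\<^sub>0 complex)" where
  "cscale c v = Poly_Mapping.map ((*) c) v"

lemma lookup_cscale [simp]: "Poly_Mapping.lookup (cscale c v) x = c * Poly_Mapping.lookup v x"
  by (simp add: cscale_def Poly_Mapping.map.rep_eq Poly_Mapping.when_def)

lemma vector_space_cscale: "vector_space cscale"
  by unfold_locales (auto intro!: poly_mapping_eqI simp: lookup_add algebra_simps)

definition basis :: "'b \<Rightarrow> ('b \<Rightarrow>\<^sub>0 complex)" where
  "basis x = Poly_Mapping.single x 1"

definition lin_ext :: "('b \<Rightarrow> ('c \<Rightarrow>\<^sub>0 complex)) \<Rightarrow> ('b \<Rightarrow>\<^sub>0 complex) \<Rightarrow> ('c \<Rightarrow>\<^sub>0 complex)" where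
  "lin_ext g v = (\<Sum>x\<in>Poly_Mapping.keys v. cscale (Poly_Mapping.lookup v x) (g x))"

definition bilin_ext ::
  "('b \<Rightarrow> 'c \<Rightarrow> ('d \<Rightarrow>\<^sub>0 complex)) \<Rightarrow> ('b \<Rightarrow>\<^sub>0 complex) \<Rightarrow> ('c \<Rightarrow>\<^sub>0 complex) \<Rightarrow> ('d \<Rightarrow>\<^sub>0 complex)" where
  "bilin_ext g u v = (\<Sum>x\<in>Poly_Mapping.keys u. \<Sum>y\<in>Poly_Mapping.keys v. cscale (Poly_Mapping.lookup u x * Poly_Mapping.lookup v y) (g x y))"

definition tensor ::
  "('b \<Rightarrow>\<^sub>0 complex) \<Rightarrow> ('c \<Rightarrow>\<^sub>0 complex) \<Rightarrow> ('b \<times> 'c \<Rightarrow>\<^sub>0 complex)" where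
  "tensor = bilin_ext (\<lambda>x y. basis (x, y))"

definition tensor_op ::
  "(('b \<Rightarrow>\<^sub>0 complex) \<Rightarrow> ('d \<Rightarrow>\<^sub>0 complex)) \<Rightarrow> (('c \<Rightarrow>\<^sub>0 complex) \<Rightarrow> ('e \<Rightarrow>\<^sub>0 complex)) \<Rightarrow>
   ('b \<times> 'c \<Rightarrow>\<^sub>0 complex) \<Rightarrow> ('d \<times> 'e \<Rightarrow>\<^sub>0 complex)" where
  "tensor_op A B = lin_ext (\<lambda>(x, y). tensor (A (basis x)) (B (basis y)))"


section \<open>Superspaces and representations of Lie superalgebras\<close>

text \<open>
  The basis elements are homogeneous; \<open>par\<close> gives their parities in the two-element field.
\<close>

definition homogeneous :: "('b \<Rightarrow> bit) \<Rightarrow> bit \<Rightarrow> ('b \<Rightarrow>\<^sub>0 complex) set" where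
  "homogeneous par p = {v. \<forall>x\<in>Poly_Mapping.keys v. par x = p}"

definition super_sign :: "bit \<Rightarrow> bit \<Rightarrow> complex" where
  "super_sign p q = (if p * q = 1 then -1 else 1)"

definition super_representation ::
  "('a \<Rightarrow> bit) \<Rightarrow> (('a \<Rightarrow>\<^sub>0 complex) \<Rightarrow> ('a \<Rightarrow>\<^sub>0 complex) \<Rightarrow> ('a \<Rightarrow>\<^sub>0 complex)) \<Rightarrow> ('b \<Rightarrow> bit) \<Rightarrow>
   (('a \<Rightarrow>\<^sub>0 complex) \<Rightarrow> ('b \<Rightarrow>\<^sub>0 complex) \<Rightarrow> ('b \<Rightarrow>\<^sub>0 complex)) \<Rightarrow> bool" where
  "super_representation par br parV \<rho> \<longleftrightarrow>
     (\<forall>x. Vector_Spaces.linear cscale cscale (\<rho> x)) \<and>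
     (\<forall>v. Vector_Spaces.linear cscale cscale (\<lambda>x. \<rho> x v)) \<and>
     (\<forall>p q. \<forall>x\<in>homogeneous par p. \<forall>v\<in>homogeneous parV q. \<rho> x v \<in> homogeneous parV (p + q)) \<and>
     (\<forall>p q. \<forall>x\<in>homogeneous par p. \<forall>y\<in>homogeneous par q. \<forall>v.
        \<rho> (br x y) v = \<rho> x (\<rho> y v) - cscale (super_sign p q) (\<rho> y (\<rho> x v)))"


section \<open>The lattice and the cocycle\<close>

text \<open>
  The index type \<open>'m\<close>, finite and linearly ordered, stands for \<open>{1,\<dots>,M}\<close>, and the finite
  type \<open>'n\<close> stands for \<open>{1,\<dots>,N}\<close>. The set \<open>{1,\<dots>,M+N}\<close> is \<open>'m + 'n\<close>: \<open>Inl i\<close> is \<open>i\<close> and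
  \<open>Inr j\<close> is \<open>j + M\<close>. The lattice is \<open>int ^ 'm\<close>, and \<open>complex ^ 'm\<close> is its
  complexification.
\<close>

definition pairing :: "('a::comm_ring_1) ^ 'm \<Rightarrow> 'a ^ ('m::finite) \<Rightarrow> 'a" where
  "pairing \<alpha> \<beta> = (\<Sum>i\<in>UNIV. \<alpha> $ i * \<beta> $ i)"

definition of_lattice :: "int ^ 'm \<Rightarrow> complex ^ ('m::finite)" where
  "of_lattice \<gamma> = (\<chi> i. of_int (\<gamma> $ i))"

definition lat_e :: "'m::finite \<Rightarrow> int ^ 'm" where
  "lat_e i = axis i 1"

abbreviation lat_root :: "'m::finite \<Rightarrow> 'm \<Rightarrow> int ^ 'm" where
  "lat_root i j \<equiv> lat_e i - lat_e j"

definition cocycle :: "int ^ ('m::{finite,linorder}) \<Rightarrow> int ^ 'm::{finite,linorder} \<Rightarrow> complex" where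
  "cocycle \<alpha> \<beta> = (\<Prod>i\<in>UNIV. \<Prod>j\<in>UNIV. (if i \<le> j then 1 else -1) powi (\<alpha> $ i * \<beta> $ j))"

lemma cocycle_add_left: "cocycle (\<alpha> + \<beta>) \<gamma> = cocycle \<alpha> \<gamma> * cocycle \<beta> \<gamma>"
  unfolding cocycle_def prod.distrib[symmetric]
  by (intro prod.cong refl) (simp add: distrib_right power_int_add)

lemma cocycle_add_right: "cocycle \<alpha> (\<beta> + \<gamma>) = cocycle \<alpha> \<beta> * cocycle \<alpha> \<gamma>"
  unfolding cocycle_def prod.distrib[symmetric]
  by (intro prod.cong refl) (simp add: distrib_left power_int_add)

lemma cocycle_e: "cocycle (lat_e i) (lat_e j) = (if i \<le> j then 1 else -1)"
proof -
  let ?s = "\<lambda>a b. if a \<le> b then 1 else (-1 :: complex)"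
  have "?s a b powi (lat_e i $ a * lat_e j $ b) = (if b = j then if a = i then ?s i j else 1 else 1)"
    for a b
    by (simp add: lat_e_def axis_def)
  then show ?thesis
    unfolding cocycle_def by (simp only: prod.delta finite UNIV_I if_True)
qed


section \<open>The Lie superalgebra and its affinization\<close>

text \<open>The pair \<open>(a, b)\<close> is the index of the basis vector $T_{ab}$.\<close>

type_synonym ('m, 'n) t_basis = "('m + 'n) \<times> ('m + 'n)"

definition t_parity :: "('m, 'n) t_basis \<Rightarrow> bit" where
  "t_parity x = (if isl (fst x) = isl (snd x) then 0 else 1)"

definition t_bracket_even ::
  "'m \<Rightarrow> 'm \<Rightarrow> 'm \<Rightarrow> 'm \<Rightarrow> (('m::{finite,linorder}, 'n) t_basis \<Rightarrow>\<^sub>0 complex)" where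
  "t_bracket_even i j k l =
    (let T = (\<lambda>a b. basis (Inl a, Inl b)) in
     if i \<noteq> j \<and> k \<noteq> l then
       (if pairing (lat_root i j) (lat_root k l) \<ge> 0 then 0
        else if j = k \<and> l \<noteq> i then cscale (cocycle (lat_root i j) (lat_root k l)) (T i l)
        else if l = i \<and> j \<noteq> k then cscale (cocycle (lat_root i j) (lat_root k l)) (T k j)
        else cscale (cocycle (lat_root i j) (lat_root k l)) (T i i - T j j))
     else if i = j \<and> k \<noteq> l then cscale (of_int (pairing (lat_e i) (lat_root k l))) (T k l)
     else if i \<noteq> j \<and> k = l then - cscale (of_int (pairing (lat_e k) (lat_root i j))) (T i j)
     else 0)"

text \<open>
  The four kinds of basis vectors are numbered so that the given brackets $[x, y]$ are those
  in which the kind of \<open>x\<close> is at most that of \<open>y\<close>; the others follow by super skew-symmetry.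
\<close>

fun t_kind :: "('m, 'n) t_basis \<Rightarrow> nat" where
  "t_kind (Inl _, Inl _) = 0"
| "t_kind (Inr _, Inr _) = 1"
| "t_kind (Inr _, Inl _) = 2"
| "t_kind (Inl _, Inr _) = 3"

fun t_bracket_given ::
  "('m::{finite,linorder}, 'n) t_basis \<Rightarrow> ('m, 'n) t_basis \<Rightarrow> (('m, 'n) t_basis \<Rightarrow>\<^sub>0 complex)" where
  "t_bracket_given (Inl i, Inl j) (Inl k, Inl l) = t_bracket_even i j k l"
| "t_bracket_given (Inr i, Inr j) (Inr k, Inr l) =
     (if j = k then basis (Inr i, Inr l) else 0) - (if i = l then basis (Inr k, Inr j) else 0)"
| "t_bracket_given (Inl i, Inl j) (Inr k, Inl l) =
     (if i \<noteq> j then (if i = l then cscale (cocycle (lat_e j) (lat_e i)) (basis (Inr k, Inl j)) else 0)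
      else - (if i = l then basis (Inr k, Inl l) else 0))"
| "t_bracket_given (Inl i, Inl j) (Inl k, Inr l) =
     (if j = k then cscale (cocycle (lat_e i) (lat_e j)) (basis (Inl i, Inr l)) else 0)"
| "t_bracket_given (Inr i, Inr j) (Inr k, Inl l) = (if j = k then basis (Inr i, Inl l) else 0)"
| "t_bracket_given (Inr i, Inr j) (Inl k, Inr l) = - (if l = i then basis (Inl k, Inr j) else 0)"
| "t_bracket_given (Inr i, Inl j) (Inl k, Inr l) =
     (if j = k then basis (Inr i, Inr l) else 0) +
     (if l = i then cscale (cocycle (lat_e k) (lat_e j)) (basis (Inl k, Inl j)) else 0)"
| "t_bracket_given _ _ = 0"

definition t_bracket ::
  "('m::{finite,linorder}, 'n) t_basis \<Rightarrow> ('m, 'n) t_basis \<Rightarrow> (('m, 'n) t_basis \<Rightarrow>\<^sub>0 complex)" where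
  "t_bracket x y =
    (if t_kind x \<le> t_kind y then t_bracket_given x y
     else - cscale (super_sign (t_parity x) (t_parity y)) (t_bracket_given y x))"

fun t_form :: "('m::{finite,linorder}, 'n) t_basis \<Rightarrow> ('m, 'n) t_basis \<Rightarrow> complex" where
  "t_form (Inl i, Inl j) (Inl k, Inl l) =
     (if j = k \<and> l = i then cocycle (lat_root i j) (lat_root k l) else 0)"
| "t_form (Inr i, Inl j) (Inl k, Inr l) = (if j = k \<and> l = i then -1 else 0)"
| "t_form (Inl k, Inr l) (Inr i, Inl j) = (if j = k \<and> l = i then 1 else 0)"
| "t_form (Inr i, Inr j) (Inr k, Inr l) = (if j = k \<and> l = i then -1 else 0)"
| "t_form _ _ = 0"

text \<open>\<open>Mode x m\<close> is the index of $x \otimes t^m$, and \<open>Central\<close> that of the central element $K$.\<close>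

datatype ('m, 'n) affine_basis = Mode "('m, 'n) t_basis" int | Central

fun affine_parity :: "('m, 'n) affine_basis \<Rightarrow> bit" where
  "affine_parity (Mode x m) = t_parity x"
| "affine_parity Central = 0"

fun affine_bracket_basis ::
  "('m::{finite,linorder}, 'n) affine_basis \<Rightarrow> ('m, 'n) affine_basis \<Rightarrow>
   (('m, 'n) affine_basis \<Rightarrow>\<^sub>0 complex)" where
  "affine_bracket_basis (Mode x m) (Mode y n) =
     lin_ext (\<lambda>z. basis (Mode z (m + n))) (t_bracket x y) +
     cscale (if m + n = 0 then t_form x y * of_int m else 0) (basis Central)"
| "affine_bracket_basis _ _ = 0"

definition affine_bracket ::
  "(('m::{finite,linorder}, 'n) affine_basis \<Rightarrow>\<^sub>0 complex) \<Rightarrow>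
   (('m, 'n) affine_basis \<Rightarrow>\<^sub>0 complex) \<Rightarrow> (('m, 'n) affine_basis \<Rightarrow>\<^sub>0 complex)" where
  "affine_bracket = bilin_ext affine_bracket_basis"


section \<open>Polynomial algebras\<close>

text \<open>
  \<open>('x \<Rightarrow>\<^sub>0 nat) \<Rightarrow>\<^sub>0 complex\<close> is the complex polynomial algebra in the variables \<open>'x\<close>; its
  product is that of the library.
\<close>

definition mult_var :: "'x \<Rightarrow> (('x \<Rightarrow>\<^sub>0 nat) \<Rightarrow>\<^sub>0 complex) \<Rightarrow> (('x \<Rightarrow>\<^sub>0 nat) \<Rightarrow>\<^sub>0 complex)" where
  "mult_var x u = Poly_Mapping.single (Poly_Mapping.single x 1) 1 * u"

definition partial_deriv :: "'x \<Rightarrow> (('x \<Rightarrow>\<^sub>0 nat) \<Rightarrow>\<^sub>0 complex) \<Rightarrow> (('x \<Rightarrow>\<^sub>0 nat) \<Rightarrow>\<^sub>0 complex)" where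
  "partial_deriv x =
     lin_ext (\<lambda>p. cscale (of_nat (Poly_Mapping.lookup p x)) (basis (p - Poly_Mapping.single x 1)))"


section \<open>The lattice Fock space\<close>

text \<open>
  The variable \<open>(i, k)\<close> is $e_i(-k-1)$, so that $S(\mathfrak h_-)$ is the polynomial algebra
  in the variables \<open>'m \<times> nat\<close>, and \<open>(\<gamma>, p)\<close> is the index of $e^\gamma \otimes p$.
\<close>

type_synonym 'm sym_basis = "('m \<times> nat) \<Rightarrow>\<^sub>0 nat"
type_synonym 'm v_basis = "(int ^ 'm) \<times> ('m sym_basis)"

definition heis_sym ::
  "complex ^ 'm \<Rightarrow> int \<Rightarrow> ('m::finite sym_basis \<Rightarrow>\<^sub>0 complex) \<Rightarrow> ('m sym_basis \<Rightarrow>\<^sub>0 complex)" where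
  "heis_sym \<alpha> k u =
    (if k < 0 then \<Sum>i\<in>UNIV. cscale (\<alpha> $ i) (mult_var (i, nat (- k - 1)) u)
     else \<Sum>i\<in>UNIV. cscale (of_int k * \<alpha> $ i) (partial_deriv (i, nat (k - 1)) u))"

definition heis ::
  "complex ^ 'm \<Rightarrow> int \<Rightarrow> ('m::finite v_basis \<Rightarrow>\<^sub>0 complex) \<Rightarrow> ('m v_basis \<Rightarrow>\<^sub>0 complex)" where
  "heis \<alpha> k =
    (if k = 0 then lin_ext (\<lambda>(\<gamma>, p). cscale (pairing \<alpha> (of_lattice \<gamma>)) (basis (\<gamma>, p)))
     else tensor_op id (heis_sym \<alpha> k))"

definition e_op ::
  "int ^ ('m::{finite,linorder}) \<Rightarrow> ('m v_basis \<Rightarrow>\<^sub>0 complex) \<Rightarrow> ('m v_basis \<Rightarrow>\<^sub>0 complex)" where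
  "e_op \<alpha> = lin_ext (\<lambda>(\<gamma>, p). cscale (cocycle \<alpha> \<gamma>) (basis (\<alpha> + \<gamma>, p)))"

text \<open>The coefficient of $z^s$ in $z^{\alpha(0)}$.\<close>

definition z_op ::
  "int ^ 'm \<Rightarrow> int \<Rightarrow> ('m::finite v_basis \<Rightarrow>\<^sub>0 complex) \<Rightarrow> ('m v_basis \<Rightarrow>\<^sub>0 complex)" where
  "z_op \<alpha> s = lin_ext (\<lambda>(\<gamma>, p). if pairing \<alpha> \<gamma> = s then basis (\<gamma>, p) else 0)"

text \<open>
  Exponentials of formal series of operators without constant term: \<open>series_power A l n\<close> is
  the coefficient of $w^n$ in $(\sum_{k\ge1} A_k w^k)^l$, and \<open>series_exp A n\<close> is the
  coefficient of $w^n$ in $\exp(\sum_{k\ge1} A_k w^k)$. Powers \<open>l > n\<close> do not contribute.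
\<close>

fun series_power ::
  "(nat \<Rightarrow> ('b \<Rightarrow>\<^sub>0 complex) \<Rightarrow> ('b \<Rightarrow>\<^sub>0 complex)) \<Rightarrow> nat \<Rightarrow> nat \<Rightarrow> ('b \<Rightarrow>\<^sub>0 complex) \<Rightarrow> ('b \<Rightarrow>\<^sub>0 complex)" where
  "series_power A 0 n v = (if n = 0 then v else 0)"
| "series_power A (Suc l) n v = (\<Sum>k=1..n. A k (series_power A l (n - k) v))"

definition series_exp ::
  "(nat \<Rightarrow> ('b \<Rightarrow>\<^sub>0 complex) \<Rightarrow> ('b \<Rightarrow>\<^sub>0 complex)) \<Rightarrow> nat \<Rightarrow> ('b \<Rightarrow>\<^sub>0 complex) \<Rightarrow> ('b \<Rightarrow>\<^sub>0 complex)" where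
  "series_exp A n v = (\<Sum>l\<le>n. cscale (1 / fact l) (series_power A l n v))"

text \<open>
  \<open>T_coeff \<alpha> n\<close> is the coefficient of $z^{-n}$ in $T_\pm(\alpha,z)$, where $\pm n > 0$.
\<close>

definition T_coeff ::
  "int ^ 'm \<Rightarrow> int \<Rightarrow> ('m::finite v_basis \<Rightarrow>\<^sub>0 complex) \<Rightarrow> ('m v_basis \<Rightarrow>\<^sub>0 complex)" where
  "T_coeff \<alpha> n v = cscale (- 1 / of_int n) (heis (of_lattice \<alpha>) n v)"

text \<open>\<open>exp_minus \<alpha> a\<close>: coefficient of $z^a$ in $\exp T_-(\alpha,z)$.\<close>

definition exp_minus ::
  "int ^ 'm \<Rightarrow> nat \<Rightarrow> ('m::finite v_basis \<Rightarrow>\<^sub>0 complex) \<Rightarrow> ('m v_basis \<Rightarrow>\<^sub>0 complex)" where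
  "exp_minus \<alpha> = series_exp (\<lambda>k. T_coeff \<alpha> (- int k))"

text \<open>\<open>exp_plus \<alpha> b\<close>: coefficient of $z^{-b}$ in $\exp T_+(\alpha,z)$.\<close>

definition exp_plus ::
  "int ^ 'm \<Rightarrow> nat \<Rightarrow> ('m::finite v_basis \<Rightarrow>\<^sub>0 complex) \<Rightarrow> ('m v_basis \<Rightarrow>\<^sub>0 complex)" where
  "exp_plus \<alpha> = series_exp (\<lambda>k. T_coeff \<alpha> (int k))"

text \<open>
  \<open>Y_coeff \<alpha> n\<close> is the coefficient of $z^{-n}$ in $Y(\alpha,z)$; the power $z^s$ of
  $z^{\alpha(0)}$ that contributes satisfies $s + a - b = -n$. Applied to a vector the
  sum has only finitely many nonzero terms, as \<^const>\<open>Sum_any\<close> requires.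
\<close>

definition Y_coeff ::
  "int ^ ('m::{finite,linorder}) \<Rightarrow> int \<Rightarrow> ('m v_basis \<Rightarrow>\<^sub>0 complex) \<Rightarrow> ('m v_basis \<Rightarrow>\<^sub>0 complex)" where
  "Y_coeff \<alpha> n v =
     Sum_any (\<lambda>(a, b). e_op \<alpha> (z_op \<alpha> (int b - int a - n) (exp_minus \<alpha> a (exp_plus \<alpha> b v))))"

text \<open>
  \<open>X_int \<alpha> n\<close> is $X_n(\alpha)$, for \<open>(\<alpha>, \<alpha>)\<close> even; \<open>X_half \<alpha> r\<close> is $X_{r-\frac12}(\alpha)$, for
  \<open>(\<alpha>, \<alpha>)\<close> odd.
\<close>

definition X_int ::
  "int ^ ('m::{finite,linorder}) \<Rightarrow> int \<Rightarrow> ('m v_basis \<Rightarrow>\<^sub>0 complex) \<Rightarrow> ('m v_basis \<Rightarrow>\<^sub>0 complex)" where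
  "X_int \<alpha> n = Y_coeff \<alpha> (n + pairing \<alpha> \<alpha> div 2)"

definition X_half ::
  "int ^ ('m::{finite,linorder}) \<Rightarrow> int \<Rightarrow> ('m v_basis \<Rightarrow>\<^sub>0 complex) \<Rightarrow> ('m v_basis \<Rightarrow>\<^sub>0 complex)" where
  "X_half \<alpha> r = Y_coeff \<alpha> r"


section \<open>The bosonic Fock space\<close>

text \<open>
  \<open>Phi j k\<close> and \<open>Phi_star j k\<close> are the variables $\varphi^j_{-k-\frac12}$ and
  $\varphi^{j*}_{-k-\frac12}$; the vacuum is the constant polynomial 1.
\<close>

datatype 'n boson_var = Phi 'n nat | Phi_star 'n nat

type_synonym 'n f_basis = "'n boson_var \<Rightarrow>\<^sub>0 nat"

text \<open>
  \<open>phi j r\<close> and \<open>phi_star j r\<close> are the operators $\varphi^j_{r-\frac12}$ and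
  $\varphi^{j*}_{r-\frac12}$. Those with \<open>r > 0\<close> kill the vacuum and satisfy
  $[\varphi^j_{r-\frac12}, \varphi^{j*}_{(1-r)-\frac12}] = -1$ and
  $[\varphi^{j*}_{r-\frac12}, \varphi^j_{(1-r)-\frac12}] = 1$.
\<close>

definition phi :: "'n \<Rightarrow> int \<Rightarrow> ('n f_basis \<Rightarrow>\<^sub>0 complex) \<Rightarrow> ('n f_basis \<Rightarrow>\<^sub>0 complex)" where
  "phi j r u =
    (if r \<le> 0 then mult_var (Phi j (nat (- r))) u
     else - partial_deriv (Phi_star j (nat (r - 1))) u)"

definition phi_star :: "'n \<Rightarrow> int \<Rightarrow> ('n f_basis \<Rightarrow>\<^sub>0 complex) \<Rightarrow> ('n f_basis \<Rightarrow>\<^sub>0 complex)" where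
  "phi_star j r u =
    (if r \<le> 0 then mult_var (Phi_star j (nat (- r))) u
     else partial_deriv (Phi j (nat (r - 1))) u)"

definition normal_phi ::
  "'n \<Rightarrow> int \<Rightarrow> 'n \<Rightarrow> int \<Rightarrow> ('n f_basis \<Rightarrow>\<^sub>0 complex) \<Rightarrow> ('n f_basis \<Rightarrow>\<^sub>0 complex)" where
  "normal_phi i r j s =
    (if r \<le> s then phi i r \<circ> phi_star j s else phi_star j s \<circ> phi i r)"


section \<open>The operators on the tensor product\<close>

type_synonym ('m, 'n) fock_basis = "'m v_basis \<times> 'n f_basis"

fun fock_parity :: "('m::finite, 'n) fock_basis \<Rightarrow> bit" where
  "fock_parity ((\<gamma>, p), q) = of_int (pairing \<gamma> \<gamma>)"

text \<open>
  The mode $n - r + \frac12$ is $s - \frac12$ for $s = n - r + 1$. On each vector only finitely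
  many terms of the sums over \<open>r\<close> are nonzero.
\<close>

definition S_star ::
  "'m \<Rightarrow> 'n \<Rightarrow> int \<Rightarrow> (('m::{finite,linorder}, 'n) fock_basis \<Rightarrow>\<^sub>0 complex) \<Rightarrow>
   (('m, 'n) fock_basis \<Rightarrow>\<^sub>0 complex)" where
  "S_star i j n v = Sum_any (\<lambda>r. tensor_op (X_half (lat_e i) r) (phi_star j (n - r + 1)) v)"

definition S_unstar ::
  "'n \<Rightarrow> 'm \<Rightarrow> int \<Rightarrow> (('m::{finite,linorder}, 'n) fock_basis \<Rightarrow>\<^sub>0 complex) \<Rightarrow>
   (('m, 'n) fock_basis \<Rightarrow>\<^sub>0 complex)" where
  "S_unstar j i n v = Sum_any (\<lambda>r. tensor_op (X_half (- lat_e i) r) (phi j (n - r + 1)) v)"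

definition S_normal ::
  "'n \<Rightarrow> 'n \<Rightarrow> int \<Rightarrow> (('m::finite, 'n) fock_basis \<Rightarrow>\<^sub>0 complex) \<Rightarrow>
   (('m, 'n) fock_basis \<Rightarrow>\<^sub>0 complex)" where
  "S_normal i j n v = Sum_any (\<lambda>r. tensor_op id (normal_phi i r j (n - r + 1)) v)"

fun fock_action_basis ::
  "('m::{finite,linorder}, 'n) affine_basis \<Rightarrow>
   (('m, 'n) fock_basis \<Rightarrow>\<^sub>0 complex) \<Rightarrow> (('m, 'n) fock_basis \<Rightarrow>\<^sub>0 complex)" where
  "fock_action_basis (Mode (Inl i, Inl j) n) =
     (if i = j then tensor_op (heis (of_lattice (lat_e i)) n) id else tensor_op (X_int (lat_root i j) n) id)"
| "fock_action_basis (Mode (Inl i, Inr j) n) = S_star i j n"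
| "fock_action_basis (Mode (Inr j, Inl i) n) = S_unstar j i n"
| "fock_action_basis (Mode (Inr i, Inr j) n) = S_normal i j n"
| "fock_action_basis Central = id"

definition fock_action ::
  "(('m::{finite,linorder}, 'n) affine_basis \<Rightarrow>\<^sub>0 complex) \<Rightarrow>
   (('m, 'n) fock_basis \<Rightarrow>\<^sub>0 complex) \<Rightarrow> (('m, 'n) fock_basis \<Rightarrow>\<^sub>0 complex)" where
  "fock_action x v = lin_ext (\<lambda>b. fock_action_basis b v) x"

end

theory Submission
  imports Defs
begin

text \<open>
  The proof writes every operator of the representation as a current $:a_A(z)\,a_B^*(z):$, where \<open>A\<close>
  and \<open>B\<close> run over the \<open>M + N\<close> indices of \<open>T\<close>. For the last \<open>N\<close> indices \<open>a\<close> and \<open>a\<^sup>*\<close> are the given bosons.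
  For the first \<open>M\<close> ones they are the fermions $\psi_i(z) = Y(e_i,z)$ and $\psi_i^*(z) = Y(-e_i,z)$ of the
  boson-fermion correspondence, where $:\psi_i(z)\psi_i^*(z):$ is $e_i(z)$ and $\psi_i(z)\psi_j^*(z)$
  is \<open>F(e\<^sub>i, e\<^sub>j) Y(e\<^sub>i - e\<^sub>j, z)\<close> for \<open>i \<noteq> j\<close>. After this the root vectors, Cartan elements and odd
  elements of \<open>T\<close> need no separate treatment.

  The analytic content is the product formula for two vertex operators (\<open>Y_coeff_product\<close>). It rests on
  the exchange relation \<open>exp_plus_exp_minus_int\<close> for the exponentials of annihilation and creation
  operators, whose scalar factor is $(1-w/z)^{(\alpha,\beta)}$. For exponents \<open>0\<close> and \<open>1\<close> this factor has no pole, and the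
  operators commute up to a sign (\<open>Y_coeff_exchange\<close>). For the exponent \<open>-1\<close> the two expansions of $(z-w)^{-1}$
  differ by a delta function, which gives the canonical anticommutators (\<open>Y_coeff_anticommutator\<close>) and the identity
  for the diagonal currents (\<open>normal_ordered_sum_graded\<close>). The cocycle supplies the
  signs by which \<open>Y(e\<^sub>i, z)\<close> and \<open>Y(e\<^sub>j, z)\<close> anticommute, instead of commuting, for \<open>i \<noteq> j\<close>.

  The bracket of two currents follows from the canonical relations alone (\<open>current_commutator\<close>): a current acts on
  the fields as a matrix unit, and restoring the normal order after shifting the modes by \<open>m\<close> gives the
  central term. The result is the affine bracket of $\mathfrak{gl}(M|N)$ in the basis of matrix units.
  The basis $T_{ab}$ differs from it by signs, in terms of which the bracket and the form of \<open>T\<close> become those of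
  matrix units (\<open>t_bracket_eq\<close>, \<open>t_form_eq\<close>).

  All identities between series are proved for their coefficients. The sums that occur are finite on each
  vector because annihilation operators lower the energy, which is expressed by the supports \<open>graded \<gamma> d\<close>.
\<close>

section \<open>Linear maps between spaces with a basis\<close>

interpretation cs: vector_space cscale
  by (rule vector_space_cscale)

abbreviation lin :: "(('b \<Rightarrow>\<^sub>0 complex) \<Rightarrow> ('c \<Rightarrow>\<^sub>0 complex)) \<Rightarrow> bool" where
  "lin f \<equiv> Vector_Spaces.linear cscale cscale f"

lemma linI:
  assumes "\<And>u v. f (u + v) = f u + f v" and "\<And>c v. f (cscale c v) = cscale c (f v)"
  shows "lin f"
  by (rule Vector_Spaces.linear.intro[OF vector_space_cscale vector_space_cscale])
     (unfold_locales, use assms in auto)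

lemma lin_module_hom: "lin f \<Longrightarrow> module_hom cscale cscale f"
  by (rule Vector_Spaces.linear.axioms(3))

lemmas lin_add = module_hom.add[OF lin_module_hom]
lemmas lin_scale = module_hom.scale[OF lin_module_hom]
lemmas lin_0 = module_hom.zero[OF lin_module_hom]
lemmas lin_neg = module_hom.neg[OF lin_module_hom]
lemmas lin_diff = module_hom.diff[OF lin_module_hom]
lemmas lin_sum = module_hom.sum[OF lin_module_hom]

lemma lin_id: "lin (\<lambda>v. v)"
  by (rule linI) auto

lemma lin_id': "lin id"
  by (rule linI) auto

lemma lin_zero_map: "lin (\<lambda>v. 0)"
  by (rule linI) auto

lemma lin_compose: "lin f \<Longrightarrow> lin g \<Longrightarrow> lin (\<lambda>v. f (g v))"
  by (rule linI) (auto simp: lin_add lin_scale)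

lemma lin_scale_map: "lin f \<Longrightarrow> lin (\<lambda>v. cscale c (f v))"
  by (rule linI) (auto simp: lin_add lin_scale cs.scale_right_distrib mult.commute)

lemma lin_cscale: "lin (cscale c)"
  by (rule linI) (auto simp: cs.scale_right_distrib mult.commute)

lemma lin_uminus: "lin f \<Longrightarrow> lin (\<lambda>v. - f v)"
  by (rule linI) (auto simp: lin_add lin_scale)

lemma lin_add_map: "lin f \<Longrightarrow> lin g \<Longrightarrow> lin (\<lambda>v. f v + g v)"
  by (rule linI) (auto simp: lin_add lin_scale cs.scale_right_distrib)

lemma lin_diff_map: "lin f \<Longrightarrow> lin g \<Longrightarrow> lin (\<lambda>v. f v - g v)"
  by (rule linI) (auto simp: lin_add lin_scale cs.scale_right_diff_distrib)

lemma lin_sum_map: "(\<And>i. i \<in> S \<Longrightarrow> lin (f i)) \<Longrightarrow> lin (\<lambda>v. \<Sum>i\<in>S. f i v)"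
  by (rule linI) (auto simp: lin_add lin_scale cs.scale_sum_right sum.distrib)

lemma lin_if_map: "lin f \<Longrightarrow> lin g \<Longrightarrow> lin (\<lambda>v. if P then f v else g v)"
  by (cases P) simp_all

lemmas lin_intros = lin_id lin_id' lin_zero_map lin_scale_map lin_uminus lin_add_map
  lin_diff_map lin_sum_map lin_if_map

lemma lookup_basis: "Poly_Mapping.lookup (basis x) y = (if y = x then 1 else 0)"
  by (auto simp: basis_def lookup_single when_def)

lemma keys_basis [simp]: "Poly_Mapping.keys (basis x) = {x}"
  by (simp add: basis_def)

lemma lin_ext_superset:
  assumes "finite S" "Poly_Mapping.keys v \<subseteq> S"
  shows "lin_ext g v = (\<Sum>x\<in>S. cscale (Poly_Mapping.lookup v x) (g x))"
  unfolding lin_ext_def using assms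
  by (intro sum.mono_neutral_left) (auto simp: in_keys_iff)

lemma lin_lin_ext: "lin (lin_ext g)"
proof (rule linI)
  fix u v :: "'a \<Rightarrow>\<^sub>0 complex"
  let ?S = "Poly_Mapping.keys u \<union> Poly_Mapping.keys v"
  have "lin_ext g (u + v) = (\<Sum>x\<in>?S. cscale (Poly_Mapping.lookup (u + v) x) (g x))"
    by (rule lin_ext_superset) (use Poly_Mapping.keys_add[of u v] in auto)
  also have "\<dots> = lin_ext g u + lin_ext g v"
    by (simp add: lin_ext_superset[of ?S] lookup_add cs.scale_left_distrib sum.distrib)
  finally show "lin_ext g (u + v) = lin_ext g u + lin_ext g v" .
next
  fix c and v :: "'a \<Rightarrow>\<^sub>0 complex"
  have "lin_ext g (cscale c v) = (\<Sum>x\<in>Poly_Mapping.keys v. cscale (Poly_Mapping.lookup (cscale c v) x) (g x))"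
    by (rule lin_ext_superset) (auto simp: in_keys_iff)
  also have "\<dots> = cscale c (lin_ext g v)"
    by (simp add: lin_ext_def cs.scale_sum_right)
  finally show "lin_ext g (cscale c v) = cscale c (lin_ext g v)" .
qed

lemma lin_ext_basis [simp]: "lin_ext g (basis x) = g x"
  by (simp add: lin_ext_def lookup_basis)

lemma basis_expansion: "lin_ext basis v = v"
proof (rule poly_mapping_eqI)
  fix y
  have "Poly_Mapping.lookup (lin_ext basis v) y =
      (\<Sum>x\<in>Poly_Mapping.keys v. Poly_Mapping.lookup v x * (if y = x then 1 else 0))"
    by (simp add: lin_ext_def lookup_sum lookup_basis)
  also have "\<dots> = Poly_Mapping.lookup v y"
    by (subst sum.cong[OF refl, of _ _ "\<lambda>x. if y = x then Poly_Mapping.lookup v x else 0"])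
       (auto simp: in_keys_iff)
  finally show "Poly_Mapping.lookup (lin_ext basis v) y = Poly_Mapping.lookup v y" .
qed

lemma lin_eq_lin_ext:
  assumes "lin f"
  shows "f v = lin_ext (\<lambda>x. f (basis x)) v"
proof -
  have "f v = f (lin_ext basis v)"
    by (simp add: basis_expansion)
  then show ?thesis
    by (simp add: lin_ext_def lin_sum[OF assms] lin_scale[OF assms])
qed

lemma lin_eqI_on:
  assumes "lin f" "lin g" "\<And>x. x \<in> A \<Longrightarrow> f (basis x) = g (basis x)" "Poly_Mapping.keys v \<subseteq> A"
  shows "f v = g v"
  unfolding lin_eq_lin_ext[OF assms(1), of v] lin_eq_lin_ext[OF assms(2), of v] lin_ext_def
  using assms(3,4) by (auto intro!: sum.cong)

lemma lin_eqI:
  assumes "lin f" "lin g" "\<And>x. f (basis x) = g (basis x)"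
  shows "f v = g v"
  using lin_eqI_on[of f g UNIV v] assms by auto

lemma keys_sum_subset:
  "(\<And>i. i \<in> S \<Longrightarrow> Poly_Mapping.keys (f i) \<subseteq> B) \<Longrightarrow> Poly_Mapping.keys (sum f S) \<subseteq> B"
proof (induction S rule: infinite_finite_induct)
  case (insert x F)
  then have "Poly_Mapping.keys (f x) \<subseteq> B" "Poly_Mapping.keys (sum f F) \<subseteq> B"
    by auto
  moreover have "Poly_Mapping.keys (sum f (insert x F)) \<subseteq> Poly_Mapping.keys (f x) \<union> Poly_Mapping.keys (sum f F)"
    using insert.hyps Poly_Mapping.keys_add by simp
  ultimately show ?case
    by blast
qed auto

lemma keys_cscale_subset: "Poly_Mapping.keys v \<subseteq> B \<Longrightarrow> Poly_Mapping.keys (cscale c v) \<subseteq> B"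
  by (auto simp: in_keys_iff)

text \<open>
  Weight, energy and parity of vectors are all expressed by supports, so this lemma reduces a
  statement on the degree of an operator to basis vectors.
\<close>

lemma keys_lin_subset:
  assumes "lin f" "\<And>x. x \<in> A \<Longrightarrow> Poly_Mapping.keys (f (basis x)) \<subseteq> B" "Poly_Mapping.keys v \<subseteq> A"
  shows "Poly_Mapping.keys (f v) \<subseteq> B"
  unfolding lin_eq_lin_ext[OF assms(1), of v] lin_ext_def
  using assms(2,3) by (intro keys_sum_subset keys_cscale_subset) auto

lemma bilin_ext_eq: "bilin_ext g u v = lin_ext (\<lambda>x. lin_ext (g x) v) u"
  by (simp add: bilin_ext_def lin_ext_def cs.scale_sum_right)

lemma lin_lin_ext_family:
  assumes "\<And>x. lin (g x)"
  shows "lin (\<lambda>v. lin_ext (\<lambda>x. g x v) u)"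
  unfolding lin_ext_def by (intro lin_sum_map lin_scale_map assms)

lemma lin_bilin_ext_left: "lin (\<lambda>u. bilin_ext g u v)"
  unfolding bilin_ext_eq by (rule lin_lin_ext)

lemma lin_bilin_ext_right: "lin (bilin_ext g u)"
  unfolding bilin_ext_eq[abs_def] by (intro lin_lin_ext_family lin_lin_ext)

lemma bilin_ext_basis [simp]: "bilin_ext g (basis x) (basis y) = g x y"
  by (simp add: bilin_ext_eq)


subsection \<open>Tensor products of operators\<close>

lemma lin_tensor_left: "lin (\<lambda>u. tensor u v)"
  unfolding tensor_def by (rule lin_bilin_ext_left)

lemma lin_tensor_right: "lin (tensor u)"
  unfolding tensor_def by (rule lin_bilin_ext_right)

lemma tensor_basis [simp]: "tensor (basis x) (basis y) = basis (x, y)"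
  by (simp add: tensor_def)

lemma keys_tensor: "Poly_Mapping.keys (tensor u v) \<subseteq> Poly_Mapping.keys u \<times> Poly_Mapping.keys v"
  unfolding tensor_def bilin_ext_def
  by (intro keys_sum_subset keys_cscale_subset) auto

lemma lin_tensor_op: "lin (tensor_op A B)"
  unfolding tensor_op_def by (rule lin_lin_ext)

lemma tensor_op_basis [simp]: "tensor_op A B (basis (x, y)) = tensor (A (basis x)) (B (basis y))"
  by (simp add: tensor_op_def)

lemma tensor_op_tensor:
  assumes A: "lin A" and B: "lin B"
  shows "tensor_op A B (tensor u v) = tensor (A u) (B v)"
proof (rule lin_eqI[of "\<lambda>u. tensor_op A B (tensor u v)" "\<lambda>u. tensor (A u) (B v)"])
  fix x
  show "tensor_op A B (tensor (basis x) v) = tensor (A (basis x)) (B v)"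
    by (rule lin_eqI[of "\<lambda>v. tensor_op A B (tensor (basis x) v)" "\<lambda>v. tensor (A (basis x)) (B v)"])
       (auto intro: lin_compose[OF lin_tensor_op lin_tensor_right] lin_compose[OF lin_tensor_right B])
qed (auto intro: lin_compose[OF lin_tensor_op lin_tensor_left] lin_compose[OF lin_tensor_left A])

lemma tensor_op_comp:
  assumes "lin A" "lin B"
  shows "tensor_op A B (tensor_op A' B' w) = tensor_op (\<lambda>v. A (A' v)) (\<lambda>v. B (B' v)) w"
  by (rule lin_eqI[of "\<lambda>w. tensor_op A B (tensor_op A' B' w)"])
     (auto intro: lin_tensor_op lin_compose simp: tensor_op_tensor[OF assms])

lemma tensor_op_eqI:
  assumes "lin f" "\<And>x y. tensor (A (basis x)) (B (basis y)) = f (basis (x, y))"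
  shows "tensor_op A B w = f w"
  by (rule lin_eqI[of "tensor_op A B" f]) (auto intro: lin_tensor_op assms simp: assms(2))

lemma tensor_op_id: "tensor_op (\<lambda>v. v) (\<lambda>v. v) w = w"
  by (rule tensor_op_eqI) (auto intro: lin_intros)

lemma tensor_op_linear_left:
  "tensor_op (\<lambda>v. A v + A' v) B w = tensor_op A B w + tensor_op A' B w"
  "tensor_op (\<lambda>v. A v - A' v) B w = tensor_op A B w - tensor_op A' B w"
  "tensor_op (\<lambda>v. cscale c (A v)) B w = cscale c (tensor_op A B w)"
  "tensor_op (\<lambda>v. \<Sum>i\<in>S. C i v) B w = (\<Sum>i\<in>S. tensor_op (C i) B w)"
  by (rule tensor_op_eqI, auto intro!: lin_intros lin_tensor_op
        simp: lin_add[OF lin_tensor_left] lin_diff[OF lin_tensor_left] lin_scale[OF lin_tensor_left]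
          lin_sum[OF lin_tensor_left])+

lemma tensor_op_linear_right:
  "tensor_op A (\<lambda>v. B v + B' v) w = tensor_op A B w + tensor_op A B' w"
  "tensor_op A (\<lambda>v. B v - B' v) w = tensor_op A B w - tensor_op A B' w"
  "tensor_op A (\<lambda>v. cscale c (B v)) w = cscale c (tensor_op A B w)"
  "tensor_op A (\<lambda>v. \<Sum>i\<in>S. C i v) w = (\<Sum>i\<in>S. tensor_op A (C i) w)"
  by (rule tensor_op_eqI, auto intro!: lin_intros lin_tensor_op
        simp: lin_add[OF lin_tensor_right] lin_diff[OF lin_tensor_right] lin_scale[OF lin_tensor_right]
          lin_sum[OF lin_tensor_right])+

section \<open>Polynomial algebras and the Heisenberg algebra\<close>

lemma cscale_eq_mult:
  fixes v :: "('x::monoid_add) \<Rightarrow>\<^sub>0 complex"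
  shows "cscale c v = Poly_Mapping.single 0 c * v"
  by (rule poly_mapping_eqI) (simp add: lookup_mult lookup_single when_mult)

lemma lin_mult_var: "lin (mult_var x)"
  by (rule linI)
     (simp_all add: mult_var_def distrib_left cscale_eq_mult mult.left_commute)

lemma mult_var_basis [simp]: "mult_var x (basis p) = basis (Poly_Mapping.single x 1 + p)"
  by (simp add: mult_var_def basis_def mult_single)

lemma lin_partial_deriv: "lin (partial_deriv x)"
  unfolding partial_deriv_def by (rule lin_lin_ext)

lemma partial_deriv_basis [simp]:
  "partial_deriv x (basis p) =
     cscale (of_nat (Poly_Mapping.lookup p x)) (basis (p - Poly_Mapping.single x 1))"
  by (simp add: partial_deriv_def)

lemma mult_var_commute: "mult_var x (mult_var y u) = mult_var y (mult_var x u)"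
  by (simp add: mult_var_def mult.left_commute)

lemma partial_deriv_commute: "partial_deriv x (partial_deriv y u) = partial_deriv y (partial_deriv x u)"
proof (rule lin_eqI[of "\<lambda>u. partial_deriv x (partial_deriv y u)"])
  fix p :: "'a \<Rightarrow>\<^sub>0 nat"
  let ?s = "\<lambda>x. Poly_Mapping.single x (1::nat)"
  have "p - ?s y - ?s x = p - ?s x - ?s y"
    by (rule poly_mapping_eqI) (simp add: lookup_minus)
  then show "partial_deriv x (partial_deriv y (basis p)) = partial_deriv y (partial_deriv x (basis p))"
    by (cases "x = y")
       (simp_all add: lin_scale[OF lin_partial_deriv] lookup_minus lookup_single mult.commute)
qed (rule lin_compose[OF lin_partial_deriv lin_partial_deriv])+

lemma partial_deriv_mult_var:
  "partial_deriv x (mult_var y u) = mult_var y (partial_deriv x u) + (if x = y then u else 0)"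
proof (rule lin_eqI[of "\<lambda>u. partial_deriv x (mult_var y u)"])
  fix p :: "'a \<Rightarrow>\<^sub>0 nat"
  let ?s = "\<lambda>x. Poly_Mapping.single x (1::nat)"
  have 1: "?s y + p - ?s x = ?s y + (p - ?s x)" if "Poly_Mapping.lookup p x \<noteq> 0"
    by (rule poly_mapping_eqI) (use that in \<open>auto simp: lookup_minus lookup_add lookup_single when_def\<close>)
  show "partial_deriv x (mult_var y (basis p)) =
      mult_var y (partial_deriv x (basis p)) + (if x = y then basis p else 0)"
  proof (cases "x = y")
    case True
    show ?thesis
    proof (cases "Poly_Mapping.lookup p x = 0")
      case False
      have "?s x + (p - ?s x) = p"
        using 1[OF False] True by simp
      then show ?thesis
        using True
        by (simp add: lin_scale[OF lin_mult_var] lookup_add cs.scale_left_distrib add.commute)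
    qed (use True in \<open>simp add: lin_scale[OF lin_mult_var] lin_0[OF lin_mult_var] lookup_add\<close>)
  next
    case False
    then show ?thesis
      using 1 by (cases "Poly_Mapping.lookup p x = 0")
        (auto simp: lin_scale[OF lin_mult_var] lin_0[OF lin_mult_var] lookup_add lookup_single)
  qed
qed (intro lin_intros lin_compose[OF lin_partial_deriv lin_mult_var]
       lin_compose[OF lin_mult_var lin_partial_deriv] lin_id)+

text \<open>
  For \<open>k \<noteq> 0\<close> this is the operator $e_i(k)$ on $S(\mathfrak h_-)$.
\<close>

definition osc_var :: "'m \<Rightarrow> int \<Rightarrow> ('m sym_basis \<Rightarrow>\<^sub>0 complex) \<Rightarrow> ('m sym_basis \<Rightarrow>\<^sub>0 complex)" where
  "osc_var i k u = (if k < 0 then mult_var (i, nat (- k - 1)) u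
     else cscale (of_int k) (partial_deriv (i, nat (k - 1)) u))"

lemma lin_osc_var: "lin (osc_var i k)"
  unfolding osc_var_def[abs_def]
  by (intro lin_if_map lin_scale_map lin_mult_var lin_partial_deriv)

lemma osc_var_commutator:
  assumes "k \<noteq> 0" "l \<noteq> 0"
  shows "osc_var i k (osc_var j l u) =
    osc_var j l (osc_var i k u) + cscale (if i = j \<and> k + l = 0 then of_int k else 0) u"
proof -
  have nat_eq: "nat (k - 1) = nat (- l - 1) \<longleftrightarrow> k + l = 0" if "k > 0" "l < 0" for k l :: int
    using that by auto
  consider "k < 0" "l < 0" | "k > 0" "l > 0" | "k > 0" "l < 0" | "k < 0" "l > 0"
    using assms by linarith
  then show ?thesis
  proof cases
    case 1
    then show ?thesis by (simp add: osc_var_def mult_var_commute)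
  next
    case 2
    then show ?thesis
      by (simp add: osc_var_def partial_deriv_commute lin_scale[OF lin_partial_deriv] mult.commute)
  next
    case 3
    then show ?thesis
      by (simp add: osc_var_def partial_deriv_mult_var lin_scale[OF lin_mult_var]
          cs.scale_right_distrib nat_eq)
  next
    case 4
    then have "k = - l" if "k + l = 0" using that by simp
    with 4 show ?thesis
      by (auto simp add: osc_var_def partial_deriv_mult_var lin_scale[OF lin_mult_var]
          cs.scale_right_distrib nat_eq cs.scale_left_distrib[symmetric] simp flip: of_int_add)
  qed
qed

lemma heis_sym_eq: "heis_sym \<alpha> k u = (\<Sum>i\<in>UNIV. cscale (\<alpha> $ i) (osc_var i k u))"
  by (simp add: heis_sym_def osc_var_def mult.commute)

lemma lin_heis_sym: "lin (heis_sym \<alpha> k)"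
  unfolding heis_sym_eq[abs_def] by (intro lin_sum_map lin_scale_map lin_osc_var)

lemma heis_sym_commutator:
  assumes "k \<noteq> 0" "l \<noteq> 0"
  shows "heis_sym \<alpha> k (heis_sym \<beta> l u) =
    heis_sym \<beta> l (heis_sym \<alpha> k u) + cscale (if k + l = 0 then of_int k * pairing \<alpha> \<beta> else 0) u"
proof -
  have "heis_sym \<alpha> k (heis_sym \<beta> l u) =
      (\<Sum>i\<in>UNIV. \<Sum>j\<in>UNIV. cscale (\<alpha> $ i * \<beta> $ j) (osc_var i k (osc_var j l u)))"
    by (simp add: heis_sym_eq lin_sum[OF lin_osc_var] lin_scale[OF lin_osc_var] cs.scale_sum_right)
  also have "\<dots> = (\<Sum>i\<in>UNIV. \<Sum>j\<in>UNIV. cscale (\<alpha> $ i * \<beta> $ j) (osc_var j l (osc_var i k u))) +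
      (\<Sum>i\<in>UNIV. \<Sum>j\<in>UNIV. if i = j then cscale (if k + l = 0 then of_int k * (\<alpha> $ i * \<beta> $ i) else 0) u else 0)"
    unfolding sum.distrib[symmetric]
    by (intro sum.cong refl) (auto simp add: osc_var_commutator[OF assms] cs.scale_right_distrib mult_ac)
  also have "(\<Sum>i\<in>UNIV. \<Sum>j\<in>UNIV. if i = j then cscale (if k + l = 0 then of_int k * (\<alpha> $ i * \<beta> $ i) else 0) u else 0)
      = cscale (if k + l = 0 then of_int k * pairing \<alpha> \<beta> else 0) u"
    by (simp add: pairing_def cs.scale_sum_left sum_distrib_left)
  also have "(\<Sum>i\<in>UNIV. \<Sum>j\<in>UNIV. cscale (\<alpha> $ i * \<beta> $ j) (osc_var j l (osc_var i k u))) =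
      heis_sym \<beta> l (heis_sym \<alpha> k u)"
    by (subst sum.swap)
       (simp add: heis_sym_eq lin_sum[OF lin_osc_var] lin_scale[OF lin_osc_var] cs.scale_sum_right mult.commute)
  finally show ?thesis .
qed

lemma lin_heis: "lin (heis \<alpha> k)"
  unfolding heis_def by (auto intro: lin_lin_ext lin_tensor_op)

lemma heis_zero_basis: "heis \<alpha> 0 (basis (\<gamma>, p)) = cscale (pairing \<alpha> (of_lattice \<gamma>)) (basis (\<gamma>, p))"
  by (simp add: heis_def)

lemma heis_basis: "k \<noteq> 0 \<Longrightarrow> heis \<alpha> k (basis (\<gamma>, p)) = tensor (basis \<gamma>) (heis_sym \<alpha> k (basis p))"
  by (simp add: heis_def)

lemma heis_tensor: "k \<noteq> 0 \<Longrightarrow> heis \<alpha> k (tensor u v) = tensor u (heis_sym \<alpha> k v)"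
  by (simp add: heis_def tensor_op_tensor[OF lin_id' lin_heis_sym])

lemma heis_zero_tensor:
  "heis \<alpha> 0 (tensor (basis \<gamma>) u) = cscale (pairing \<alpha> (of_lattice \<gamma>)) (tensor (basis \<gamma>) u)"
  by (rule lin_eqI[of "\<lambda>u. heis \<alpha> 0 (tensor (basis \<gamma>) u)"])
     (auto intro: lin_compose[OF lin_heis lin_tensor_right] lin_scale_map lin_tensor_right
       simp: heis_zero_basis)

theorem heis_commutator:
  "heis \<alpha> k (heis \<beta> l v) =
    heis \<beta> l (heis \<alpha> k v) + cscale (if k + l = 0 then of_int k * pairing \<alpha> \<beta> else 0) v"
proof (rule lin_eqI[of "\<lambda>v. heis \<alpha> k (heis \<beta> l v)"])
  fix x :: "'a v_basis"
  obtain \<gamma> p where x: "x = (\<gamma>, p)" by force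
  show "heis \<alpha> k (heis \<beta> l (basis x)) = heis \<beta> l (heis \<alpha> k (basis x)) +
      cscale (if k + l = 0 then of_int k * pairing \<alpha> \<beta> else 0) (basis x)"
  proof (cases "k = 0 \<or> l = 0")
    case True
    then show ?thesis
      by (cases "k = 0"; cases "l = 0")
         (auto simp: x heis_zero_basis heis_basis heis_zero_tensor lin_scale[OF lin_heis] mult.commute)
  next
    case False
    then show ?thesis
      by (simp add: x heis_basis heis_tensor heis_sym_commutator[of k l \<alpha> \<beta>] lin_add[OF lin_tensor_right]
          lin_scale[OF lin_tensor_right])
  qed
qed (intro lin_add_map lin_scale_map lin_id lin_compose[OF lin_heis lin_heis])+

lemma heis_add: "heis (\<alpha> + \<beta>) k v = heis \<alpha> k v + heis \<beta> k v"
proof (rule lin_eqI[of "heis (\<alpha> + \<beta>) k"])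
  fix x :: "'a v_basis"
  obtain \<gamma> p where x: "x = (\<gamma>, p)" by force
  show "heis (\<alpha> + \<beta>) k (basis x) = heis \<alpha> k (basis x) + heis \<beta> k (basis x)"
    by (cases "k = 0")
       (simp_all add: x heis_zero_basis heis_basis heis_sym_eq pairing_def distrib_right
         cs.scale_left_distrib sum.distrib lin_add[OF lin_tensor_right])
qed (intro lin_add_map lin_heis)+

text \<open>The vertex operators involve \<open>\<alpha>(k)\<close> only for \<open>\<alpha>\<close> in the lattice.\<close>

definition osc :: "int ^ 'm \<Rightarrow> int \<Rightarrow> ('m::finite v_basis \<Rightarrow>\<^sub>0 complex) \<Rightarrow> ('m v_basis \<Rightarrow>\<^sub>0 complex)" where
  "osc \<alpha> = heis (of_lattice \<alpha>)"

lemma of_lattice_add: "of_lattice (\<alpha> + \<beta>) = of_lattice \<alpha> + of_lattice \<beta>"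
  by (simp add: of_lattice_def vec_eq_iff)

lemma pairing_of_lattice: "pairing (of_lattice \<alpha>) (of_lattice \<beta>) = of_int (pairing \<alpha> \<beta>)"
  by (simp add: of_lattice_def pairing_def)

lemma pairing_add_left: "pairing (\<alpha> + \<beta>) \<gamma> = pairing \<alpha> \<gamma> + pairing \<beta> \<gamma>"
  by (simp add: pairing_def distrib_right sum.distrib)

lemma pairing_add_right: "pairing \<alpha> (\<beta> + \<gamma>) = pairing \<alpha> \<beta> + pairing \<alpha> \<gamma>"
  by (simp add: pairing_def distrib_left sum.distrib)

lemma pairing_minus_left: "pairing (- \<alpha>) \<gamma> = - pairing \<alpha> \<gamma>"
  by (simp add: pairing_def sum_negf)

lemma pairing_minus_right: "pairing \<alpha> (- \<gamma>) = - pairing \<alpha> \<gamma>"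
  by (simp add: pairing_def sum_negf)

lemma pairing_diff_left: "pairing (\<alpha> - \<beta>) \<gamma> = pairing \<alpha> \<gamma> - pairing \<beta> \<gamma>"
  by (simp add: pairing_def left_diff_distrib sum_subtractf)

lemma pairing_diff_right: "pairing \<alpha> (\<beta> - \<gamma>) = pairing \<alpha> \<beta> - pairing \<alpha> \<gamma>"
  by (simp add: pairing_def right_diff_distrib sum_subtractf)

lemma pairing_commute: "pairing \<alpha> \<beta> = pairing \<beta> \<alpha>"
  by (simp add: pairing_def mult.commute)

lemma pairing_lat_e: "pairing (lat_e i) (lat_e j) = (if i = j then 1 else 0)"
proof -
  have "pairing (lat_e i) (lat_e j) = (\<Sum>a\<in>UNIV. if a = i then (if i = j then 1 else 0) else 0)"
    unfolding pairing_def by (rule sum.cong) (auto simp: lat_e_def axis_def)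
  then show ?thesis
    by simp
qed

lemma lin_osc: "lin (osc \<alpha> k)"
  unfolding osc_def by (rule lin_heis)

lemma osc_commutator:
  "osc \<alpha> k (osc \<beta> l v) =
    osc \<beta> l (osc \<alpha> k v) + cscale (if k + l = 0 then of_int (k * pairing \<alpha> \<beta>) else 0) v"
  unfolding osc_def by (subst heis_commutator) (simp add: pairing_of_lattice)

lemma osc_add: "osc (\<alpha> + \<beta>) k v = osc \<alpha> k v + osc \<beta> k v"
  by (simp add: osc_def of_lattice_add heis_add)


subsection \<open>The gradings of the lattice Fock space\<close>

text \<open>
  A vector supported in \<open>graded \<gamma> d\<close> is $e^\gamma \otimes u$ with all terms of \<open>u\<close> of energy at
  most \<open>d\<close>, where $e_i(-k)$ has energy \<open>k\<close>. For negative \<open>d\<close> only the zero vector is left;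
  this makes all sums over annihilation operators finite.
\<close>

definition energy :: "'m sym_basis \<Rightarrow> nat" where
  "energy q = (\<Sum>x\<in>Poly_Mapping.keys q. Poly_Mapping.lookup q x * Suc (snd x))"

definition graded :: "int ^ 'm \<Rightarrow> int \<Rightarrow> 'm v_basis set" where
  "graded \<gamma> d = {\<gamma>} \<times> {q. int (energy q) \<le> d}"

lemma energy_plus: "energy (p + q) = energy p + energy q"
  unfolding energy_def by (rule setsum_keys_plus_distrib) (auto simp: algebra_simps)

lemma energy_single: "energy (Poly_Mapping.single x 1) = Suc (snd x)"
  by (simp add: energy_def)

lemma energy_minus_single:
  assumes "Poly_Mapping.lookup q x \<noteq> 0"
  shows "energy q = Suc (snd x) + energy (q - Poly_Mapping.single x 1)"
proof -
  have "q = Poly_Mapping.single x 1 + (q - Poly_Mapping.single x 1)"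
    by (rule poly_mapping_eqI) (use assms in \<open>auto simp: lookup_add lookup_minus lookup_single when_def\<close>)
  then show ?thesis
    by (metis energy_plus energy_single)
qed

lemma keys_heis_sym:
  assumes "k \<noteq> 0" "int (energy q) \<le> d"
  shows "Poly_Mapping.keys (heis_sym \<alpha> k (basis q)) \<subseteq> {q. int (energy q) \<le> d - k}"
  unfolding heis_sym_eq
proof (intro keys_sum_subset keys_cscale_subset)
  fix i
  show "Poly_Mapping.keys (osc_var i k (basis q)) \<subseteq> {q. int (energy q) \<le> d - k}"
  proof (cases "k < 0 \<or> Poly_Mapping.lookup q (i, nat (k - 1)) = 0")
    case True
    then show ?thesis
      using assms by (auto simp: osc_var_def energy_plus energy_single[simplified])
  next
    case False
    then show ?thesis
      using assms energy_minus_single[of q "(i, nat (k - 1))"]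
      by (auto simp: osc_var_def intro!: keys_cscale_subset)
  qed
qed

lemma graded_negative: "d < 0 \<Longrightarrow> Poly_Mapping.keys v \<subseteq> graded \<gamma> d \<Longrightarrow> v = 0"
  by (auto simp: graded_def)

lemma basis_graded: "Poly_Mapping.keys (basis (\<gamma>, q)) \<subseteq> graded \<gamma> (int (energy q))"
  by (simp add: graded_def)

lemma osc_graded:
  assumes "Poly_Mapping.keys v \<subseteq> graded \<gamma> d"
  shows "Poly_Mapping.keys (osc \<alpha> k v) \<subseteq> graded \<gamma> (d - k)"
proof (rule keys_lin_subset[OF lin_osc _ assms])
  fix x assume "x \<in> graded \<gamma> d"
  then obtain q where x: "x = (\<gamma>, q)" "int (energy q) \<le> d"
    by (auto simp: graded_def)
  show "Poly_Mapping.keys (osc \<alpha> k (basis x)) \<subseteq> graded \<gamma> (d - k)"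
  proof (cases "k = 0")
    case True
    have "Poly_Mapping.keys (basis (\<gamma>, q)) \<subseteq> graded \<gamma> (d - k)"
      using x True by (auto simp: graded_def)
    then show ?thesis
      using True by (simp add: x osc_def heis_zero_basis keys_cscale_subset)
  next
    case False
    have "Poly_Mapping.keys (osc \<alpha> k (basis x)) \<subseteq>
        Poly_Mapping.keys (basis \<gamma>) \<times> Poly_Mapping.keys (heis_sym (of_lattice \<alpha>) k (basis q))"
      unfolding x osc_def heis_basis[OF False] by (rule keys_tensor)
    with keys_heis_sym[OF False x(2), of "of_lattice \<alpha>"] show ?thesis
      by (auto simp: graded_def)
  qed
qed

lemma osc_zero_mode:
  assumes "Poly_Mapping.keys v \<subseteq> graded \<gamma> d"
  shows "osc \<alpha> 0 v = cscale (of_int (pairing \<alpha> \<gamma>)) v"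
  by (rule lin_eqI_on[OF lin_osc lin_cscale _ assms])
     (auto simp: graded_def osc_def heis_zero_basis pairing_of_lattice)

lemma lin_e_op: "lin (e_op \<alpha>)"
  unfolding e_op_def by (rule lin_lin_ext)

lemma e_op_basis: "e_op \<alpha> (basis (\<gamma>, p)) = cscale (cocycle \<alpha> \<gamma>) (basis (\<alpha> + \<gamma>, p))"
  by (simp add: e_op_def)

lemma e_op_tensor:
  "e_op \<alpha> (tensor (basis \<gamma>) u) = cscale (cocycle \<alpha> \<gamma>) (tensor (basis (\<alpha> + \<gamma>)) u)"
  by (rule lin_eqI[of "\<lambda>u. e_op \<alpha> (tensor (basis \<gamma>) u)"])
     (auto intro: lin_compose[OF lin_e_op lin_tensor_right] lin_scale_map lin_tensor_right
       simp: e_op_basis)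

lemma e_op_graded:
  assumes "Poly_Mapping.keys v \<subseteq> graded \<gamma> d"
  shows "Poly_Mapping.keys (e_op \<alpha> v) \<subseteq> graded (\<alpha> + \<gamma>) d"
  by (rule keys_lin_subset[OF lin_e_op _ assms])
     (auto simp: graded_def e_op_basis in_keys_iff lookup_basis split: if_splits)

lemma e_op_e_op: "e_op \<alpha> (e_op \<beta> v) = cscale (cocycle \<alpha> \<beta>) (e_op (\<alpha> + \<beta>) v)"
  by (rule lin_eqI[of "\<lambda>v. e_op \<alpha> (e_op \<beta> v)"])
     (auto intro: lin_compose[OF lin_e_op lin_e_op] lin_scale_map lin_e_op
       simp: e_op_basis lin_scale[OF lin_e_op] cocycle_add_left cocycle_add_right add_ac mult_ac)

lemma cocycle_zero_left [simp]: "cocycle 0 \<gamma> = 1"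
  by (simp add: cocycle_def)

lemma e_op_zero: "e_op 0 v = v"
  by (rule lin_eqI[of "e_op 0"]) (auto intro: lin_e_op lin_id simp: e_op_basis)

lemma osc_e_op:
  assumes "k \<noteq> 0"
  shows "osc \<alpha> k (e_op \<beta> v) = e_op \<beta> (osc \<alpha> k v)"
  by (rule lin_eqI[of "\<lambda>v. osc \<alpha> k (e_op \<beta> v)"])
     (use assms in \<open>auto intro: lin_compose[OF lin_heis lin_e_op] lin_compose[OF lin_e_op lin_heis]
       simp: osc_def e_op_basis lin_scale[OF lin_heis] heis_basis e_op_tensor\<close>)

lemma lin_z_op: "lin (z_op \<alpha> s)"
  unfolding z_op_def by (rule lin_lin_ext)

lemma z_op_graded:
  assumes "Poly_Mapping.keys v \<subseteq> graded \<gamma> d"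
  shows "z_op \<alpha> s v = (if pairing \<alpha> \<gamma> = s then v else 0)"
  by (rule lin_eqI_on[OF lin_z_op lin_if_map[OF lin_id lin_zero_map] _ assms])
     (auto simp: graded_def z_op_def)

section \<open>Exponentials of commuting series of operators\<close>

lemma sum_triangle_swap:
  fixes f :: "nat \<Rightarrow> nat \<Rightarrow> 'a::comm_monoid_add"
  shows "(\<Sum>k=1..n. \<Sum>j=1..n-k. f k j) = (\<Sum>j=1..n. \<Sum>k=1..n-j. f k j)"
proof -
  have 1: "{j \<in> {1..n}. k + j \<le> n} = {1..n-k}" if "k \<in> {1..n}" for k
    using that by auto
  have 2: "{k \<in> {1..n}. k + j \<le> n} = {1..n-j}" if "j \<in> {1..n}" for j
    using that by auto
  have "(\<Sum>k=1..n. \<Sum>j=1..n-k. f k j) = (\<Sum>k\<in>{1..n}. \<Sum>j\<in>{j \<in> {1..n}. k + j \<le> n}. f k j)"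
    by (intro sum.cong refl 1[symmetric])
  also have "\<dots> = (\<Sum>j\<in>{1..n}. \<Sum>k\<in>{k \<in> {1..n}. k + j \<le> n}. f k j)"
    by (rule sum.swap_restrict) auto
  also have "\<dots> = (\<Sum>j=1..n. \<Sum>k=1..n-j. f k j)"
    by (intro sum.cong refl 2)
  finally show ?thesis .
qed

lemma sum_triangle_swap0:
  fixes f :: "nat \<Rightarrow> nat \<Rightarrow> 'a::comm_monoid_add"
  shows "(\<Sum>k=1..n. \<Sum>j\<le>n-k. f k j) = (\<Sum>j\<le>n. \<Sum>k=1..n-j. f k j)"
proof -
  have 1: "{j \<in> {..n}. k + j \<le> n} = {..n-k}" if "k \<in> {1..n}" for k
    using that by auto
  have 2: "{k \<in> {1..n}. k + j \<le> n} = {1..n-j}" if "j \<in> {..n}" for j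
    using that by auto
  have "(\<Sum>k=1..n. \<Sum>j\<le>n-k. f k j) = (\<Sum>k\<in>{1..n}. \<Sum>j\<in>{j \<in> {..n}. k + j \<le> n}. f k j)"
    by (intro sum.cong refl 1[symmetric])
  also have "\<dots> = (\<Sum>j\<in>{..n}. \<Sum>k\<in>{k \<in> {1..n}. k + j \<le> n}. f k j)"
    by (rule sum.swap_restrict) auto
  also have "\<dots> = (\<Sum>j\<le>n. \<Sum>k=1..n-j. f k j)"
    by (intro sum.cong refl 2)
  finally show ?thesis .
qed

lemma lin_series_power:
  assumes "\<And>k. lin (A k)"
  shows "lin (series_power A l n)"
proof (induction l arbitrary: n)
  case 0
  have "series_power A 0 n = (\<lambda>v. if n = 0 then v else 0)"
    by auto
  then show ?case
    by (simp add: lin_intros del: series_power.simps)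
next
  case (Suc l)
  have "series_power A (Suc l) n = (\<lambda>v. \<Sum>k=1..n. A k (series_power A l (n - k) v))"
    by auto
  then show ?case
    using lin_compose[OF assms Suc] by (simp add: lin_sum_map del: series_power.simps)
qed

lemma lin_series_exp:
  assumes "\<And>k. lin (A k)"
  shows "lin (series_exp A n)"
  unfolding series_exp_def[abs_def] by (intro lin_sum_map lin_scale_map lin_series_power assms)

lemma series_power_commute:
  assumes f: "lin f" and "\<And>k v. k \<ge> 1 \<Longrightarrow> f (A k v) = A k (f v)"
  shows "f (series_power A l n v) = series_power A l n (f v)"
  by (induction l arbitrary: n) (auto simp: lin_0[OF f] lin_sum[OF f] assms(2) intro!: sum.cong)

lemma series_exp_commute:
  assumes f: "lin f" and "\<And>k v. k \<ge> 1 \<Longrightarrow> f (A k v) = A k (f v)"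
  shows "f (series_exp A n v) = series_exp A n (f v)"
  by (simp add: series_exp_def lin_sum[OF f] lin_scale[OF f] series_power_commute[of f A, OF assms])

lemma series_exp_zero: "series_exp A 0 v = v"
  by (simp add: series_exp_def)

lemma series_power_eq_0:
  assumes "\<And>k. lin (A k)"
  shows "n < l \<Longrightarrow> series_power A l n v = 0"
proof (induction l arbitrary: n)
  case (Suc l)
  have "A k (series_power A l (n - k) v) = 0" if "k \<in> {1..n}" for k
  proof -
    have "n - k < l"
      using Suc.prems that by auto
    then show ?thesis
      by (simp add: Suc.IH lin_0[OF assms])
  qed
  then show ?case
    by simp
qed simp

text \<open>
  The operator $w\frac{d}{dw}$ applied to the power $B^{l+1}$ of $B = \sum_k A_k w^k$ gives
  $(l+1)\,(w B') B^l$, because the coefficients of \<open>B\<close> commute.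
\<close>

lemma series_power_deriv:
  assumes lin: "\<And>k. lin (A k)"
    and comm: "\<And>k l v. k \<ge> 1 \<Longrightarrow> l \<ge> 1 \<Longrightarrow> A k (A l v) = A l (A k v)"
  shows "cscale (of_nat n) (series_power A (Suc l) n v) =
    cscale (of_nat (Suc l)) (\<Sum>k=1..n. cscale (of_nat k) (A k (series_power A l (n - k) v)))"
proof (induction l arbitrary: n)
  case 0
  have "cscale (of_nat n) (A k (series_power A 0 (n - k) v)) = cscale (of_nat k) (A k (series_power A 0 (n - k) v))"
    if "k \<in> {1..n}" for k
    using that by (cases "k = n") (auto simp: lin_0[OF lin])
  then have "(\<Sum>k=1..n. cscale (of_nat n) (A k (series_power A 0 (n - k) v))) =
      (\<Sum>k=1..n. cscale (of_nat k) (A k (series_power A 0 (n - k) v)))"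
    by (intro sum.cong refl)
  then show ?case
    by (simp add: cs.scale_sum_right del: series_power.simps(1))
next
  case (Suc l)
  let ?P = "\<lambda>l n. series_power A l n v"
  let ?S = "\<Sum>k=1..n. cscale (of_nat k) (A k (?P (Suc l) (n - k)))"
  have split: "cscale (of_nat n) w = cscale (of_nat k) w + cscale (of_nat (n - k)) w"
    if "k \<in> {1..n}" for k and w :: "'a \<Rightarrow>\<^sub>0 complex"
    using that by (simp add: cs.scale_left_distrib[symmetric] of_nat_diff)
  have "cscale (of_nat n) (?P (Suc (Suc l)) n) =
      (\<Sum>k=1..n. cscale (of_nat n) (A k (?P (Suc l) (n - k))))"
    by (subst series_power.simps(2)) (simp add: cs.scale_sum_right del: series_power.simps)
  also have "\<dots> = (\<Sum>k=1..n. cscale (of_nat k) (A k (?P (Suc l) (n - k))) +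
      A k (cscale (of_nat (n - k)) (?P (Suc l) (n - k))))"
    by (intro sum.cong refl) (simp add: split lin_scale[OF lin] del: series_power.simps)
  also have "\<dots> = ?S + (\<Sum>k=1..n. A k (cscale (of_nat (n - k)) (?P (Suc l) (n - k))))"
    by (rule sum.distrib)
  also have "(\<Sum>k=1..n. A k (cscale (of_nat (n - k)) (?P (Suc l) (n - k)))) =
      cscale (of_nat (Suc l)) (\<Sum>k=1..n. \<Sum>j=1..n-k. cscale (of_nat j) (A k (A j (?P l (n - k - j)))))"
    unfolding Suc.IH by (simp add: cs.scale_sum_right lin_scale[OF lin] lin_sum[OF lin] del: series_power.simps)
  also have "(\<Sum>k=1..n. \<Sum>j=1..n-k. cscale (of_nat j) (A k (A j (?P l (n - k - j))))) =
      (\<Sum>j=1..n. \<Sum>k=1..n-j. cscale (of_nat j) (A j (A k (?P l (n - j - k)))))"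
    by (subst sum_triangle_swap, intro sum.cong refl)
       (subst comm, auto simp: add.commute simp del: series_power.simps)
  also have "\<dots> = ?S"
    by (simp add: lin_sum[OF lin] cs.scale_sum_right)
  finally have "cscale (of_nat n) (?P (Suc (Suc l)) n) = ?S + cscale (of_nat (Suc l)) ?S" .
  then show ?case
    by (simp only: of_nat_Suc[of "Suc l"] cs.scale_left_distrib cs.scale_one)
qed

text \<open>
  For $X = \exp B$ this is $w X' = (w B') X$, obtained from the powers of \<open>B\<close> term by term.
\<close>

lemma series_exp_rec:
  assumes lin: "\<And>k. lin (A k)"
    and comm: "\<And>k l v. k \<ge> 1 \<Longrightarrow> l \<ge> 1 \<Longrightarrow> A k (A l v) = A l (A k v)"
  shows "cscale (of_nat n) (series_exp A n v) =
    (\<Sum>k=1..n. cscale (of_nat k) (A k (series_exp A (n - k) v)))"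
proof (cases n)
  case (Suc n')
  let ?P = "\<lambda>l n. series_power A l n v"
  have inv_fact: "1 / fact (Suc l) * of_nat (Suc l) = (1 / fact l :: complex)" for l
    by (simp add: fact_Suc divide_simps del: of_nat_Suc)
  have trunc: "series_exp A (n - k) v = (\<Sum>l\<le>n'. cscale (1 / fact l) (?P l (n - k)))" if "k \<ge> 1" for k
    unfolding series_exp_def
    by (rule sum.mono_neutral_left) (use that Suc in \<open>auto simp: series_power_eq_0[OF lin]\<close>)
  have "cscale (of_nat n) (series_exp A n v) = (\<Sum>l\<le>n'. cscale (1 / fact (Suc l)) (cscale (of_nat n) (?P (Suc l) n)))"
    unfolding series_exp_def Suc sum.atMost_Suc_shift
    by (simp add: cs.scale_sum_right mult.commute del: series_power.simps(2) of_nat_Suc fact_Suc)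
  also have "\<dots> = (\<Sum>l\<le>n'. cscale (1 / fact l) (\<Sum>k=1..n. cscale (of_nat k) (A k (?P l (n - k)))))"
    by (intro sum.cong refl) (simp only: series_power_deriv[of A, OF lin comm] cs.scale_scale inv_fact)
  also have "\<dots> = (\<Sum>k=1..n. cscale (of_nat k) (A k (\<Sum>l\<le>n'. cscale (1 / fact l) (?P l (n - k)))))"
    by (simp add: cs.scale_sum_right lin_sum[OF lin] lin_scale[OF lin] mult.commute sum.swap[of _ "{..n'}"])
  also have "\<dots> = (\<Sum>k=1..n. cscale (of_nat k) (A k (series_exp A (n - k) v)))"
    by (intro sum.cong refl) (simp add: trunc)
  finally show ?thesis .
qed simp

text \<open>
  The recursion that expresses $w X' = (w B') X$ determines the coefficients of \<open>X\<close>
  from the constant one.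
\<close>

lemma log_deriv_unique:
  assumes "X 0 = Y 0"
    and "\<And>n. n \<ge> 1 \<Longrightarrow> cscale (of_nat n) (X n) = (\<Sum>k=1..n. G k (X (n - k)))"
    and "\<And>n. n \<ge> 1 \<Longrightarrow> cscale (of_nat n) (Y n) = (\<Sum>k=1..n. G k (Y (n - k)))"
  shows "X n = Y n"
proof (induction n rule: less_induct)
  case (less n)
  show ?case
  proof (cases "n = 0")
    case False
    have "(\<Sum>k=1..n. G k (X (n - k))) = (\<Sum>k=1..n. G k (Y (n - k)))"
      using less by (intro sum.cong) auto
    then have "cscale (of_nat n) (X n) = cscale (of_nat n) (Y n)"
      using assms(2,3)[of n] False by simp
    then show ?thesis
      using False by simp
  qed (simp add: assms(1))
qed

text \<open>
  Both sides have constant coefficient \<open>v\<close> and satisfy the recursion of \<open>log_deriv_unique\<close> for \<open>A + B\<close>.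
\<close>

lemma series_exp_add:
  assumes linA: "\<And>k. lin (A k)" and linB: "\<And>k. lin (B k)"
    and AA: "\<And>k l v. k \<ge> 1 \<Longrightarrow> l \<ge> 1 \<Longrightarrow> A k (A l v) = A l (A k v)"
    and BB: "\<And>k l v. k \<ge> 1 \<Longrightarrow> l \<ge> 1 \<Longrightarrow> B k (B l v) = B l (B k v)"
    and AB: "\<And>k l v. k \<ge> 1 \<Longrightarrow> l \<ge> 1 \<Longrightarrow> A k (B l v) = B l (A k v)"
    and C: "\<And>k v. k \<ge> 1 \<Longrightarrow> C k v = A k v + B k v" and linC: "\<And>k. lin (C k)"
  shows "series_exp C n v = (\<Sum>a\<le>n. series_exp A a (series_exp B (n - a) v))"
proof (rule log_deriv_unique[where G = "\<lambda>k w. cscale (of_nat k) (A k w + B k w)"])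
  have CC: "C k (C l v) = C l (C k v)" if "k \<ge> 1" "l \<ge> 1" for k l v
    using that by (simp add: C lin_add[OF linA] lin_add[OF linB] AA[of k l] BB[of k l] AB[of k l] AB[of l k] add_ac)
  show "cscale (of_nat n) (series_exp C n v) =
      (\<Sum>k=1..n. cscale (of_nat k) (A k (series_exp C (n - k) v) + B k (series_exp C (n - k) v)))" for n
    by (subst series_exp_rec[OF linC CC]) (auto simp: C intro!: sum.cong)
next
  show "series_exp C 0 v = (\<Sum>a\<le>0. series_exp A a (series_exp B (0 - a) v))"
    by (simp add: series_exp_zero)
next
  fix n
  let ?X = "series_exp A" and ?Y = "\<lambda>n. series_exp B n v"
  have linX: "lin (?X a)" for a
    by (rule lin_series_exp[OF linA])
  have XB: "?X a (B k w) = B k (?X a w)" if "k \<ge> 1" for a k w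
    by (rule series_exp_commute[OF linB, symmetric]) (use AB that in auto)
  have split: "cscale (of_nat n) w = cscale (of_nat a) w + cscale (of_nat (n - a)) w"
    if "a \<le> n" for a and w :: "'a \<Rightarrow>\<^sub>0 complex"
    using that by (simp add: cs.scale_left_distrib[symmetric] of_nat_diff)
  have "cscale (of_nat n) (\<Sum>a\<le>n. ?X a (?Y (n - a))) =
      (\<Sum>a\<le>n. cscale (of_nat a) (?X a (?Y (n - a)))) + (\<Sum>a\<le>n. ?X a (cscale (of_nat (n - a)) (?Y (n - a))))"
    by (simp add: cs.scale_sum_right split[of _ "w" for w] lin_scale[OF linX] sum.distrib cong: sum.cong_simp)
  also have "(\<Sum>a\<le>n. cscale (of_nat a) (?X a (?Y (n - a)))) =
      (\<Sum>a\<le>n. cscale (of_nat (n - a)) (?X (n - a) (?Y a)))"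
    by (rule sum.reindex_bij_witness[of _ "\<lambda>a. n - a" "\<lambda>a. n - a"]) auto
  also have "\<dots> = (\<Sum>a\<le>n. \<Sum>k=1..n-a. cscale (of_nat k) (A k (?X (n - a - k) (?Y a))))"
    by (simp only: series_exp_rec[of A, OF linA AA])
  also have "\<dots> = (\<Sum>k=1..n. \<Sum>a\<le>n-k. cscale (of_nat k) (A k (?X (n - k - a) (?Y a))))"
    by (subst sum_triangle_swap0) (simp add: add.commute)
  also have "\<dots> = (\<Sum>k=1..n. cscale (of_nat k) (A k (\<Sum>a\<le>n-k. ?X a (?Y (n - k - a)))))"
  proof (rule sum.cong[OF refl])
    fix k
    have "(\<Sum>a\<le>n-k. ?X (n - k - a) (?Y a)) = (\<Sum>a\<le>n-k. ?X a (?Y (n - k - a)))"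
      by (rule sum.reindex_bij_witness[of _ "\<lambda>a. n - k - a" "\<lambda>a. n - k - a"])
         (auto simp del: diff_diff_left)
    then show "(\<Sum>a\<le>n-k. cscale (of_nat k) (A k (?X (n - k - a) (?Y a)))) =
        cscale (of_nat k) (A k (\<Sum>a\<le>n-k. ?X a (?Y (n - k - a))))"
      by (simp flip: cs.scale_sum_right lin_sum[OF linA])
  qed
  also have "(\<Sum>a\<le>n. ?X a (cscale (of_nat (n - a)) (?Y (n - a)))) =
      (\<Sum>a\<le>n. \<Sum>k=1..n-a. cscale (of_nat k) (B k (?X a (?Y (n - k - a)))))"
    by (simp only: series_exp_rec[of B, OF linB BB] lin_sum[OF linX] lin_scale[OF linX])
       (intro sum.cong refl, simp add: XB add.commute)
  also have "\<dots> = (\<Sum>k=1..n. cscale (of_nat k) (B k (\<Sum>a\<le>n-k. ?X a (?Y (n - k - a)))))"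
    by (subst sum_triangle_swap0[symmetric]) (simp add: lin_sum[OF linB] cs.scale_sum_right)
  finally show "cscale (of_nat n) (\<Sum>a\<le>n. ?X a (?Y (n - a))) =
      (\<Sum>k=1..n. cscale (of_nat k) (A k (\<Sum>a\<le>n-k. ?X a (?Y (n - k - a))) +
        B k (\<Sum>a\<le>n-k. ?X a (?Y (n - k - a)))))"
    by (simp add: cs.scale_right_distrib sum.distrib)
qed

section \<open>The exponentials in the vertex operators\<close>

lemma T_coeff_eq: "T_coeff \<alpha> n v = cscale (- 1 / of_int n) (osc \<alpha> n v)"
  by (simp add: T_coeff_def osc_def)

lemma lin_T_coeff: "lin (T_coeff \<alpha> n)"
  unfolding T_coeff_eq[abs_def] by (intro lin_scale_map lin_osc)

lemma osc_same_sign: "k + l \<noteq> 0 \<Longrightarrow> osc \<alpha> k (osc \<beta> l v) = osc \<beta> l (osc \<alpha> k v)"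
  using osc_commutator[of \<alpha> k \<beta> l v] by simp

lemma T_coeff_commute: "k + l \<noteq> 0 \<Longrightarrow> T_coeff \<alpha> k (T_coeff \<beta> l v) = T_coeff \<beta> l (T_coeff \<alpha> k v)"
  by (simp add: T_coeff_eq lin_scale[OF lin_osc] lin_neg[OF lin_osc] osc_same_sign[of k l \<alpha> \<beta>] mult.commute)

lemma T_coeff_add: "T_coeff (\<alpha> + \<beta>) n v = T_coeff \<alpha> n v + T_coeff \<beta> n v"
  by (simp add: T_coeff_eq osc_add cs.scale_right_distrib)

lemma lin_exp_minus: "lin (exp_minus \<alpha> n)"
  unfolding exp_minus_def by (intro lin_series_exp lin_T_coeff)

lemma lin_exp_plus: "lin (exp_plus \<alpha> n)"
  unfolding exp_plus_def by (intro lin_series_exp lin_T_coeff)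

lemma exp_minus_commute:
  assumes "lin f" "\<And>k v. k \<ge> 1 \<Longrightarrow> f (osc \<alpha> (- int k) v) = osc \<alpha> (- int k) (f v)"
  shows "f (exp_minus \<alpha> n v) = exp_minus \<alpha> n (f v)"
  unfolding exp_minus_def
  by (rule series_exp_commute[OF assms(1)]) (simp add: T_coeff_eq lin_scale[OF assms(1)] lin_neg[OF assms(1)] assms(2))

lemma exp_plus_commute:
  assumes "lin f" "\<And>k v. k \<ge> 1 \<Longrightarrow> f (osc \<alpha> (int k) v) = osc \<alpha> (int k) (f v)"
  shows "f (exp_plus \<alpha> n v) = exp_plus \<alpha> n (f v)"
  unfolding exp_plus_def
  by (rule series_exp_commute[OF assms(1)]) (simp add: T_coeff_eq lin_scale[OF assms(1)] lin_neg[OF assms(1)] assms(2))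

lemma exp_minus_rec:
  "cscale (of_nat n) (exp_minus \<alpha> n v) = (\<Sum>k=1..n. osc \<alpha> (- int k) (exp_minus \<alpha> (n - k) v))"
  unfolding exp_minus_def
  by (subst series_exp_rec[OF lin_T_coeff T_coeff_commute]) (auto intro!: sum.cong simp: T_coeff_eq)

lemma exp_plus_rec:
  "cscale (of_nat n) (exp_plus \<alpha> n v) = - (\<Sum>k=1..n. osc \<alpha> (int k) (exp_plus \<alpha> (n - k) v))"
  unfolding exp_plus_def sum_negf[symmetric]
  by (subst series_exp_rec[OF lin_T_coeff T_coeff_commute]) (auto intro!: sum.cong simp: T_coeff_eq)

lemma exp_minus_0 [simp]: "exp_minus \<alpha> 0 v = v"
  by (simp add: exp_minus_def series_exp_zero)

lemma exp_plus_0 [simp]: "exp_plus \<alpha> 0 v = v"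
  by (simp add: exp_plus_def series_exp_zero)

lemma exp_minus_add:
  "exp_minus (\<alpha> + \<beta>) n v = (\<Sum>a\<le>n. exp_minus \<alpha> a (exp_minus \<beta> (n - a) v))"
  unfolding exp_minus_def
  by (rule series_exp_add) (auto intro: lin_T_coeff T_coeff_commute simp: T_coeff_add)

lemma exp_plus_add:
  "exp_plus (\<alpha> + \<beta>) n v = (\<Sum>a\<le>n. exp_plus \<alpha> a (exp_plus \<beta> (n - a) v))"
  unfolding exp_plus_def
  by (rule series_exp_add) (auto intro: lin_T_coeff T_coeff_commute simp: T_coeff_add)

lemma of_lattice_zero [simp]: "of_lattice 0 = 0"
  by (simp add: of_lattice_def vec_eq_iff)

lemma osc_zero: "osc 0 k v = 0"
  using osc_add[of 0 0 k v] by simp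

lemma exp_minus_zero: "exp_minus 0 n v = (if n = 0 then v else 0)"
proof (cases n)
  case (Suc m)
  have "cscale (of_nat n) (exp_minus 0 n v) = 0"
    by (subst exp_minus_rec) (simp add: osc_zero)
  then show ?thesis
    using Suc by (simp del: of_nat_Suc)
qed simp

lemma exp_plus_zero: "exp_plus 0 n v = (if n = 0 then v else 0)"
proof (cases n)
  case (Suc m)
  have "cscale (of_nat n) (exp_plus 0 n v) = 0"
    by (subst exp_plus_rec) (simp add: osc_zero)
  then show ?thesis
    using Suc by (simp del: of_nat_Suc)
qed simp

lemma exp_minus_graded:
  assumes "Poly_Mapping.keys v \<subseteq> graded \<gamma> d"
  shows "Poly_Mapping.keys (exp_minus \<alpha> n v) \<subseteq> graded \<gamma> (d + int n)"
proof (induction n rule: less_induct)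
  case (less n)
  show ?case
  proof (cases "n = 0")
    case False
    have "exp_minus \<alpha> n v = cscale (1 / of_nat n) (cscale (of_nat n) (exp_minus \<alpha> n v))"
      using False by simp
    also have "Poly_Mapping.keys \<dots> \<subseteq> graded \<gamma> (d + int n)"
      unfolding exp_minus_rec
    proof (intro keys_cscale_subset keys_sum_subset)
      fix k assume k: "k \<in> {1..n}"
      have "Poly_Mapping.keys (osc \<alpha> (- int k) (exp_minus \<alpha> (n - k) v)) \<subseteq> graded \<gamma> (d + int (n - k) - (- int k))"
        by (rule osc_graded, rule less.IH) (use k in auto)
      then show "Poly_Mapping.keys (osc \<alpha> (- int k) (exp_minus \<alpha> (n - k) v)) \<subseteq> graded \<gamma> (d + int n)"
        using k by (simp add: of_nat_diff)
    qed
    finally show ?thesis .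
  qed (use assms in simp)
qed

lemma exp_plus_graded:
  assumes "Poly_Mapping.keys v \<subseteq> graded \<gamma> d"
  shows "Poly_Mapping.keys (exp_plus \<alpha> n v) \<subseteq> graded \<gamma> (d - int n)"
proof (induction n rule: less_induct)
  case (less n)
  show ?case
  proof (cases "n = 0")
    case False
    have "exp_plus \<alpha> n v = cscale (- 1 / of_nat n) (- cscale (of_nat n) (exp_plus \<alpha> n v))"
      using False by simp
    also have "Poly_Mapping.keys \<dots> \<subseteq> graded \<gamma> (d - int n)"
      unfolding exp_plus_rec minus_minus
    proof (intro keys_cscale_subset keys_sum_subset)
      fix k assume k: "k \<in> {1..n}"
      have "Poly_Mapping.keys (osc \<alpha> (int k) (exp_plus \<alpha> (n - k) v)) \<subseteq> graded \<gamma> (d - int (n - k) - int k)"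
        by (rule osc_graded, rule less.IH) (use k in auto)
      then show "Poly_Mapping.keys (osc \<alpha> (int k) (exp_plus \<alpha> (n - k) v)) \<subseteq> graded \<gamma> (d - int n)"
        using k by (simp add: of_nat_diff)
    qed
    finally show ?thesis .
  qed (use assms in simp)
qed

lemma exp_minus_exp_minus:
  "exp_minus \<alpha> a (exp_minus \<beta> b v) = exp_minus \<beta> b (exp_minus \<alpha> a v)"
  by (intro exp_minus_commute lin_exp_minus exp_minus_commute[symmetric] lin_osc osc_same_sign) auto

lemma exp_plus_exp_plus:
  "exp_plus \<alpha> a (exp_plus \<beta> b v) = exp_plus \<beta> b (exp_plus \<alpha> a v)"
  by (intro exp_plus_commute lin_exp_plus exp_plus_commute[symmetric] lin_osc osc_same_sign) auto

lemma e_op_exp_minus: "e_op \<alpha> (exp_minus \<beta> b v) = exp_minus \<beta> b (e_op \<alpha> v)"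
  by (rule exp_minus_commute[OF lin_e_op]) (auto simp: osc_e_op)

lemma e_op_exp_plus: "e_op \<alpha> (exp_plus \<beta> b v) = exp_plus \<beta> b (e_op \<alpha> v)"
  by (rule exp_plus_commute[OF lin_e_op]) (auto simp: osc_e_op)

text \<open>
  The coefficients of $\exp T_-$ are extended by zero to all integers, so that the index shifts
  caused by $z^{\alpha(0)}$ need no case distinctions.
\<close>

definition exp_minus_int :: "int ^ 'm \<Rightarrow> int \<Rightarrow> ('m::finite v_basis \<Rightarrow>\<^sub>0 complex) \<Rightarrow> ('m v_basis \<Rightarrow>\<^sub>0 complex)" where
  "exp_minus_int \<alpha> a v = (if a < 0 then 0 else exp_minus \<alpha> (nat a) v)"

lemma lin_exp_minus_int: "lin (exp_minus_int \<alpha> a)"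
  unfolding exp_minus_int_def[abs_def] by (intro lin_if_map lin_zero_map lin_exp_minus)

lemma exp_minus_int_negative: "a < 0 \<Longrightarrow> exp_minus_int \<alpha> a v = 0"
  by (simp add: exp_minus_int_def)

lemma exp_minus_int_nat: "exp_minus_int \<alpha> (int a) v = exp_minus \<alpha> a v"
  by (simp add: exp_minus_int_def)

lemma exp_minus_int_commute:
  "exp_minus_int \<alpha> a (exp_minus_int \<beta> b v) = exp_minus_int \<beta> b (exp_minus_int \<alpha> a v)"
  by (simp add: exp_minus_int_def exp_minus_exp_minus[of \<alpha> _ \<beta>] lin_0[OF lin_exp_minus])

lemma e_op_exp_minus_int: "e_op \<alpha> (exp_minus_int \<beta> b v) = exp_minus_int \<beta> b (e_op \<alpha> v)"
  by (simp add: exp_minus_int_def e_op_exp_minus lin_0[OF lin_e_op])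

lemma exp_minus_int_graded:
  assumes "Poly_Mapping.keys v \<subseteq> graded \<gamma> d"
  shows "Poly_Mapping.keys (exp_minus_int \<alpha> a v) \<subseteq> graded \<gamma> (d + a)"
  using exp_minus_graded[OF assms, of \<alpha> "nat a"] by (auto simp: exp_minus_int_def)

text \<open>
  Since the coefficients at negative indices vanish, the recursion may be summed up to any \<open>n \<ge> x\<close>.
\<close>

lemma exp_minus_int_rec:
  assumes "x \<le> int n"
  shows "(\<Sum>k=1..n. osc \<alpha> (- int k) (exp_minus_int \<alpha> (x - int k) v)) = cscale (of_int x) (exp_minus_int \<alpha> x v)"
proof (cases "x < 0")
  case False
  then obtain m where x: "x = int m"
    using nat_0_le by (metis linorder_not_less)
  have "(\<Sum>k=1..n. osc \<alpha> (- int k) (exp_minus_int \<alpha> (x - int k) v)) =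
      (\<Sum>k=1..m. osc \<alpha> (- int k) (exp_minus_int \<alpha> (x - int k) v))"
    using assms by (intro sum.mono_neutral_right) (auto simp: x exp_minus_int_negative lin_0[OF lin_osc])
  also have "\<dots> = (\<Sum>k=1..m. osc \<alpha> (- int k) (exp_minus \<alpha> (m - k) v))"
    by (intro sum.cong refl) (auto simp: x exp_minus_int_nat simp flip: of_nat_diff)
  also have "\<dots> = cscale (of_nat m) (exp_minus \<alpha> m v)"
    by (rule exp_minus_rec[symmetric])
  finally show ?thesis
    by (simp add: x exp_minus_int_nat)
qed (simp add: exp_minus_int_negative lin_0[OF lin_osc])

lemma exp_minus_int_add:
  "(\<Sum>a=0..x. exp_minus_int \<alpha> a (exp_minus_int \<beta> (x - a) v)) = exp_minus_int (\<alpha> + \<beta>) x v"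
proof (cases "x < 0")
  case False
  then obtain m where x: "x = int m"
    using nat_0_le by (metis linorder_not_less)
  have "(\<Sum>a=0..x. exp_minus_int \<alpha> a (exp_minus_int \<beta> (x - a) v)) =
      (\<Sum>a\<le>m. exp_minus \<alpha> a (exp_minus \<beta> (m - a) v))"
    by (rule sum.reindex_bij_witness[of _ int nat]) (auto simp: x exp_minus_int_def nat_diff_distrib)
  then show ?thesis
    by (simp add: exp_minus_add x exp_minus_int_nat)
qed (simp add: exp_minus_int_negative)

lemma exp_minus_int_zero: "exp_minus_int 0 a v = (if a = 0 then v else 0)"
  by (simp add: exp_minus_int_def exp_minus_zero)

text \<open>
  $\exp T_-(\beta,w)$ is multiplication by $\exp(\sum_{k>0} \frac1k \beta(-k) w^k)$, on which the
  derivation $\alpha(k)$ acts as multiplication by $(\alpha,\beta) w^k$.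
\<close>

lemma osc_exp_minus:
  assumes k: "k \<ge> 1"
  shows "osc \<alpha> (int k) (exp_minus \<beta> n v) =
    exp_minus \<beta> n (osc \<alpha> (int k) v) + cscale (of_int (pairing \<alpha> \<beta>)) (exp_minus_int \<beta> (int n - int k) v)"
proof (induction n rule: less_induct)
  case (less n)
  let ?c = "of_int (pairing \<alpha> \<beta>) :: complex"
  show ?case
  proof (cases "n = 0")
    case False
    have "cscale (of_nat n) (osc \<alpha> (int k) (exp_minus \<beta> n v)) =
        (\<Sum>l=1..n. osc \<alpha> (int k) (osc \<beta> (- int l) (exp_minus \<beta> (n - l) v)))"
      by (simp only: lin_scale[OF lin_osc, symmetric] exp_minus_rec lin_sum[OF lin_osc])
    also have "\<dots> = (\<Sum>l=1..n. osc \<beta> (- int l) (osc \<alpha> (int k) (exp_minus \<beta> (n - l) v)) +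
        (if l = k then cscale (of_nat k * ?c) (exp_minus \<beta> (n - k) v) else 0))"
      by (subst osc_commutator) (intro sum.cong refl, auto)
    also have "\<dots> = (\<Sum>l=1..n. osc \<beta> (- int l) (exp_minus \<beta> (n - l) (osc \<alpha> (int k) v)) +
        cscale ?c (osc \<beta> (- int l) (exp_minus_int \<beta> (int n - int k - int l) v)) +
        (if l = k then cscale (of_nat k * ?c) (exp_minus \<beta> (n - k) v) else 0))"
    proof (rule sum.cong[OF refl])
      fix l assume l: "l \<in> {1..n}"
      then have "int (n - l) - int k = int n - int k - int l"
        by auto
      then show "osc \<beta> (- int l) (osc \<alpha> (int k) (exp_minus \<beta> (n - l) v)) +
          (if l = k then cscale (of_nat k * ?c) (exp_minus \<beta> (n - k) v) else 0) =
        osc \<beta> (- int l) (exp_minus \<beta> (n - l) (osc \<alpha> (int k) v)) +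
        cscale ?c (osc \<beta> (- int l) (exp_minus_int \<beta> (int n - int k - int l) v)) +
        (if l = k then cscale (of_nat k * ?c) (exp_minus \<beta> (n - k) v) else 0)"
        using less.IH[of "n - l"] l by (simp add: lin_add[OF lin_osc] lin_scale[OF lin_osc] cancel_ab_semigroup_add_class.diff_right_commute[of "int n" "int l"])
    qed
    also have "\<dots> = cscale (of_nat n) (exp_minus \<beta> n (osc \<alpha> (int k) v)) +
        cscale ?c (\<Sum>l=1..n. osc \<beta> (- int l) (exp_minus_int \<beta> (int n - int k - int l) v)) +
        (if k \<le> n then cscale (of_nat k * ?c) (exp_minus \<beta> (n - k) v) else 0)"
      using k by (simp add: sum.distrib exp_minus_rec cs.scale_sum_right)
    also have "(if k \<le> n then cscale (of_nat k * ?c) (exp_minus \<beta> (n - k) v) else 0) =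
        cscale (of_nat k * ?c) (exp_minus_int \<beta> (int n - int k) v)"
      by (auto simp: exp_minus_int_negative exp_minus_int_nat simp flip: of_nat_diff)
    also have "(\<Sum>l=1..n. osc \<beta> (- int l) (exp_minus_int \<beta> (int n - int k - int l) v)) =
        cscale (of_int (int n - int k)) (exp_minus_int \<beta> (int n - int k) v)"
      by (rule exp_minus_int_rec) simp
    finally have "cscale (of_nat n) (osc \<alpha> (int k) (exp_minus \<beta> n v)) = cscale (of_nat n)
        (exp_minus \<beta> n (osc \<alpha> (int k) v) + cscale ?c (exp_minus_int \<beta> (int n - int k) v))"
      by (simp add: cs.scale_right_distrib cs.scale_left_diff_distrib algebra_simps)
    then show ?thesis
      using False by simp
  qed (use k in \<open>simp add: exp_minus_int_negative\<close>)
qed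

lemma osc_exp_minus_int:
  assumes "k \<ge> 1"
  shows "osc \<alpha> (int k) (exp_minus_int \<beta> a v) =
    exp_minus_int \<beta> a (osc \<alpha> (int k) v) + cscale (of_int (pairing \<alpha> \<beta>)) (exp_minus_int \<beta> (a - int k) v)"
proof (cases "a < 0")
  case False
  then show ?thesis
    using osc_exp_minus[OF assms, of \<alpha> \<beta> "nat a" v] by (simp add: exp_minus_int_def)
qed (simp add: exp_minus_int_negative lin_0[OF lin_osc])


subsection \<open>The exchange relation\<close>

text \<open>The coefficient of $t^j$ in $(1 - t)^c$.\<close>

definition binom_coeff :: "int \<Rightarrow> nat \<Rightarrow> complex" where
  "binom_coeff c j = (-1) ^ j * (of_int c gchoose j)"

text \<open>This is $t\frac{d}{dt}(1-t)^c = -c\,\frac{t}{1-t}\,(1-t)^c$.\<close>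

lemma binom_coeff_rec: "of_nat j * binom_coeff c j = - of_int c * (\<Sum>i<j. binom_coeff c i)"
proof (cases j)
  case (Suc m)
  have "(\<Sum>i<j. binom_coeff c i) = (-1) ^ m * ((of_int c - 1) gchoose m)"
    using gbinomial_sum_lower_neg[of "of_int c :: complex" m]
    by (simp add: Suc lessThan_Suc_atMost binom_coeff_def mult.commute)
  moreover have "of_nat j * (of_int c gchoose j) = (of_int c :: complex) * ((of_int c - 1) gchoose m)"
    unfolding Suc by (rule gbinomial_absorption)
  ultimately show ?thesis
    by (simp add: binom_coeff_def Suc mult.left_commute[of "of_nat (Suc m)"] del: of_nat_Suc)
qed simp

lemma binom_coeff_0 [simp]: "binom_coeff c 0 = 1"
  by (simp add: binom_coeff_def)

text \<open>
  $\exp T_+(\alpha,z)\,\exp T_-(\beta,w) = (1 - w/z)^{(\alpha,\beta)}\,\exp T_-(\beta,w)\,\exp T_+(\alpha,z)$: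
  as series in $u = z^{-1}$, both sides equal $\exp T_-(\beta,w)$ at \<open>u = 0\<close> and both are solutions
  of $u X' = - \bigl(\sum_{k>0} \alpha(k) u^k\bigr) X$.
\<close>

theorem exp_plus_exp_minus_int:
  "exp_plus \<alpha> b (exp_minus_int \<beta> a v) =
    (\<Sum>j\<le>b. cscale (binom_coeff (pairing \<alpha> \<beta>) j) (exp_minus_int \<beta> (a - int j) (exp_plus \<alpha> (b - j) v)))"
proof (rule log_deriv_unique[where G = "\<lambda>k w. - osc \<alpha> (int k) w"])
  show "exp_plus \<alpha> 0 (exp_minus_int \<beta> a v) = (\<Sum>j\<le>0. cscale (binom_coeff (pairing \<alpha> \<beta>) j)
      (exp_minus_int \<beta> (a - int j) (exp_plus \<alpha> (0 - j) v)))"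
    by simp
next
  fix n
  show "cscale (of_nat n) (exp_plus \<alpha> n (exp_minus_int \<beta> a v)) =
      (\<Sum>k=1..n. - osc \<alpha> (int k) (exp_plus \<alpha> (n - k) (exp_minus_int \<beta> a v)))"
    by (simp add: exp_plus_rec sum_negf)
next
  fix n
  let ?c = "of_int (pairing \<alpha> \<beta>) :: complex"
  let ?C = "binom_coeff (pairing \<alpha> \<beta>)"
  let ?E = "\<lambda>j. exp_minus_int \<beta> (a - int j)" and ?D = "\<lambda>b. exp_plus \<alpha> b v"
  have "(\<Sum>k=1..n. - osc \<alpha> (int k) (\<Sum>j\<le>n-k. cscale (?C j) (?E j (?D (n - k - j))))) =
      - (\<Sum>k=1..n. \<Sum>j\<le>n-k. cscale (?C j) (?E j (osc \<alpha> (int k) (?D (n - k - j)))) +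
          cscale (?c * ?C j) (?E (j + k) (?D (n - k - j))))"
    unfolding sum_negf
    by (intro arg_cong[of _ _ uminus] sum.cong refl)
       (simp add: lin_sum[OF lin_osc] lin_scale[OF lin_osc] osc_exp_minus_int cs.scale_right_distrib
         algebra_simps)
  also have "\<dots> = - (\<Sum>k=1..n. \<Sum>j\<le>n-k. cscale (?C j) (?E j (osc \<alpha> (int k) (?D (n - k - j))))) -
      (\<Sum>k=1..n. \<Sum>j\<le>n-k. cscale (?c * ?C j) (?E (j + k) (?D (n - k - j))))"
    by (simp add: sum.distrib)
  also have "- (\<Sum>k=1..n. \<Sum>j\<le>n-k. cscale (?C j) (?E j (osc \<alpha> (int k) (?D (n - k - j))))) =
      (\<Sum>j\<le>n. cscale (?C j) (?E j (- (\<Sum>k=1..n-j. osc \<alpha> (int k) (?D (n - j - k))))))"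
    by (subst sum_triangle_swap0)
       (simp add: lin_sum[OF lin_exp_minus_int] lin_neg[OF lin_exp_minus_int] cs.scale_sum_right
         sum_negf add.commute)
  also have "\<dots> = (\<Sum>j\<le>n. cscale (of_nat (n - j) * ?C j) (?E j (?D (n - j))))"
    by (simp only: exp_plus_rec[symmetric] lin_scale[OF lin_exp_minus_int] cs.scale_scale mult.commute)
  also have "(\<Sum>k=1..n. \<Sum>j\<le>n-k. cscale (?c * ?C j) (?E (j + k) (?D (n - k - j)))) =
      (\<Sum>j\<le>n. \<Sum>k=1..n-j. cscale (?c * ?C j) (?E (j + k) (?D (n - (j + k)))))"
    by (subst sum_triangle_swap0) (simp add: add.commute)
  also have "\<dots> = (\<Sum>j\<le>n. \<Sum>i\<in>{i\<in>{..n}. j < i}. cscale (?c * ?C j) (?E i (?D (n - i))))"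
  proof (rule sum.cong[OF refl])
    fix j
    show "(\<Sum>k=1..n-j. cscale (?c * ?C j) (?E (j + k) (?D (n - (j + k))))) =
        (\<Sum>i\<in>{i\<in>{..n}. j < i}. cscale (?c * ?C j) (?E i (?D (n - i))))"
      by (rule sum.reindex_bij_witness[of _ "\<lambda>i. i - j" "\<lambda>k. j + k"]) auto
  qed
  also have "\<dots> = (\<Sum>i\<le>n. \<Sum>j\<in>{j\<in>{..n}. j < i}. cscale (?c * ?C j) (?E i (?D (n - i))))"
    by (rule sum.swap_restrict) auto
  also have "\<dots> = (\<Sum>i\<le>n. cscale (?c * (\<Sum>j<i. ?C j)) (?E i (?D (n - i))))"
  proof (rule sum.cong[OF refl])
    fix i assume "i \<in> {..n}"
    then have "{j\<in>{..n}. j < i} = {..<i}"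
      by auto
    then show "(\<Sum>j\<in>{j\<in>{..n}. j < i}. cscale (?c * ?C j) (?E i (?D (n - i)))) =
        cscale (?c * (\<Sum>j<i. ?C j)) (?E i (?D (n - i)))"
      by (simp add: sum_distrib_left cs.scale_sum_left)
  qed
  also have "(\<Sum>j\<le>n. cscale (of_nat (n - j) * ?C j) (?E j (?D (n - j)))) -
      (\<Sum>i\<le>n. cscale (?c * (\<Sum>j<i. ?C j)) (?E i (?D (n - i)))) =
      (\<Sum>j\<le>n. cscale (of_nat (n - j) * ?C j - ?c * (\<Sum>i<j. ?C i)) (?E j (?D (n - j))))"
    by (simp add: cs.scale_left_diff_distrib sum_subtractf)
  also have "\<dots> = (\<Sum>j\<le>n. cscale (of_nat n * ?C j) (?E j (?D (n - j))))"
  proof (rule sum.cong[OF refl])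
    fix j assume "j \<in> {..n}"
    then have "of_nat (n - j) * ?C j - ?c * (\<Sum>i<j. ?C i) = of_nat n * ?C j"
      using binom_coeff_rec[of j "pairing \<alpha> \<beta>"] by (simp add: of_nat_diff algebra_simps)
    then show "cscale (of_nat (n - j) * ?C j - ?c * (\<Sum>i<j. ?C i)) (?E j (?D (n - j))) =
        cscale (of_nat n * ?C j) (?E j (?D (n - j)))"
      by simp
  qed
  finally show "cscale (of_nat n) (\<Sum>j\<le>n. cscale (?C j) (?E j (?D (n - j)))) =
      (\<Sum>k=1..n. - osc \<alpha> (int k) (\<Sum>j\<le>n-k. cscale (?C j) (?E j (?D (n - k - j)))))"
    by (simp add: cs.scale_sum_right)
qed

section \<open>Locally finite families of operators\<close>

lemma finite_support_basis:
  assumes "\<And>i. lin (F i)" "\<And>x. finite {i. F i (basis x) \<noteq> 0}"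
  shows "finite {i. F i v \<noteq> 0}"
proof (rule finite_subset)
  show "{i. F i v \<noteq> 0} \<subseteq> (\<Union>x\<in>Poly_Mapping.keys v. {i. F i (basis x) \<noteq> 0})"
  proof
    fix i assume "i \<in> {i. F i v \<noteq> 0}"
    then have "lin_ext (\<lambda>x. F i (basis x)) v \<noteq> 0"
      using lin_eq_lin_ext[OF assms(1), of i v] by simp
    then obtain x where "x \<in> Poly_Mapping.keys v" "cscale (Poly_Mapping.lookup v x) (F i (basis x)) \<noteq> 0"
      unfolding lin_ext_def by (meson sum.not_neutral_contains_not_neutral)
    then show "i \<in> (\<Union>x\<in>Poly_Mapping.keys v. {i. F i (basis x) \<noteq> 0})"
      by auto
  qed
qed (use assms(2) in auto)

lemma lin_Sum_any:
  assumes "\<And>i. lin (F i)" "\<And>x. finite {i. F i (basis x) \<noteq> 0}"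
  shows "lin (\<lambda>v. Sum_any (\<lambda>i. F i v))"
proof (rule linI)
  note fin = finite_support_basis[of F, OF assms]
  fix u v
  show "Sum_any (\<lambda>i. F i (u + v)) = Sum_any (\<lambda>i. F i u) + Sum_any (\<lambda>i. F i v)"
    by (simp add: lin_add[OF assms(1)] Sum_any.distrib fin)
next
  note fin = finite_support_basis[of F, OF assms]
  fix c v
  have "Sum_any (\<lambda>i. F i (cscale c v)) = (\<Sum>i\<in>{i. F i v \<noteq> 0}. F i (cscale c v))"
    by (rule Sum_any.expand_superset) (use fin in \<open>auto simp: lin_scale[OF assms(1)]\<close>)
  then show "Sum_any (\<lambda>i. F i (cscale c v)) = cscale c (Sum_any (\<lambda>i. F i v))"
    by (simp add: Sum_any.expand_set lin_scale[OF assms(1)] cs.scale_sum_right)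
qed

lemma lin_of_Sum_any:
  assumes f: "lin f" and "finite {i. g i \<noteq> 0}"
  shows "f (Sum_any g) = Sum_any (\<lambda>i. f (g i))"
proof -
  have "Sum_any (\<lambda>i. f (g i)) = (\<Sum>i\<in>{i. g i \<noteq> 0}. f (g i))"
    by (rule Sum_any.expand_superset) (use assms(2) in \<open>auto simp: lin_0[OF f]\<close>)
  then show ?thesis
    by (simp add: Sum_any.expand_set lin_sum[OF f])
qed

lemma eventually_zero_basis:
  fixes F :: "int \<Rightarrow> ('b \<Rightarrow>\<^sub>0 complex) \<Rightarrow> ('c \<Rightarrow>\<^sub>0 complex)"
  assumes "\<And>n. lin (F n)" "\<And>x. \<exists>K. \<forall>n>K. F n (basis x) = 0"
  shows "\<exists>K. \<forall>n>K. F n v = 0"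
proof -
  obtain k where k: "F n (basis x) = 0" if "n > k x" for n x
    using assms(2) by metis
  have "F n v = 0" if n: "n > Max (insert 0 (k ` Poly_Mapping.keys v))" for n
  proof -
    have "F n (basis x) = 0" if "x \<in> Poly_Mapping.keys v" for x
      using n that by (intro k) auto
    then show ?thesis
      unfolding lin_eq_lin_ext[OF assms(1), of n v] lin_ext_def by simp
  qed
  then show ?thesis
    by blast
qed


section \<open>Vertex operators\<close>

text \<open>
  On the weight space of \<open>\<gamma>\<close> the operator $z^{\alpha(0)}$ is the scalar $z^{(\alpha,\gamma)}$, which determines the
  degree in the creation operators from the degree \<open>b\<close> in the annihilation operators. The latter is at most \<open>B\<close>,
  because the energy of \<open>v\<close> is.
\<close>

lemma Y_coeff_eq:
  assumes v: "Poly_Mapping.keys v \<subseteq> graded \<gamma> d" and B: "d \<le> int B"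
  shows "Y_coeff \<alpha> n v =
    (\<Sum>b\<le>B. e_op \<alpha> (exp_minus_int \<alpha> (int b - n - pairing \<alpha> \<gamma>) (exp_plus \<alpha> b v)))"
proof -
  let ?t = "\<lambda>(a, b). e_op \<alpha> (z_op \<alpha> (int b - int a - n) (exp_minus \<alpha> a (exp_plus \<alpha> b v)))"
  let ?g = "\<lambda>b. (nat (int b - n - pairing \<alpha> \<gamma>), b)"
  have z: "?t (a, b) = (if pairing \<alpha> \<gamma> = int b - int a - n
      then e_op \<alpha> (exp_minus \<alpha> a (exp_plus \<alpha> b v)) else 0)" for a b
    using z_op_graded[OF exp_minus_graded[OF exp_plus_graded[OF v]], of \<alpha> "int b - int a - n" \<alpha> a \<alpha> b]
    by (simp add: lin_0[OF lin_e_op])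
  have zero: "exp_plus \<alpha> b v = 0" if "b > B" for b
    by (rule graded_negative[OF _ exp_plus_graded[OF v]]) (use that B in simp)
  have "Y_coeff \<alpha> n v = Sum_any ?t"
    by (simp add: Y_coeff_def)
  also have "\<dots> = sum ?t (?g ` {..B})"
  proof (rule Sum_any.expand_superset)
    show "{x. ?t x \<noteq> 0} \<subseteq> ?g ` {..B}"
    proof
      fix x assume x: "x \<in> {x. ?t x \<noteq> 0}"
      obtain a b where ab: "x = (a, b)" by force
      then have "?t (a, b) \<noteq> 0"
        using x by simp
      then have *: "pairing \<alpha> \<gamma> = int b - int a - n"
          "e_op \<alpha> (exp_minus \<alpha> a (exp_plus \<alpha> b v)) \<noteq> 0"
        unfolding z by (auto split: if_splits)
      moreover have "b \<le> B"
      proof (rule ccontr)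
        assume "\<not> b \<le> B"
        then show False
          using *(2) by (simp add: zero lin_0[OF lin_exp_minus] lin_0[OF lin_e_op])
      qed
      ultimately show "x \<in> ?g ` {..B}"
        using ab by (intro image_eqI[of _ _ b]) auto
    qed
  qed simp
  also have "\<dots> = (\<Sum>b\<le>B. ?t (?g b))"
    by (subst sum.reindex) (auto simp: inj_on_def o_def)
  also have "\<dots> = (\<Sum>b\<le>B. e_op \<alpha> (exp_minus_int \<alpha> (int b - n - pairing \<alpha> \<gamma>) (exp_plus \<alpha> b v)))"
    by (intro sum.cong refl) (auto simp: z[simplified] exp_minus_int_def lin_0[OF lin_e_op])
  finally show ?thesis .
qed

lemma lin_Y_coeff: "lin (Y_coeff \<alpha> n)"
proof -
  let ?F = "\<lambda>(a, b) v. e_op \<alpha> (z_op \<alpha> (int b - int a - n) (exp_minus \<alpha> a (exp_plus \<alpha> b v)))"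
  have "Y_coeff \<alpha> n = (\<lambda>v. Sum_any (\<lambda>i. ?F i v))"
    by (simp add: Y_coeff_def fun_eq_iff case_prod_unfold)
  moreover have "lin (\<lambda>v. Sum_any (\<lambda>i. ?F i v))"
  proof (rule lin_Sum_any)
    show "lin (?F i)" for i
      using lin_compose[OF lin_e_op lin_compose[OF lin_z_op lin_compose[OF lin_exp_minus lin_exp_plus]]]
      by (cases i) simp
  next
    fix x :: "'a v_basis"
    obtain \<gamma> q where x: "x = (\<gamma>, q)" by force
    note v = basis_graded[of \<gamma> q]
    have "{i. ?F i (basis x) \<noteq> 0} \<subseteq> (\<lambda>b. (nat (int b - n - pairing \<alpha> \<gamma>), b)) ` {..energy q}"
    proof
      fix i assume i: "i \<in> {i. ?F i (basis x) \<noteq> 0}"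
      obtain a b where ab: "i = (a, b)" by force
      have nz: "e_op \<alpha> (z_op \<alpha> (int b - int a - n) (exp_minus \<alpha> a (exp_plus \<alpha> b (basis x)))) \<noteq> 0"
        using i ab by simp
      then have "exp_plus \<alpha> b (basis x) \<noteq> 0"
        by (metis lin_0[OF lin_exp_minus] lin_0[OF lin_e_op] lin_0[OF lin_z_op])
      then have "b \<le> energy q"
        using graded_negative[OF _ exp_plus_graded[OF v], of b \<alpha>] x by fastforce
      moreover have "pairing \<alpha> \<gamma> = int b - int a - n"
        using nz z_op_graded[OF exp_minus_graded[OF exp_plus_graded[OF v]], of \<alpha> "int b - int a - n" \<alpha> a \<alpha> b]
        by (auto simp: x lin_0[OF lin_e_op] split: if_splits)
      ultimately show "i \<in> (\<lambda>b. (nat (int b - n - pairing \<alpha> \<gamma>), b)) ` {..energy q}"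
        using ab by (intro image_eqI[of _ _ b]) auto
    qed
    then show "finite {i. ?F i (basis x) \<noteq> 0}"
      by (rule finite_subset) simp
  qed
  ultimately show ?thesis
    by simp
qed

lemma Y_coeff_graded:
  assumes v: "Poly_Mapping.keys v \<subseteq> graded \<gamma> d"
  shows "Poly_Mapping.keys (Y_coeff \<alpha> n v) \<subseteq> graded (\<alpha> + \<gamma>) (d - n - pairing \<alpha> \<gamma>)"
proof -
  have "d \<le> int (nat d)" by simp
  have "Poly_Mapping.keys (e_op \<alpha> (exp_minus_int \<alpha> (int b - n - pairing \<alpha> \<gamma>) (exp_plus \<alpha> b v)))
      \<subseteq> graded (\<alpha> + \<gamma>) (d - int b + (int b - n - pairing \<alpha> \<gamma>))" for b
    by (intro e_op_graded exp_minus_int_graded exp_plus_graded v)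
  then show ?thesis
    unfolding Y_coeff_eq[OF v \<open>d \<le> int (nat d)\<close>] by (intro keys_sum_subset) (simp add: algebra_simps)
qed

lemma Y_coeff_eventually_zero: "\<exists>K. \<forall>n>K. Y_coeff \<alpha> n v = 0"
proof (rule eventually_zero_basis[OF lin_Y_coeff])
  fix x :: "'a v_basis"
  obtain \<gamma> q where x: "x = (\<gamma>, q)" by force
  have "Y_coeff \<alpha> n (basis x) = 0" if "n > int (energy q) - pairing \<alpha> \<gamma>" for n
    using graded_negative[OF _ Y_coeff_graded[OF basis_graded[of \<gamma> q]], of n \<alpha>] that x by simp
  then show "\<exists>K. \<forall>n>K. Y_coeff \<alpha> n (basis x) = 0"
    by blast
qed

lemma sum_diagonal_truncate:
  fixes f :: "nat \<Rightarrow> nat \<Rightarrow> 'a::comm_monoid_add"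
  assumes "\<And>j i. j > J \<or> i > B \<Longrightarrow> f j i = 0" and "B + J \<le> C"
  shows "(\<Sum>b\<le>C. \<Sum>j\<le>b. f j (b - j)) = (\<Sum>i\<le>B. \<Sum>j\<le>J. f j i)"
proof -
  have fin: "finite {(j, i). j + i \<le> C}"
    by (rule finite_subset[of _ "{..C} \<times> {..C}"]) auto
  have "(\<Sum>b\<le>C. \<Sum>j\<le>b. f j (b - j)) = (\<Sum>(j,i)\<in>{(j,i). j + i \<le> C}. f j i)"
    by (simp add: sum.triangle_reindex_eq)
  also have "\<dots> = (\<Sum>(j,i)\<in>{..J} \<times> {..B}. f j i)"
  proof (rule sum.mono_neutral_right[OF fin])
    show "{..J} \<times> {..B} \<subseteq> {(j, i). j + i \<le> C}"
      using assms(2) by auto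
    show "\<forall>p\<in>{(j, i). j + i \<le> C} - {..J} \<times> {..B}. (case p of (j, i) \<Rightarrow> f j i) = 0"
    proof
      fix p assume p: "p \<in> {(j, i). j + i \<le> C} - {..J} \<times> {..B}"
      obtain j i where ji: "p = (j, i)" by force
      with p have "j > J \<or> i > B"
        by auto
      then show "(case p of (j, i) \<Rightarrow> f j i) = 0"
        using assms(1) by (simp add: ji)
    qed
  qed
  also have "\<dots> = (\<Sum>i\<le>B. \<Sum>j\<le>J. f j i)"
    by (simp add: sum.cartesian_product[symmetric] sum.swap[of _ "{..J}"])
  finally show ?thesis .
qed

text \<open>
  This is $Y(\alpha,z)Y(\beta,w) = F(\alpha,\beta)\,(z-w)^{(\alpha,\beta)}\,e^{\alpha+\beta} z^{\alpha(0)} w^{\beta(0)}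
  \exp T_-(\alpha,z) \exp T_-(\beta,w) \exp T_+(\alpha,z) \exp T_+(\beta,w)$, expanded in $|z|>|w|$.
  The bounds \<open>B\<close> and \<open>J\<close> only cut off vanishing terms.
\<close>

theorem Y_coeff_product:
  assumes v: "Poly_Mapping.keys v \<subseteq> graded \<gamma> d" and B: "d \<le> int B"
    and J: "int B - n - pairing \<beta> \<gamma> \<le> int J"
  shows "Y_coeff \<alpha> m (Y_coeff \<beta> n v) = cscale (cocycle \<alpha> \<beta>) (e_op (\<alpha> + \<beta>)
    (\<Sum>b\<le>B. \<Sum>b'\<le>B. \<Sum>j\<le>J. cscale (binom_coeff (pairing \<alpha> \<beta>) j)
      (exp_minus_int \<alpha> (int b - m - pairing \<alpha> \<gamma> + int j - pairing \<alpha> \<beta>)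
        (exp_minus_int \<beta> (int b' - n - pairing \<beta> \<gamma> - int j)
          (exp_plus \<alpha> b (exp_plus \<beta> b' v))))))"
proof -
  let ?c = "pairing \<alpha> \<beta>" and ?E = "exp_minus_int" and ?D = "exp_plus"
  define x where "x b = int b - m - pairing \<alpha> \<gamma> - ?c" for b :: nat
  define y where "y b = int b - n - pairing \<beta> \<gamma>" for b :: nat
  \<comment> \<open>Large enough for the vector \<open>Y\<^sub>n(\<beta>) v\<close>, and for the square \<open>i \<le> B\<close>, \<open>j \<le> J\<close> to lie in the
    triangle \<open>i + j \<le> C\<close>.\<close>
  define C where "C = nat (max (d - n - pairing \<beta> \<gamma>) (int B + int J))"
  have C: "d - n - pairing \<beta> \<gamma> \<le> int C" "B + J \<le> C"
    unfolding C_def by auto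
  define f where "f b' j i = cscale (binom_coeff ?c j)
      (?E \<alpha> (x (i + j)) (?E \<beta> (y b' - int j) (?D \<alpha> i (?D \<beta> b' v))))" for b' j i
  have f0: "f b' j i = 0" if "b' \<le> B" "j > J \<or> i > B" for b' j i
    using that(2)
  proof
    assume "j > J"
    then have "y b' - int j < 0"
      using J that(1) by (simp add: y_def)
    then show ?thesis
      by (simp add: f_def exp_minus_int_negative lin_0[OF lin_exp_minus_int])
  next
    assume "i > B"
    then have "?D \<alpha> i (?D \<beta> b' v) = 0"
      by (intro graded_negative[OF _ exp_plus_graded[OF exp_plus_graded[OF v]]]) (use B in simp)
    then show ?thesis
      by (simp add: f_def lin_0[OF lin_exp_minus_int])
  qed
  have w: "Y_coeff \<beta> n v = (\<Sum>b'\<le>B. e_op \<beta> (?E \<beta> (y b') (?D \<beta> b' v)))"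
    using Y_coeff_eq[OF v B] by (simp add: y_def)
  have "Y_coeff \<alpha> m (Y_coeff \<beta> n v) = (\<Sum>b\<le>C. e_op \<alpha> (?E \<alpha> (x b) (?D \<alpha> b (Y_coeff \<beta> n v))))"
    using Y_coeff_eq[OF Y_coeff_graded[OF v] C(1)]
    by (simp add: x_def pairing_add_right algebra_simps)
  also have "\<dots> = (\<Sum>b\<le>C. \<Sum>b'\<le>B. e_op \<alpha> (?E \<alpha> (x b) (?D \<alpha> b (e_op \<beta> (?E \<beta> (y b') (?D \<beta> b' v))))))"
    by (simp add: w lin_sum[OF lin_e_op] lin_sum[OF lin_exp_minus_int] lin_sum[OF lin_exp_plus])
  also have "\<dots> = (\<Sum>b\<le>C. \<Sum>b'\<le>B. e_op \<alpha> (e_op \<beta> (\<Sum>j\<le>b. f b' j (b - j))))"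
  proof (intro sum.cong refl)
    fix b b'
    have "?E \<alpha> (x b) (?D \<alpha> b (?E \<beta> (y b') (?D \<beta> b' v))) = (\<Sum>j\<le>b. f b' j (b - j))"
      unfolding exp_plus_exp_minus_int lin_sum[OF lin_exp_minus_int] lin_scale[OF lin_exp_minus_int] f_def
      by (intro sum.cong refl) simp
    then show "e_op \<alpha> (?E \<alpha> (x b) (?D \<alpha> b (e_op \<beta> (?E \<beta> (y b') (?D \<beta> b' v))))) =
        e_op \<alpha> (e_op \<beta> (\<Sum>j\<le>b. f b' j (b - j)))"
      by (simp flip: e_op_exp_plus e_op_exp_minus_int)
  qed
  also have "\<dots> = e_op \<alpha> (e_op \<beta> (\<Sum>b'\<le>B. \<Sum>b\<le>C. \<Sum>j\<le>b. f b' j (b - j)))"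
    by (simp add: lin_sum[OF lin_e_op] sum.swap[of _ "{..C}"])
  also have "(\<Sum>b'\<le>B. \<Sum>b\<le>C. \<Sum>j\<le>b. f b' j (b - j)) = (\<Sum>b'\<le>B. \<Sum>i\<le>B. \<Sum>j\<le>J. f b' j i)"
    by (intro sum.cong refl sum_diagonal_truncate C(2)) (auto simp: f0)
  also have "\<dots> = (\<Sum>i\<le>B. \<Sum>b'\<le>B. \<Sum>j\<le>J. f b' j i)"
    by (rule sum.swap)
  finally show ?thesis
    by (simp add: e_op_e_op f_def x_def y_def algebra_simps)
qed

lemma gbinomial_minus_one: "((-1::complex) gchoose j) = (-1) ^ j"
  using gbinomial_minus[of "1::complex" j] by (simp flip: binomial_gbinomial)

lemma binom_coeff_simps:
  "binom_coeff 0 j = (if j = 0 then 1 else 0)"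
  "binom_coeff 1 j = (if j = 0 then 1 else if j = 1 then -1 else 0)"
  "binom_coeff (-1) j = 1"
proof -
  show "binom_coeff 0 j = (if j = 0 then 1 else 0)"
    by (cases j) (auto simp: binom_coeff_def)
  have "(1 gchoose j) = (of_nat (1 choose j) :: complex)"
    by (simp add: binomial_gbinomial)
  then show "binom_coeff 1 j = (if j = 0 then 1 else if j = 1 then -1 else 0)"
    by (auto simp: binom_coeff_def binomial_eq_0)
  show "binom_coeff (-1) j = 1"
    by (simp add: binom_coeff_def gbinomial_minus_one flip: power_mult_distrib)
qed

lemma bound_exists: "\<exists>B. d \<le> int B \<and> e \<le> int B"
  by (rule exI[of _ "nat (max d e)"]) auto

lemma Y_coeff_product_0:
  assumes v: "Poly_Mapping.keys v \<subseteq> graded \<gamma> d" and B: "d \<le> int B" and c: "pairing \<alpha> \<beta> = 0"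
  shows "Y_coeff \<alpha> m (Y_coeff \<beta> n v) = cscale (cocycle \<alpha> \<beta>) (e_op (\<alpha> + \<beta>)
    (\<Sum>b\<le>B. \<Sum>b'\<le>B. exp_minus_int \<alpha> (int b - m - pairing \<alpha> \<gamma>)
        (exp_minus_int \<beta> (int b' - n - pairing \<beta> \<gamma>) (exp_plus \<alpha> b (exp_plus \<beta> b' v)))))"
proof -
  obtain J where J: "int B - n - pairing \<beta> \<gamma> \<le> int J"
    using bound_exists by blast
  have "cscale (if j = 0 then 1 else 0) u = (if j = 0 then u else 0)" for j :: nat and u :: "'a v_basis \<Rightarrow>\<^sub>0 complex"
    by simp
  then show ?thesis
    by (simp add: Y_coeff_product[OF v B J] c binom_coeff_simps)
qed

lemma Y_coeff_product_1:
  assumes v: "Poly_Mapping.keys v \<subseteq> graded \<gamma> d" and B: "d \<le> int B" and c: "pairing \<alpha> \<beta> = 1"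
  shows "Y_coeff \<alpha> m (Y_coeff \<beta> n v) = cscale (cocycle \<alpha> \<beta>) (e_op (\<alpha> + \<beta>)
    (\<Sum>b\<le>B. \<Sum>b'\<le>B. exp_minus_int \<alpha> (int b - m - pairing \<alpha> \<gamma> - 1)
        (exp_minus_int \<beta> (int b' - n - pairing \<beta> \<gamma>) (exp_plus \<alpha> b (exp_plus \<beta> b' v))) -
      exp_minus_int \<alpha> (int b - m - pairing \<alpha> \<gamma>)
        (exp_minus_int \<beta> (int b' - n - pairing \<beta> \<gamma> - 1) (exp_plus \<alpha> b (exp_plus \<beta> b' v)))))"
proof -
  obtain J where J: "int B - n - pairing \<beta> \<gamma> \<le> int J" "1 \<le> int J"
    using bound_exists by blast
  have "(\<Sum>j\<le>J. cscale (binom_coeff 1 j) (g j)) = g 0 - g 1" for g :: "nat \<Rightarrow> 'a v_basis \<Rightarrow>\<^sub>0 complex"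
  proof -
    have "(\<Sum>j\<le>J. cscale (binom_coeff 1 j) (g j)) = (\<Sum>j\<in>{0,1}. cscale (binom_coeff 1 j) (g j))"
      by (rule sum.mono_neutral_right) (use J in \<open>auto simp: binom_coeff_simps\<close>)
    then show ?thesis
      by (simp add: binom_coeff_simps)
  qed
  then show ?thesis
    by (simp add: Y_coeff_product[OF v B J(1)] c)
qed

lemma Y_coeff_exchange_graded:
  assumes v: "Poly_Mapping.keys v \<subseteq> graded \<gamma> d" and c: "pairing \<alpha> \<beta> \<in> {0, 1}"
  shows "cscale (cocycle \<beta> \<alpha>) (Y_coeff \<alpha> m (Y_coeff \<beta> n v)) =
    cscale ((-1) powi pairing \<alpha> \<beta> * cocycle \<alpha> \<beta>) (Y_coeff \<beta> n (Y_coeff \<alpha> m v))"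
proof -
  obtain B where B: "d \<le> int B"
    using bound_exists by blast
  let ?x = "\<lambda>b. int b - m - pairing \<alpha> \<gamma>" and ?y = "\<lambda>b. int b - n - pairing \<beta> \<gamma>"
  let ?E = exp_minus_int and ?D = exp_plus
  show ?thesis
  proof (cases "pairing \<alpha> \<beta> = 0")
    case True
    have "(\<Sum>b\<le>B. \<Sum>b'\<le>B. ?E \<alpha> (?x b) (?E \<beta> (?y b') (?D \<alpha> b (?D \<beta> b' v)))) =
        (\<Sum>b'\<le>B. \<Sum>b\<le>B. ?E \<beta> (?y b') (?E \<alpha> (?x b) (?D \<beta> b' (?D \<alpha> b v))))"
      by (subst sum.swap) (simp only: exp_minus_int_commute[of \<alpha> _ \<beta>] exp_plus_exp_plus[of \<alpha> _ \<beta>])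
    then show ?thesis
      using True by (simp add: Y_coeff_product_0[OF v B] pairing_commute[of \<beta>] add.commute[of \<beta>] mult.commute)
  next
    case False
    with c have c1: "pairing \<alpha> \<beta> = 1"
      by simp
    have "(\<Sum>b\<le>B. \<Sum>b'\<le>B. ?E \<alpha> (?x b - 1) (?E \<beta> (?y b') (?D \<alpha> b (?D \<beta> b' v))) -
          ?E \<alpha> (?x b) (?E \<beta> (?y b' - 1) (?D \<alpha> b (?D \<beta> b' v)))) =
        - (\<Sum>b'\<le>B. \<Sum>b\<le>B. ?E \<beta> (?y b' - 1) (?E \<alpha> (?x b) (?D \<beta> b' (?D \<alpha> b v))) -
          ?E \<beta> (?y b') (?E \<alpha> (?x b - 1) (?D \<beta> b' (?D \<alpha> b v))))"
      by (subst sum.swap) (simp only: exp_minus_int_commute[of \<alpha> _ \<beta>] exp_plus_exp_plus[of \<alpha> _ \<beta>]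
          sum_negf[symmetric] minus_diff_eq)
    then show ?thesis
      using c1 by (simp add: Y_coeff_product_1[OF v B] pairing_commute[of \<beta>] add.commute[of \<beta>]
          mult.commute lin_neg[OF lin_e_op])
  qed
qed

text \<open>
  For \<open>(\<alpha>, \<beta>) \<ge> 0\<close> the factor $(z-w)^{(\alpha,\beta)}$ is a polynomial, so it has the same expansion for both orders
  of the operators. The exponents \<open>0\<close> and \<open>1\<close> are those that occur for \<open>\<plusminus>e\<^sub>i\<close> and \<open>\<plusminus>e\<^sub>j\<close>.
\<close>

lemma Y_coeff_exchange:
  assumes c: "pairing \<alpha> \<beta> \<in> {0, 1}"
  shows "cscale (cocycle \<beta> \<alpha>) (Y_coeff \<alpha> m (Y_coeff \<beta> n v)) =
    cscale ((-1) powi pairing \<alpha> \<beta> * cocycle \<alpha> \<beta>) (Y_coeff \<beta> n (Y_coeff \<alpha> m v))"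
proof (rule lin_eqI[of "\<lambda>v. cscale (cocycle \<beta> \<alpha>) (Y_coeff \<alpha> m (Y_coeff \<beta> n v))"])
  fix x :: "'a v_basis"
  obtain \<gamma> q where x: "x = (\<gamma>, q)" by force
  show "cscale (cocycle \<beta> \<alpha>) (Y_coeff \<alpha> m (Y_coeff \<beta> n (basis x))) =
      cscale ((-1) powi pairing \<alpha> \<beta> * cocycle \<alpha> \<beta>) (Y_coeff \<beta> n (Y_coeff \<alpha> m (basis x)))"
    unfolding x by (rule Y_coeff_exchange_graded[OF basis_graded c])
qed (intro lin_scale_map lin_compose[OF lin_Y_coeff lin_Y_coeff])+

section \<open>Bilinear expressions in vertex operators\<close>

text \<open>
  Here $\exp T_+(\alpha,z)\exp T_+(\beta,z) = \exp T_+(\alpha+\beta,z)$, applied coefficientwise;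
  vanishing terms are cut off.
\<close>

lemma exp_plus_collapse:
  assumes v: "Poly_Mapping.keys v \<subseteq> graded \<gamma> d" and B: "d \<le> int B"
    and \<phi>: "\<And>t. lin (\<phi> t)"
  shows "(\<Sum>b\<le>B. \<Sum>b'\<le>B. \<phi> (b + b') (exp_plus \<alpha> b (exp_plus \<beta> b' v))) =
    (\<Sum>t\<le>B. \<phi> t (exp_plus (\<alpha> + \<beta>) t v))"
proof -
  let ?f = "\<lambda>b b'. \<phi> (b + b') (exp_plus \<alpha> b (exp_plus \<beta> b' v))"
  have zero: "?f b b' = 0" if "b + b' > B" for b b'
  proof -
    have "exp_plus \<alpha> b (exp_plus \<beta> b' v) = 0"
      by (rule graded_negative[OF _ exp_plus_graded[OF exp_plus_graded[OF v]]]) (use that B in simp)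
    then show ?thesis
      by (simp add: lin_0[OF \<phi>])
  qed
  have zero': "exp_plus (\<alpha> + \<beta>) t v = 0" if "t > B" for t
    by (rule graded_negative[OF _ exp_plus_graded[OF v]]) (use that B in simp)
  have "(\<Sum>t\<le>B. \<phi> t (exp_plus (\<alpha> + \<beta>) t v)) = (\<Sum>t\<le>B + B. \<phi> t (exp_plus (\<alpha> + \<beta>) t v))"
    by (rule sum.mono_neutral_left) (auto simp: zero' lin_0[OF \<phi>])
  also have "\<dots> = (\<Sum>t\<le>B + B. \<Sum>b\<le>t. ?f b (t - b))"
    by (intro sum.cong refl) (simp add: exp_plus_add lin_sum[OF \<phi>])
  also have "\<dots> = (\<Sum>b'\<le>B. \<Sum>b\<le>B. ?f b b')"
    by (rule sum_diagonal_truncate) (auto intro!: zero)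
  finally show ?thesis
    by (subst sum.swap) simp
qed

text \<open>
  The weight \<open>b\<close> is the effect of $-z\frac{d}{dz}$ on $\exp T_+(\alpha,z)$, and
  $(z\frac{d}{dz}\exp T_+(\alpha,z))\exp T_+(-\alpha,z) = \sum_{n>0}\alpha(n)z^{-n}$.
\<close>

lemma exp_plus_weighted_collapse:
  assumes "n \<le> int B"
  shows "(\<Sum>b\<le>B. \<Sum>b'\<le>B. if int b + int b' = n
      then cscale (of_nat b) (exp_plus \<alpha> b (exp_plus (- \<alpha>) b' v)) else 0) =
    (if n \<ge> 1 then - osc \<alpha> n v else 0)"
proof (cases "n < 0")
  case False
  then obtain p where p: "n = int p"
    using nat_0_le by (metis linorder_not_less)
  let ?D = "exp_plus \<alpha>" and ?D' = "\<lambda>b. exp_plus (- \<alpha>) b"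
  have "(\<Sum>b\<le>B. \<Sum>b'\<le>B. if int b + int b' = n then cscale (of_nat b) (?D b (?D' b' v)) else 0) =
      (\<Sum>b\<le>B. if b \<le> p then cscale (of_nat b) (?D b (?D' (p - b) v)) else 0)"
  proof (rule sum.cong[OF refl])
    fix b
    show "(\<Sum>b'\<le>B. if int b + int b' = n then cscale (of_nat b) (?D b (?D' b' v)) else 0) =
        (if b \<le> p then cscale (of_nat b) (?D b (?D' (p - b) v)) else 0)"
    proof (cases "b \<le> p")
      case True
      then have eq: "int b + int b' = n \<longleftrightarrow> b' = p - b" for b'
        unfolding p by auto
      have "p - b \<le> B"
        using assms p by simp
      then show ?thesis
        using True unfolding eq by (simp add: sum.delta)
    qed (use p in \<open>auto intro!: sum.neutral\<close>)
  qed
  also have "\<dots> = (\<Sum>b\<le>p. cscale (of_nat b) (?D b (?D' (p - b) v)))"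
    by (rule sum.mono_neutral_cong_right) (use assms p in auto)
  also have "\<dots> = (\<Sum>j\<le>p. cscale (of_nat (p - j)) (?D (p - j) (?D' j v)))"
    by (rule sum.reindex_bij_witness[of _ "\<lambda>j. p - j" "\<lambda>j. p - j"]) auto
  also have "\<dots> = - (\<Sum>j\<le>p. \<Sum>k=1..p-j. osc \<alpha> (int k) (?D (p - j - k) (?D' j v)))"
    by (simp only: exp_plus_rec sum_negf)
  also have "(\<Sum>j\<le>p. \<Sum>k=1..p-j. osc \<alpha> (int k) (?D (p - j - k) (?D' j v))) =
      (\<Sum>k=1..p. \<Sum>j\<le>p-k. osc \<alpha> (int k) (?D' j (?D (p - k - j) v)))"
    by (subst sum_triangle_swap0) (simp add: add.commute exp_plus_exp_plus[of \<alpha> _ "- \<alpha>"])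
  also have "\<dots> = (\<Sum>k=1..p. osc \<alpha> (int k) (exp_plus (- \<alpha> + \<alpha>) (p - k) v))"
    by (simp only: exp_plus_add lin_sum[OF lin_osc])
  also have "\<dots> = (\<Sum>k=1..p. if k = p then osc \<alpha> (int k) v else 0)"
    by (intro sum.cong refl) (auto simp: exp_plus_zero lin_0[OF lin_osc])
  also have "\<dots> = (if n \<ge> 1 then osc \<alpha> n v else 0)"
    by (simp add: p)
  finally show ?thesis
    by simp
qed (auto intro!: sum.neutral)

text \<open>
  $(z\frac{d}{dz}\exp T_-(\alpha,z))\exp T_-(-\alpha,z) = \sum_{n>0}\alpha(-n)z^n$.
\<close>

lemma exp_minus_weighted_collapse:
  "(\<Sum>a=0..x. cscale (of_int a) (exp_minus_int \<alpha> a (exp_minus_int (- \<alpha>) (x - a) w))) =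
    (if x \<ge> 1 then osc \<alpha> (- x) w else 0)"
proof (cases "x < 0")
  case False
  then obtain p where p: "x = int p"
    using nat_0_le by (metis linorder_not_less)
  let ?E = "exp_minus_int \<alpha>" and ?E' = "exp_minus_int (- \<alpha>)"
  have inner: "(\<Sum>a=0..x. ?E (a - int k) (?E' (x - a) w)) = (if k = p then w else 0)"
    if "k \<in> {1..p}" for k
  proof -
    have "(\<Sum>a=0..x. ?E (a - int k) (?E' (x - a) w)) = (\<Sum>a=int k..x. ?E (a - int k) (?E' (x - a) w))"
      using that by (intro sum.mono_neutral_right) (auto simp: exp_minus_int_negative)
    also have "\<dots> = (\<Sum>a=0..x - int k. ?E a (?E' (x - int k - a) w))"
      by (rule sum.reindex_bij_witness[of _ "\<lambda>a. a + int k" "\<lambda>a. a - int k"]) auto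
    finally show ?thesis
      by (simp add: exp_minus_int_add exp_minus_int_zero p)
  qed
  have "(\<Sum>a=0..x. cscale (of_int a) (?E a (?E' (x - a) w))) =
      (\<Sum>a=0..x. \<Sum>k=1..p. osc \<alpha> (- int k) (?E (a - int k) (?E' (x - a) w)))"
    by (intro sum.cong refl exp_minus_int_rec[symmetric]) (use p in auto)
  also have "\<dots> = (\<Sum>k=1..p. osc \<alpha> (- int k) (\<Sum>a=0..x. ?E (a - int k) (?E' (x - a) w)))"
    by (subst sum.swap) (simp add: lin_sum[OF lin_osc])
  also have "\<dots> = (\<Sum>k=1..p. if k = p then osc \<alpha> (- int k) w else 0)"
    by (intro sum.cong refl) (simp add: inner lin_0[OF lin_osc])
  finally show ?thesis
    by (simp add: p)
qed simp

text \<open>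
  If \<open>(\<alpha>, \<alpha>) = 1\<close>, then $Y(\alpha,z)Y(-\alpha,w)$ contains the factor
  $(z-w)^{-1} = \sum_{j\ge0} z^{-1-j}w^j$. For fixed degrees \<open>b\<close>, \<open>b'\<close> in the annihilation operators, the sum over \<open>j\<close>
  in a coefficient runs through the part \<open>a > x\<close> of the antidiagonal \<open>a + a' = b + b' - n\<close> of the
  product of the two creation series, where \<open>x\<close> depends on the mode. The opposite
  order of the operators, where the factor is expanded in \<open>z/w\<close>, gives the other part \<open>a \<le> x\<close>.
\<close>

definition antidiag_term ::
  "int ^ 'm \<Rightarrow> int \<Rightarrow> nat \<Rightarrow> nat \<Rightarrow> int \<Rightarrow> ('m::finite v_basis \<Rightarrow>\<^sub>0 complex) \<Rightarrow> ('m v_basis \<Rightarrow>\<^sub>0 complex)" where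
  "antidiag_term \<alpha> n b b' a v =
     exp_minus_int \<alpha> a (exp_minus_int (- \<alpha>) (int b + int b' - n - a) (exp_plus \<alpha> b (exp_plus (- \<alpha>) b' v)))"

lemma Y_coeff_product_opposite:
  assumes v: "Poly_Mapping.keys v \<subseteq> graded \<gamma> d" and B: "d \<le> int B"
    and \<alpha>: "pairing \<alpha> \<alpha> = 1" "cocycle \<alpha> (- \<alpha>) = 1"
  shows "Y_coeff \<alpha> r (Y_coeff (- \<alpha>) (n + 1 - r) v) =
    (\<Sum>b\<le>B. \<Sum>b'\<le>B. \<Sum>a=0..int b + int b' - n.
      if a > int b - r - pairing \<alpha> \<gamma> then antidiag_term \<alpha> n b b' a v else 0)"
proof -
  obtain J where J: "int B - (n + 1 - r) - pairing (- \<alpha>) \<gamma> \<le> int J"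
    using bound_exists by blast
  have "(\<Sum>j\<le>J. exp_minus_int \<alpha> (int b - r - pairing \<alpha> \<gamma> + int j + 1)
        (exp_minus_int (- \<alpha>) (int b' - (n + 1 - r) + pairing \<alpha> \<gamma> - int j)
          (exp_plus \<alpha> b (exp_plus (- \<alpha>) b' v)))) =
      (\<Sum>a=0..int b + int b' - n. if a > int b - r - pairing \<alpha> \<gamma> then antidiag_term \<alpha> n b b' a v else 0)"
    (is "(\<Sum>j\<le>J. ?f j) = (\<Sum>a=0..?N. if a > ?x then ?h a else 0)") if b': "b' \<le> B" for b b'
  proof -
    have h: "?f j = ?h (?x + 1 + int j)" for j
      by (simp add: antidiag_term_def algebra_simps)
    have "(\<Sum>a=0..?N. if a > ?x then ?h a else 0) = (\<Sum>a\<in>{?x+1..?x+1+int J}. ?h a)"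
    proof (rule sum.mono_neutral_cong)
      fix a assume "a \<in> {?x+1..?x+1+int J} - {0..?N}"
      then show "?h a = 0"
        by (auto simp: antidiag_term_def exp_minus_int_negative lin_0[OF lin_exp_minus_int])
    qed (use J b' in \<open>auto simp: pairing_minus_left\<close>)
    also have "\<dots> = (\<Sum>j\<le>J. ?h (?x + 1 + int j))"
      by (rule sum.reindex_bij_witness[of _ "\<lambda>j. ?x + 1 + int j" "\<lambda>a. nat (a - ?x - 1)"]) auto
    finally show ?thesis
      by (simp add: h)
  qed
  then show ?thesis
    unfolding Y_coeff_product[OF v B J]
    by (simp add: \<alpha> pairing_minus_right pairing_minus_left binom_coeff_simps e_op_zero)
qed

lemma Y_coeff_product_opposite':
  assumes v: "Poly_Mapping.keys v \<subseteq> graded \<gamma> d" and B: "d \<le> int B"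
    and \<alpha>: "pairing \<alpha> \<alpha> = 1" "cocycle (- \<alpha>) \<alpha> = 1"
  shows "Y_coeff (- \<alpha>) (n + 1 - r) (Y_coeff \<alpha> r v) =
    (\<Sum>b\<le>B. \<Sum>b'\<le>B. \<Sum>a=0..int b + int b' - n.
      if a \<le> int b - r - pairing \<alpha> \<gamma> then antidiag_term \<alpha> n b b' a v else 0)"
proof -
  have "Y_coeff (- \<alpha>) (n + 1 - r) (Y_coeff (- (- \<alpha>)) (n + 1 - (n + 1 - r)) v) =
    (\<Sum>b'\<le>B. \<Sum>b\<le>B. \<Sum>a=0..int b' + int b - n.
      if a > int b' - (n + 1 - r) - pairing (- \<alpha>) \<gamma> then antidiag_term (- \<alpha>) n b' b a v else 0)"
    by (rule Y_coeff_product_opposite[OF v B]) (simp_all add: \<alpha> pairing_minus_left pairing_minus_right)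
  also have "\<dots> = (\<Sum>b\<le>B. \<Sum>b'\<le>B. \<Sum>a=0..int b' + int b - n.
      if a > int b' - (n + 1 - r) - pairing (- \<alpha>) \<gamma> then antidiag_term (- \<alpha>) n b' b a v else 0)"
    by (rule sum.swap)
  also have "\<dots> = (\<Sum>b\<le>B. \<Sum>b'\<le>B. \<Sum>a=0..int b + int b' - n.
      if a \<le> int b - r - pairing \<alpha> \<gamma> then antidiag_term \<alpha> n b b' a v else 0)"
  proof (intro sum.cong[OF refl])
    fix b b'
    let ?N = "int b + int b' - n"
    have "antidiag_term \<alpha> n b b' (?N - a) v = antidiag_term (- \<alpha>) n b' b a v" for a
      by (simp add: antidiag_term_def exp_minus_int_commute[of \<alpha> _ "- \<alpha>"] exp_plus_exp_plus[of \<alpha> _ "- \<alpha>"] add_ac)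
    then show "(\<Sum>a=0..int b' + int b - n.
        if a > int b' - (n + 1 - r) - pairing (- \<alpha>) \<gamma> then antidiag_term (- \<alpha>) n b' b a v else 0) =
      (\<Sum>a=0..?N. if a \<le> int b - r - pairing \<alpha> \<gamma> then antidiag_term \<alpha> n b b' a v else 0)"
      by (intro sum.reindex_bij_witness[of _ "\<lambda>a. ?N - a" "\<lambda>a. ?N - a"])
         (auto simp: pairing_minus_left)
  qed
  finally show ?thesis
    by simp
qed

lemma antidiag_sum:
  "(\<Sum>a=0..int b + int b' - n. antidiag_term \<alpha> n b b' a v) =
    (if int b + int b' = n then exp_plus \<alpha> b (exp_plus (- \<alpha>) b' v) else 0)"
  by (simp add: antidiag_term_def exp_minus_int_add exp_minus_int_zero)

text \<open>
  $\exp T_\pm(\alpha,z)\exp T_\pm(-\alpha,z) = 1$: summed over a whole antidiagonal, both pairs of series leave only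
  their constant terms.
\<close>

lemma antidiag_total:
  assumes v: "Poly_Mapping.keys v \<subseteq> graded \<gamma> d" and B: "d \<le> int B"
  shows "(\<Sum>b\<le>B. \<Sum>b'\<le>B. \<Sum>a=0..int b + int b' - n. antidiag_term \<alpha> n b b' a v) = (if n = 0 then v else 0)"
proof -
  let ?\<phi> = "\<lambda>t w. if int t = n then w else 0"
  have "(\<Sum>b\<le>B. \<Sum>b'\<le>B. \<Sum>a=0..int b + int b' - n. antidiag_term \<alpha> n b b' a v) =
      (\<Sum>b\<le>B. \<Sum>b'\<le>B. ?\<phi> (b + b') (exp_plus \<alpha> b (exp_plus (- \<alpha>) b' v)))"
    by (simp add: antidiag_sum)
  also have "\<dots> = (\<Sum>t\<le>B. ?\<phi> t (exp_plus (\<alpha> + - \<alpha>) t v))"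
    by (rule exp_plus_collapse[OF v B]) (intro lin_if_map lin_id lin_zero_map)
  also have "\<dots> = (\<Sum>t\<le>B. if t = 0 then (if n = 0 then v else 0) else 0)"
    by (intro sum.cong refl) (auto simp: exp_plus_zero)
  finally show ?thesis
    by simp
qed

text \<open>
  The two orders of the operators complete each other to whole antidiagonals; in terms of series,
  the two expansions of $(z-w)^{-1}$ add up to the delta function.
\<close>

theorem Y_coeff_anticommutator:
  assumes \<alpha>: "pairing \<alpha> \<alpha> = 1" "cocycle \<alpha> (- \<alpha>) = 1" "cocycle (- \<alpha>) \<alpha> = 1"
  shows "Y_coeff \<alpha> r (Y_coeff (- \<alpha>) s v) + Y_coeff (- \<alpha>) s (Y_coeff \<alpha> r v) =
    (if r + s = 1 then v else 0)"
proof (rule lin_eqI[of "\<lambda>v. Y_coeff \<alpha> r (Y_coeff (- \<alpha>) s v) + Y_coeff (- \<alpha>) s (Y_coeff \<alpha> r v)"])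
  fix x :: "'a v_basis"
  obtain \<gamma> q where x: "x = (\<gamma>, q)" by force
  define n where "n = r + s - 1"
  then have s: "s = n + 1 - r"
    by simp
  note v = basis_graded[of \<gamma> q]
  have "Y_coeff \<alpha> r (Y_coeff (- \<alpha>) s (basis x)) + Y_coeff (- \<alpha>) s (Y_coeff \<alpha> r (basis x)) =
      (\<Sum>b\<le>energy q. \<Sum>b'\<le>energy q. \<Sum>a=0..int b + int b' - n. antidiag_term \<alpha> n b b' a (basis x))"
    unfolding x s Y_coeff_product_opposite[OF v order_refl \<alpha>(1,2)]
      Y_coeff_product_opposite'[OF v order_refl \<alpha>(1,3)] sum.distrib[symmetric]
    by (intro sum.cong refl) auto
  also have "\<dots> = (if n = 0 then basis x else 0)"
    unfolding x by (rule antidiag_total[OF v order_refl])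
  finally show "Y_coeff \<alpha> r (Y_coeff (- \<alpha>) s (basis x)) + Y_coeff (- \<alpha>) s (Y_coeff \<alpha> r (basis x)) =
      (if r + s = 1 then basis x else 0)"
    by (simp add: n_def)
qed (intro lin_add_map lin_if_map lin_id lin_zero_map lin_compose[OF lin_Y_coeff lin_Y_coeff])+

lemma signed_count:
  fixes lo hi p q :: int
  assumes "lo \<le> q + 1" "q \<le> hi" "lo \<le> p" "p \<le> hi"
  shows "(\<Sum>r=lo..hi. (if r \<le> p \<and> r > q then 1 else 0) - (if r > p \<and> r \<le> q then 1 else 0)) =
    (of_int (p - q) :: complex)"
proof -
  have S: "{q+1..p} = {r \<in> {lo..hi}. r \<le> p \<and> r > q}" "{p+1..q} = {r \<in> {lo..hi}. r > p \<and> r \<le> q}"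
    using assms by auto
  have 1: "(\<Sum>r=lo..hi. if r \<le> p \<and> r > q then 1 else 0) = (of_nat (card {q+1..p}) :: complex)"
    unfolding S by (subst sum.inter_filter[symmetric]) simp_all
  have 2: "(\<Sum>r=lo..hi. if r > p \<and> r \<le> q then 1 else 0) = (of_nat (card {p+1..q}) :: complex)"
    unfolding S by (subst sum.inter_filter[symmetric]) simp_all
  show ?thesis
    unfolding sum_subtractf 1 2 by (cases "p \<le> q") (auto simp: of_nat_nat)
qed

text \<open>
  On the antidiagonal \<open>a + a' = N\<close> the term \<open>a\<close> occurs
  in the modes \<open>r\<close> with \<open>q < r \<le> p\<close>, or with the opposite sign in those with \<open>p < r \<le> q\<close>, where
  \<open>q = b - (\<alpha>,\<gamma>) - a\<close> and \<open>p\<close> is the last \<open>r\<close> before normal ordering reverses the factors.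
  The multiplicity \<open>p - q\<close> is, up to the shift \<open>p\<close>, the exponent of \<open>z\<close>. So the sum over all terms is the
  value of $z\frac{\partial}{\partial z} f(z,w)$ at \<open>w = z\<close>, where the product is $f(z,w)/(z-w)$. The shift contributes only
  for \<open>n = 0\<close>, and then \<open>p = 0\<close>. This is the formula $:Y(\alpha,z)Y(-\alpha,z): = \alpha(z)$.
\<close>

lemma normal_ordered_sum_graded:
  assumes v: "Poly_Mapping.keys v \<subseteq> graded \<gamma> d"
    and \<alpha>: "pairing \<alpha> \<alpha> = 1" "cocycle \<alpha> (- \<alpha>) = 1" "cocycle (- \<alpha>) \<alpha> = 1"
  shows "Sum_any (\<lambda>r. if r \<le> n + 1 - r then Y_coeff \<alpha> r (Y_coeff (- \<alpha>) (n + 1 - r) v)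
      else - Y_coeff (- \<alpha>) (n + 1 - r) (Y_coeff \<alpha> r v)) = osc \<alpha> n v"
proof -
  obtain B where B: "d \<le> int B" "n \<le> int B"
    using bound_exists by blast
  define g where "g = pairing \<alpha> \<gamma>"
  define p where "p = (n + 1) div 2"
  define lo where "lo = min (n + 1 - int B - g) p"
  define hi where "hi = max (int B - g) p"
  have p: "r \<le> n + 1 - r \<longleftrightarrow> r \<le> p" for r
    by (auto simp: p_def)
  let ?h = "\<lambda>b b' a. antidiag_term \<alpha> n b b' a v"
  let ?t = "\<lambda>r. if r \<le> n + 1 - r then Y_coeff \<alpha> r (Y_coeff (- \<alpha>) (n + 1 - r) v)
      else - Y_coeff (- \<alpha>) (n + 1 - r) (Y_coeff \<alpha> r v)"
  have "Sum_any ?t = (\<Sum>r=lo..hi. ?t r)"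
  proof (rule Sum_any.expand_superset)
    have "?t r = 0" if "r < lo" for r
    proof -
      have "Y_coeff (- \<alpha>) (n + 1 - r) v = 0"
        by (rule graded_negative[OF _ Y_coeff_graded[OF v]])
           (use that B in \<open>auto simp: lo_def g_def pairing_minus_left\<close>)
      then show ?thesis
        using that by (simp add: p lin_0[OF lin_Y_coeff] lo_def)
    qed
    moreover have "?t r = 0" if "r > hi" for r
    proof -
      have "Y_coeff \<alpha> r v = 0"
        by (rule graded_negative[OF _ Y_coeff_graded[OF v]])
           (use that B in \<open>auto simp: hi_def g_def\<close>)
      then show ?thesis
        using that by (simp add: p lin_0[OF lin_Y_coeff] hi_def)
    qed
    ultimately show "{r. ?t r \<noteq> 0} \<subseteq> {lo..hi}"
      by (force simp: not_le)
  qed simp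
  also have "\<dots> = (\<Sum>r=lo..hi. \<Sum>b\<le>B. \<Sum>b'\<le>B. \<Sum>a=0..int b + int b' - n.
      cscale ((if r \<le> p \<and> r > int b - g - a then 1 else 0) - (if r > p \<and> r \<le> int b - g - a then 1 else 0)) (?h b b' a))"
    unfolding Y_coeff_product_opposite[OF v B(1) \<alpha>(1,2)] Y_coeff_product_opposite'[OF v B(1) \<alpha>(1,3)] p
      sum_negf[symmetric]
  proof (intro sum.cong[OF refl])
    fix r
    show "(if r \<le> p
          then \<Sum>b\<le>B. \<Sum>b'\<le>B. \<Sum>a=0..int b + int b' - n.
            if a > int b - r - pairing \<alpha> \<gamma> then ?h b b' a else 0
          else \<Sum>b\<le>B. \<Sum>b'\<le>B. \<Sum>a=0..int b + int b' - n.
            - (if a \<le> int b - r - pairing \<alpha> \<gamma> then ?h b b' a else 0)) =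
        (\<Sum>b\<le>B. \<Sum>b'\<le>B. \<Sum>a=0..int b + int b' - n.
      cscale ((if r \<le> p \<and> r > int b - g - a then 1 else 0) - (if r > p \<and> r \<le> int b - g - a then 1 else 0)) (?h b b' a))"
      by (cases "r \<le> p") (auto simp: g_def intro!: sum.cong)
  qed
  also have "\<dots> = (\<Sum>b\<le>B. \<Sum>b'\<le>B. \<Sum>a=0..int b + int b' - n. \<Sum>r=lo..hi.
      cscale ((if r \<le> p \<and> r > int b - g - a then 1 else 0) - (if r > p \<and> r \<le> int b - g - a then 1 else 0)) (?h b b' a))"
    by (simp only: sum.swap[of _ _ "{lo..hi}"])
  also have "\<dots> = (\<Sum>b\<le>B. \<Sum>b'\<le>B. \<Sum>a=0..int b + int b' - n.
      cscale (of_int (p + g)) (?h b b' a) + cscale (of_int a) (?h b b' a) - cscale (of_nat b) (?h b b' a))"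
  proof (intro sum.cong[OF refl])
    fix b b' a assume *: "b \<in> {..B}" "b' \<in> {..B}" "a \<in> {0..int b + int b' - n}"
    have "(\<Sum>r=lo..hi. (if r \<le> p \<and> r > int b - g - a then 1 else 0) - (if r > p \<and> r \<le> int b - g - a then 1 else 0)) =
        (of_int (p - (int b - g - a)) :: complex)"
      by (rule signed_count) (use * in \<open>auto simp: lo_def hi_def\<close>)
    note count = this
    show "(\<Sum>r=lo..hi. cscale ((if r \<le> p \<and> r > int b - g - a then 1 else 0) -
          (if r > p \<and> r \<le> int b - g - a then 1 else 0)) (?h b b' a)) =
        cscale (of_int (p + g)) (?h b b' a) + cscale (of_int a) (?h b b' a) - cscale (of_nat b) (?h b b' a)"
      unfolding cs.scale_sum_left[symmetric] count
      by (simp add: cs.scale_left_distrib cs.scale_left_diff_distrib algebra_simps)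
  qed
  also have "\<dots> = cscale (of_int (p + g)) (\<Sum>b\<le>B. \<Sum>b'\<le>B. \<Sum>a=0..int b + int b' - n. ?h b b' a) +
      (\<Sum>b\<le>B. \<Sum>b'\<le>B. \<Sum>a=0..int b + int b' - n. cscale (of_int a) (?h b b' a)) -
      (\<Sum>b\<le>B. \<Sum>b'\<le>B. \<Sum>a=0..int b + int b' - n. cscale (of_nat b) (?h b b' a))"
    by (simp add: sum.distrib sum_subtractf cs.scale_sum_right)
  also have "(\<Sum>b\<le>B. \<Sum>b'\<le>B. \<Sum>a=0..int b + int b' - n. ?h b b' a) = (if n = 0 then v else 0)"
    by (rule antidiag_total[OF v B(1)])
  also have "(\<Sum>b\<le>B. \<Sum>b'\<le>B. \<Sum>a=0..int b + int b' - n. cscale (of_int a) (?h b b' a)) =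
      (if n \<le> -1 then osc \<alpha> n v else 0)"
  proof -
    let ?\<phi> = "\<lambda>t w. if int t - n \<ge> 1 then osc \<alpha> (n - int t) w else 0"
    have "(\<Sum>b\<le>B. \<Sum>b'\<le>B. \<Sum>a=0..int b + int b' - n. cscale (of_int a) (?h b b' a)) =
        (\<Sum>b\<le>B. \<Sum>b'\<le>B. ?\<phi> (b + b') (exp_plus \<alpha> b (exp_plus (- \<alpha>) b' v)))"
      unfolding antidiag_term_def exp_minus_weighted_collapse by (intro sum.cong refl) auto
    also have "\<dots> = (\<Sum>t\<le>B. ?\<phi> t (exp_plus (\<alpha> + - \<alpha>) t v))"
      by (rule exp_plus_collapse[OF v B(1)]) (intro lin_if_map lin_osc lin_zero_map)
    also have "\<dots> = (\<Sum>t\<le>B. if t = 0 then ?\<phi> 0 v else 0)"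
      by (intro sum.cong refl) (auto simp: exp_plus_zero lin_0[OF lin_osc])
    finally show ?thesis
      by simp
  qed
  also have "(\<Sum>b\<le>B. \<Sum>b'\<le>B. \<Sum>a=0..int b + int b' - n. cscale (of_nat b) (?h b b' a)) =
      (if n \<ge> 1 then - osc \<alpha> n v else 0)"
    unfolding cs.scale_sum_right[symmetric] antidiag_sum exp_plus_weighted_collapse[OF B(2), symmetric]
    by (intro sum.cong refl) (auto simp: cs.scale_sum_right intro!: sum.cong)
  finally show ?thesis
    using osc_zero_mode[OF v, of \<alpha>] by (cases "n = 0") (auto simp: p_def g_def)
qed

text \<open>
  For \<open>(\<alpha>, \<beta>) = 0\<close> the product $Y(\alpha,z)Y(\beta,w)$ is regular at \<open>w = z\<close>, where the exponentials
  of \<open>\<alpha>\<close> and \<open>\<beta>\<close> combine to those of \<open>\<alpha> + \<beta>\<close>.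
\<close>

lemma product_sum_graded:
  assumes v: "Poly_Mapping.keys v \<subseteq> graded \<gamma> d" and c: "pairing \<alpha> \<beta> = 0"
  shows "Sum_any (\<lambda>r. Y_coeff \<alpha> r (Y_coeff \<beta> (n - r) v)) = cscale (cocycle \<alpha> \<beta>) (Y_coeff (\<alpha> + \<beta>) n v)"
proof -
  obtain B where B: "d \<le> int B"
    using bound_exists by blast
  define g where "g = pairing \<alpha> \<gamma>"
  define g' where "g' = pairing \<beta> \<gamma>"
  define lo where "lo = n - int B + g'"
  define hi where "hi = int B - g"
  let ?t = "\<lambda>r. Y_coeff \<alpha> r (Y_coeff \<beta> (n - r) v)"
  let ?h = "\<lambda>r b b'. exp_minus_int \<alpha> (int b - r - g)
        (exp_minus_int \<beta> (int b' - (n - r) - g') (exp_plus \<alpha> b (exp_plus \<beta> b' v)))"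
  have t: "?t r = cscale (cocycle \<alpha> \<beta>) (e_op (\<alpha> + \<beta>) (\<Sum>b\<le>B. \<Sum>b'\<le>B. ?h r b b'))" for r
    unfolding g_def g'_def by (rule Y_coeff_product_0[OF v B c])
  have "Sum_any ?t = (\<Sum>r=lo..hi. ?t r)"
  proof (rule Sum_any.expand_superset)
    have "?t r = 0" if "r \<notin> {lo..hi}" for r
    proof -
      have "?h r b b' = 0" if "b \<le> B" "b' \<le> B" for b b'
        using that \<open>r \<notin> {lo..hi}\<close>
        by (auto simp: lo_def hi_def exp_minus_int_negative lin_0[OF lin_exp_minus_int])
      then have "(\<Sum>b\<le>B. \<Sum>b'\<le>B. ?h r b b') = 0"
        by (intro sum.neutral ballI) auto
      then show ?thesis
        unfolding t by (simp only: lin_0[OF lin_e_op] cs.scale_zero_right)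
    qed
    then show "{r. ?t r \<noteq> 0} \<subseteq> {lo..hi}"
      by blast
  qed simp
  also have "\<dots> = cscale (cocycle \<alpha> \<beta>) (e_op (\<alpha> + \<beta>) (\<Sum>b\<le>B. \<Sum>b'\<le>B. \<Sum>r=lo..hi. ?h r b b'))"
    unfolding t by (simp only: lin_sum[OF lin_e_op, symmetric] cs.scale_sum_right[symmetric] sum.swap[of _ _ "{lo..hi}"])
  also have "(\<Sum>b\<le>B. \<Sum>b'\<le>B. \<Sum>r=lo..hi. ?h r b b') =
      (\<Sum>b\<le>B. \<Sum>b'\<le>B. exp_minus_int (\<alpha> + \<beta>) (int (b + b') - n - g - g') (exp_plus \<alpha> b (exp_plus \<beta> b' v)))"
  proof (intro sum.cong[OF refl])
    fix b b' assume bb: "b \<in> {..B}" "b' \<in> {..B}"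
    let ?x = "int (b + b') - n - g - g'"
    let ?f = "\<lambda>a. exp_minus_int \<alpha> a (exp_minus_int \<beta> (?x - a) (exp_plus \<alpha> b (exp_plus \<beta> b' v)))"
    have "(\<Sum>r=lo..hi. ?h r b b') = (\<Sum>a=int b - g - hi..int b - g - lo. ?f a)"
      by (rule sum.reindex_bij_witness[of _ "\<lambda>a. int b - g - a" "\<lambda>r. int b - g - r"]) (auto simp: algebra_simps)
    also have "\<dots> = (\<Sum>a=0..?x. ?f a)"
      by (rule sum.mono_neutral_right)
         (use bb in \<open>auto simp: lo_def hi_def exp_minus_int_negative lin_0[OF lin_exp_minus_int]\<close>)
    finally show "(\<Sum>r=lo..hi. ?h r b b') =
        exp_minus_int (\<alpha> + \<beta>) ?x (exp_plus \<alpha> b (exp_plus \<beta> b' v))"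
      by (simp only: exp_minus_int_add)
  qed
  also have "\<dots> = (\<Sum>t\<le>B. exp_minus_int (\<alpha> + \<beta>) (int t - n - g - g') (exp_plus (\<alpha> + \<beta>) t v))"
    by (rule exp_plus_collapse[OF v B]) (rule lin_exp_minus_int)
  also have "e_op (\<alpha> + \<beta>) \<dots> = Y_coeff (\<alpha> + \<beta>) n v"
    by (simp add: Y_coeff_eq[OF v B] lin_sum[OF lin_e_op] g_def g'_def pairing_add_left algebra_simps)
  finally show ?thesis .
qed

section \<open>Currents bilinear in free fields\<close>

lemma super_sign_square [simp]: "super_sign p q * super_sign p q = 1"
  by (simp add: super_sign_def)

lemma super_sign_commute: "super_sign p q = super_sign q p"
  by (simp add: super_sign_def mult.commute)

text \<open>
  Fields \<open>a A\<close> and \<open>ad A\<close> of half-integral modes; \<open>par A = 1\<close> for fermions and \<open>par A = 0\<close> for bosons.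
  The supercommutator of \<open>a A\<close> with \<open>ad A\<close> is \<open>1\<close> for fermions and \<open>-1\<close> for bosons, so that \<open>current A B\<close> below acts on the
  fields \<open>a\<close> as a matrix unit.
\<close>

locale free_fields =
  fixes par :: "'i \<Rightarrow> bit"
    and a ad :: "'i \<Rightarrow> int \<Rightarrow> ('b \<Rightarrow>\<^sub>0 complex) \<Rightarrow> ('b \<Rightarrow>\<^sub>0 complex)"
  assumes lin_a: "lin (a A r)" and lin_ad: "lin (ad A r)"
    and a_a: "a A r (a B s v) = cscale (super_sign (par A) (par B)) (a B s (a A r v))"
    and ad_ad: "ad A r (ad B s v) = cscale (super_sign (par A) (par B)) (ad B s (ad A r v))"
    and a_ad: "a A r (ad B s v) = cscale (super_sign (par A) (par B)) (ad B s (a A r v)) +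
      (if A = B \<and> r + s = 1 then cscale (- super_sign (par A) (par A)) v else 0)"
    and a_eventually_zero: "\<exists>K. \<forall>r>K. a A r v = 0"
    and ad_eventually_zero: "\<exists>K. \<forall>r>K. ad A r v = 0"
begin

abbreviation sg :: "'i \<Rightarrow> 'i \<Rightarrow> complex" where
  "sg A B \<equiv> super_sign (par A) (par B)"

lemma sg_commute: "sg A B = sg B A"
  by (rule super_sign_commute)

definition normal_ordered :: "'i \<Rightarrow> int \<Rightarrow> 'i \<Rightarrow> int \<Rightarrow> ('b \<Rightarrow>\<^sub>0 complex) \<Rightarrow> ('b \<Rightarrow>\<^sub>0 complex)" where
  "normal_ordered A r B s v =
    (if r \<le> s then a A r (ad B s v) else cscale (sg A B) (ad B s (a A r v)))"

definition current :: "'i \<Rightarrow> 'i \<Rightarrow> int \<Rightarrow> ('b \<Rightarrow>\<^sub>0 complex) \<Rightarrow> ('b \<Rightarrow>\<^sub>0 complex)" where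
  "current A B n v = Sum_any (\<lambda>r. normal_ordered A r B (n + 1 - r) v)"

definition contraction :: "'i \<Rightarrow> int \<Rightarrow> 'i \<Rightarrow> int \<Rightarrow> complex" where
  "contraction A r B s = (if A = B \<and> r + s = 1 \<and> r > s then - sg A A else 0)"

lemma a_ad_normal_ordered:
  "a A r (ad B s v) = normal_ordered A r B s v + cscale (contraction A r B s) v"
  by (auto simp: normal_ordered_def contraction_def a_ad[of A r B s v])

lemma normal_ordered_eq:
  "normal_ordered A r B s v = a A r (ad B s v) - cscale (contraction A r B s) v"
  by (simp add: a_ad_normal_ordered)

lemma ad_a: "ad B t (a C s v) = cscale (sg B C) (a C s (ad B t v)) + (if B = C \<and> t + s = 1 then v else 0)"
proof -
  have "cscale (sg B C) (a C s (ad B t v)) =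
      ad B t (a C s v) + cscale (sg B C) (if C = B \<and> s + t = 1 then cscale (- sg C C) v else 0)"
    by (simp add: a_ad[of C s B t v] cs.scale_right_distrib sg_commute[of C B])
  then show ?thesis
    by (auto simp: add.commute)
qed

lemma lin_normal_ordered: "lin (normal_ordered A r B s)"
  unfolding normal_ordered_def[abs_def]
  by (intro lin_if_map lin_scale_map lin_compose[OF lin_a lin_ad] lin_compose[OF lin_ad lin_a])

lemma finite_normal_ordered: "finite {r. normal_ordered A r B (n - r) v \<noteq> 0}"
proof -
  obtain K where K: "a A r v = 0" if "r > K" for r
    using a_eventually_zero by blast
  obtain L where L: "ad B r v = 0" if "r > L" for r
    using ad_eventually_zero by blast
  have "normal_ordered A r B (n - r) v = 0" if r: "r \<notin> {min (n - L) (n div 2)..max K (n div 2)}" for r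
  proof (cases "r \<le> n - r")
    case True
    then have "n - r > L"
      using r by auto
    then show ?thesis
      using True by (simp add: normal_ordered_def L lin_0[OF lin_a])
  next
    case False
    then have "r > K"
      using r by auto
    then show ?thesis
      using False by (simp add: normal_ordered_def K lin_0[OF lin_ad])
  qed
  then have "{r. normal_ordered A r B (n - r) v \<noteq> 0} \<subseteq> {min (n - L) (n div 2)..max K (n div 2)}"
    by blast
  then show ?thesis
    by (rule finite_subset) simp
qed

lemma lin_current: "lin (current A B n)"
  unfolding current_def[abs_def] by (rule lin_Sum_any, rule lin_normal_ordered, rule finite_normal_ordered)

text \<open>
  Each term of the current contracts its factor \<open>ad B\<close> with \<open>a C\<close>, and only one mode contributes. The normal ordering changes
  the current by a multiple of the identity, which has no effect on the supercommutator.
\<close>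

lemma current_a:
  "current A B n (a C s v) =
    cscale (sg A C * sg B C) (a C s (current A B n v)) + (if B = C then a A (n + s) v else 0)"
proof -
  let ?N = "\<lambda>r. normal_ordered A r B (n + 1 - r)"
  have N: "?N r (a C s v) = cscale (sg A C * sg B C) (a C s (?N r v)) +
      (if B = C \<and> r = n + s then a A (n + s) v else 0)" for r
  proof -
    let ?t = "n + 1 - r"
    have 1: "?t + s = 1 \<longleftrightarrow> r = n + s"
      by auto
    have 2: "sg A C * sg B C * contraction A r B ?t = contraction A r B ?t"
      by (simp add: contraction_def)
    have "a A r (ad B ?t (a C s v)) = cscale (sg B C) (a A r (a C s (ad B ?t v))) +
        (if B = C \<and> r = n + s then a A (n + s) v else 0)"
      unfolding ad_a 1 by (auto simp: lin_add[OF lin_a] lin_scale[OF lin_a] lin_0[OF lin_a])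
    also have "a A r (a C s (ad B ?t v)) = cscale (sg A C) (a C s (a A r (ad B ?t v)))"
      by (rule a_a)
    finally have "a A r (ad B ?t (a C s v)) = cscale (sg A C * sg B C) (a C s (a A r (ad B ?t v))) +
        (if B = C \<and> r = n + s then a A (n + s) v else 0)"
      by (simp add: mult.commute)
    then show ?thesis
      by (simp add: normal_ordered_eq lin_diff[OF lin_a] lin_scale[OF lin_a] cs.scale_right_diff_distrib 2)
  qed
  have "current A B n (a C s v) = Sum_any (\<lambda>r. cscale (sg A C * sg B C) (a C s (?N r v))) +
      Sum_any (\<lambda>r. if B = C \<and> r = n + s then a A (n + s) v else 0)"
    unfolding current_def N
  proof (rule Sum_any.distrib)
    show "finite {r. cscale (sg A C * sg B C) (a C s (?N r v)) \<noteq> 0}"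
      by (rule finite_subset[OF _ finite_normal_ordered[of A B "n + 1" v]]) (auto simp: lin_0[OF lin_a])
    show "finite {r. (if B = C \<and> r = n + s then a A (n + s) v else 0) \<noteq> 0}"
      by (rule finite_subset[of _ "{n + s}"]) auto
  qed
  also have "Sum_any (\<lambda>r. cscale (sg A C * sg B C) (a C s (?N r v))) =
      cscale (sg A C * sg B C) (a C s (current A B n v))"
    unfolding current_def
    by (rule lin_of_Sum_any[OF lin_scale_map[OF lin_a] finite_normal_ordered, symmetric])
  also have "Sum_any (\<lambda>r. if B = C \<and> r = n + s then a A (n + s) v else 0) = (if B = C then a A (n + s) v else 0)"
    by (subst Sum_any.expand_superset[of "{n + s}"]) auto
  finally show ?thesis .
qed

lemma current_ad:
  "current A B n (ad C s v) =
    cscale (sg A C * sg B C) (ad C s (current A B n v)) +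
    (if A = C then cscale (- sg A A * sg A B) (ad B (n + s) v) else 0)"
proof -
  let ?N = "\<lambda>r. normal_ordered A r B (n + 1 - r)"
  have N: "?N r (ad C s v) = cscale (sg A C * sg B C) (ad C s (?N r v)) +
      (if A = C \<and> r = 1 - s then cscale (- sg A A * sg A B) (ad B (n + s) v) else 0)" for r
  proof -
    let ?t = "n + 1 - r"
    have 2: "sg A C * sg B C * contraction A r B ?t = contraction A r B ?t"
      by (simp add: contraction_def)
    have "a A r (ad B ?t (ad C s v)) = cscale (sg B C) (a A r (ad C s (ad B ?t v)))"
      by (simp add: ad_ad[of B ?t C s v] lin_scale[OF lin_a])
    also have "a A r (ad C s (ad B ?t v)) = cscale (sg A C) (ad C s (a A r (ad B ?t v))) +
        (if A = C \<and> r = 1 - s then cscale (- sg A A) (ad B (n + s) v) else 0)"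
    proof -
      have "r + s = 1 \<longleftrightarrow> r = 1 - s"
        by auto
      then show ?thesis
        unfolding a_ad[of A r C s] by (cases "r = 1 - s") auto
    qed
    finally have "a A r (ad B ?t (ad C s v)) = cscale (sg A C * sg B C) (ad C s (a A r (ad B ?t v))) +
        (if A = C \<and> r = 1 - s then cscale (- sg A A * sg A B) (ad B (n + s) v) else 0)"
      by (auto simp: cs.scale_right_distrib mult.commute sg_commute[of C B])
    then show ?thesis
      by (simp add: normal_ordered_eq lin_diff[OF lin_ad] lin_scale[OF lin_ad] cs.scale_right_diff_distrib 2)
  qed
  have "current A B n (ad C s v) = Sum_any (\<lambda>r. cscale (sg A C * sg B C) (ad C s (?N r v))) +
      Sum_any (\<lambda>r. if A = C \<and> r = 1 - s then cscale (- sg A A * sg A B) (ad B (n + s) v) else 0)"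
    unfolding current_def N
  proof (rule Sum_any.distrib)
    show "finite {r. cscale (sg A C * sg B C) (ad C s (?N r v)) \<noteq> 0}"
      by (rule finite_subset[OF _ finite_normal_ordered[of A B "n + 1" v]]) (auto simp: lin_0[OF lin_ad])
    show "finite {r. (if A = C \<and> r = 1 - s then cscale (- sg A A * sg A B) (ad B (n + s) v) else 0) \<noteq> 0}"
      by (rule finite_subset[of _ "{1 - s}"]) auto
  qed
  also have "Sum_any (\<lambda>r. cscale (sg A C * sg B C) (ad C s (?N r v))) =
      cscale (sg A C * sg B C) (ad C s (current A B n v))"
    unfolding current_def
    by (rule lin_of_Sum_any[OF lin_scale_map[OF lin_ad] finite_normal_ordered, symmetric])
  also have "Sum_any (\<lambda>r. if A = C \<and> r = 1 - s then cscale (- sg A A * sg A B) (ad B (n + s) v) else 0) =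
      (if A = C then cscale (- sg A A * sg A B) (ad B (n + s) v) else 0)"
    by (subst Sum_any.expand_superset[of "{1 - s}"]) auto
  finally show ?thesis .
qed

lemma current_normal_ordered:
  "current A B m (normal_ordered C r D s v) =
    cscale (sg A C * sg B C * (sg A D * sg B D)) (normal_ordered C r D s (current A B m v)) +
    (if B = C then a A (m + r) (ad D s v) else 0) +
    (if A = D then cscale (- sg A A * sg A B * (sg A C * sg B C)) (a C r (ad B (m + s) v)) else 0)"
proof -
  let ?E = "current A B m"
  have 1: "sg A C * sg B C * (sg A D * sg B D) * contraction C r D s = contraction C r D s"
    by (auto simp: contraction_def mult_ac)
  have "?E (a C r (ad D s v)) = cscale (sg A C * sg B C) (a C r (?E (ad D s v))) +
      (if B = C then a A (m + r) (ad D s v) else 0)"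
    by (rule current_a)
  also have "a C r (?E (ad D s v)) = cscale (sg A D * sg B D) (a C r (ad D s (?E v))) +
      (if A = D then cscale (- sg A A * sg A B) (a C r (ad B (m + s) v)) else 0)"
    by (auto simp: current_ad lin_add[OF lin_a] lin_scale[OF lin_a] lin_neg[OF lin_a] lin_0[OF lin_a])
  finally have 2: "?E (a C r (ad D s v)) = cscale (sg A C * sg B C * (sg A D * sg B D)) (a C r (ad D s (?E v))) +
      (if B = C then a A (m + r) (ad D s v) else 0) +
      (if A = D then cscale (- sg A A * sg A B * (sg A C * sg B C)) (a C r (ad B (m + s) v)) else 0)"
    by (simp add: cs.scale_right_distrib mult.commute[of "sg A C * sg B C"] add_ac)
  show ?thesis
    by (simp only: normal_ordered_eq lin_diff[OF lin_current] lin_scale[OF lin_current] 2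
        cs.scale_right_diff_distrib cs.scale_scale 1) simp
qed

text \<open>
  The current of \<open>A\<close>, \<open>B\<close> acts on \<open>:a C ad D:\<close> by replacing \<open>a C\<close> or \<open>ad D\<close>. Restoring the normal order of
  the shifted products produces constants, whose sum counts, with sign, the modes between \<open>-m\<close> and
  \<open>0\<close>; this is the central term.
\<close>

theorem current_commutator:
  "current A B m (current C D n v) =
    cscale (sg A C * sg B C * (sg A D * sg B D)) (current C D n (current A B m v)) +
    (if B = C then current A D (m + n) v else 0) +
    (if A = D then cscale (- sg A A * sg A B * (sg A C * sg B C)) (current C B (m + n) v) else 0) +
    (if A = D \<and> B = C \<and> m + n = 0 then cscale (- sg A A * of_int m) v else 0)"
proof -
  let ?s = "sg A C * sg B C * (sg A D * sg B D)" and ?t = "- sg A A * sg A B * (sg A C * sg B C)"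
  let ?N1 = "\<lambda>r. normal_ordered C r D (n + 1 - r) (current A B m v)"
  let ?N2 = "\<lambda>r. normal_ordered A r D (m + n + 1 - r) v"
  let ?N3 = "\<lambda>r. normal_ordered C r B (m + n + 1 - r) v"
  let ?k = "\<lambda>r. (if r \<le> 0 \<and> r > - m then 1 else 0) - (if r > 0 \<and> r \<le> - m then 1 else 0) :: complex"
  let ?c = "\<lambda>r. if A = D \<and> B = C \<and> m + n = 0 then cscale (- sg A A * ?k r) v else 0"
  \<comment> \<open>A finite set of modes that contains the supports of all sums below, so that they can be
    combined term by term.\<close>
  define S where "S = {r. ?N1 r \<noteq> 0} \<union> (\<lambda>r. r - m) ` {r. ?N2 r \<noteq> 0} \<union> {r. ?N3 r \<noteq> 0} \<union>
    {r. normal_ordered C r D (n + 1 - r) v \<noteq> 0} \<union> {min 0 (- m)..max 0 (- m)}"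
  have S: "finite S"
    unfolding S_def by (intro finite_UnI finite_imageI finite_normal_ordered) auto
  have N2: "current A D (m + n) v = (\<Sum>r\<in>S. ?N2 (m + r))"
  proof -
    have "current A D (m + n) v = sum ?N2 ((\<lambda>r. r + m) ` S)"
      unfolding current_def
    proof (rule Sum_any.expand_superset)
      show "{r. ?N2 r \<noteq> 0} \<subseteq> (\<lambda>r. r + m) ` S"
      proof
        fix r assume "r \<in> {r. ?N2 r \<noteq> 0}"
        then have "r - m \<in> S"
          unfolding S_def by blast
        then show "r \<in> (\<lambda>r. r + m) ` S"
          by force
      qed
    qed (use S in simp)
    then show ?thesis
      by (simp add: sum.reindex inj_on_def add.commute)
  qed
  have N3: "current C B (m + n) v = (\<Sum>r\<in>S. ?N3 r)"
    unfolding current_def by (rule Sum_any.expand_superset[OF S]) (auto simp: S_def)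
  have N1: "current C D n (current A B m v) = (\<Sum>r\<in>S. ?N1 r)"
    unfolding current_def[of C D n] by (rule Sum_any.expand_superset[OF S]) (auto simp: S_def)
  have N0: "current C D n v = (\<Sum>r\<in>S. normal_ordered C r D (n + 1 - r) v)"
    unfolding current_def[of C D n] by (rule Sum_any.expand_superset[OF S]) (auto simp: S_def)
  have k: "(\<Sum>r\<in>S. ?k r) = of_int m"
  proof -
    have "(\<Sum>r\<in>S. ?k r) = (\<Sum>r=min 0 (- m)..max 0 (- m). ?k r)"
      by (rule sum.mono_neutral_right[OF S]) (auto simp: S_def)
    also have "\<dots> = of_int (0 - (- m))"
      by (rule signed_count) auto
    finally show ?thesis
      by simp
  qed
  have summand: "current A B m (normal_ordered C r D (n + 1 - r) v) = cscale ?s (?N1 r) +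
      (if B = C then ?N2 (m + r) else 0) + (if A = D then cscale ?t (?N3 r) else 0) + ?c r" for r
  proof -
    have idx: "m + n + 1 - (m + r) = n + 1 - r" "m + (n + 1 - r) = m + n + 1 - r"
      by auto
    have const: "(if B = C then cscale (contraction A (m + r) D (n + 1 - r)) v else 0) +
        (if A = D then cscale (?t * contraction C r B (m + n + 1 - r)) v else 0) = ?c r"
    proof (cases "A = D \<and> B = C \<and> m + n = 0")
      case True
      then have n: "n = - m" by simp
      have t: "?t * sg C C = - sg A A"
        using True by (simp add: sg_commute[of C A] mult_ac)
      have "contraction A (m + r) D (n + 1 - r) = - sg A A * (if r > - m then 1 else 0)"
        using True by (auto simp: contraction_def)
      moreover have "?t * contraction C r B (m + n + 1 - r) = sg A A * (if r > 0 then 1 else 0)"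
        using True t by (auto simp: contraction_def)
      moreover have "?k r = (if r > - m then 1 else 0) - (if r > 0 then 1 else 0)"
        by auto
      ultimately show ?thesis
        using True by (simp add: cs.scale_left_distrib[symmetric] right_diff_distrib)
    qed (auto simp: contraction_def)
    show ?thesis
      unfolding current_normal_ordered a_ad_normal_ordered idx const[symmetric]
      by (simp add: cs.scale_right_distrib)
  qed
  have split_sum: "(\<Sum>r\<in>S. cscale s (f1 r) + (if P then f2 r else 0) + (if Q then cscale t (f3 r) else 0) +
        (if R then cscale (c * k r) v else 0)) =
      cscale s (\<Sum>r\<in>S. f1 r) + (if P then (\<Sum>r\<in>S. f2 r) else 0) +
        (if Q then cscale t (\<Sum>r\<in>S. f3 r) else 0) + (if R then cscale (c * (\<Sum>r\<in>S. k r)) v else 0)"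
    for P Q R s t c f1 f2 f3 and k :: "int \<Rightarrow> complex"
    by (cases P; cases Q; cases R)
       (simp_all add: sum.distrib cs.scale_sum_right cs.scale_sum_left sum_distrib_left)
  have "current A B m (current C D n v) = (\<Sum>r\<in>S. current A B m (normal_ordered C r D (n + 1 - r) v))"
    by (simp add: N0 lin_sum[OF lin_current])
  also have "\<dots> = cscale ?s (\<Sum>r\<in>S. ?N1 r) + (if B = C then (\<Sum>r\<in>S. ?N2 (m + r)) else 0) +
      (if A = D then cscale ?t (\<Sum>r\<in>S. ?N3 r) else 0) +
      (if A = D \<and> B = C \<and> m + n = 0 then cscale (- sg A A * (\<Sum>r\<in>S. ?k r)) v else 0)"
    unfolding summand by (rule split_sum)
  finally show ?thesis
    unfolding N1[symmetric] N2[symmetric] N3[symmetric] k .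
qed

end

section \<open>The free fields\<close>

subsection \<open>Bosons\<close>

lemma lin_phi: "lin (phi j r)"
  unfolding phi_def[abs_def] by (intro lin_if_map lin_uminus lin_mult_var lin_partial_deriv)

lemma lin_phi_star: "lin (phi_star j r)"
  unfolding phi_star_def[abs_def] by (intro lin_if_map lin_mult_var lin_partial_deriv)

lemmas boson_linear =
  lin_neg[OF lin_mult_var] lin_neg[OF lin_partial_deriv] lin_add[OF lin_mult_var] lin_add[OF lin_partial_deriv]

lemma phi_phi: "phi i r (phi j s v) = phi j s (phi i r v)"
  by (auto simp: phi_def mult_var_commute partial_deriv_commute partial_deriv_mult_var boson_linear)

lemma phi_star_phi_star: "phi_star i r (phi_star j s v) = phi_star j s (phi_star i r v)"
  by (auto simp: phi_star_def mult_var_commute partial_deriv_commute partial_deriv_mult_var boson_linear)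

lemma phi_phi_star:
  "phi i r (phi_star j s v) = phi_star j s (phi i r v) + (if i = j \<and> r + s = 1 then - v else 0)"
proof -
  consider "r \<le> 0" "s \<le> 0" | "r > 0" "s > 0" | "r \<le> 0" "s > 0" | "r > 0" "s \<le> 0"
    by linarith
  then show ?thesis
  proof cases
    case 1
    then show ?thesis by (auto simp: phi_def phi_star_def mult_var_commute)
  next
    case 2
    then show ?thesis
      by (auto simp: phi_def phi_star_def partial_deriv_commute boson_linear)
  next
    case 3
    then have "nat (s - 1) = nat (- r) \<longleftrightarrow> r + s = 1"
      by auto
    then show ?thesis
      using 3 by (auto simp: phi_def phi_star_def partial_deriv_mult_var)
  next
    case 4
    then have "nat (r - 1) = nat (- s) \<longleftrightarrow> r + s = 1"
      by auto
    then show ?thesis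
      using 4 by (auto simp: phi_def phi_star_def partial_deriv_mult_var boson_linear)
  qed
qed

lemma partial_deriv_eventually_zero:
  fixes x :: "nat \<Rightarrow> 'x"
  assumes "inj x"
  shows "\<exists>K. \<forall>r>K. partial_deriv (x (nat (r - 1))) v = 0"
proof (rule eventually_zero_basis[OF lin_partial_deriv])
  fix p :: "'x \<Rightarrow>\<^sub>0 nat"
  have "finite (x -` Poly_Mapping.keys p)"
    using assms by (intro finite_vimageI) auto
  then obtain k where k: "\<forall>n\<in>x -` Poly_Mapping.keys p. n \<le> k"
    using finite_nat_set_iff_bounded_le by auto
  have "partial_deriv (x (nat (r - 1))) (basis p) = 0" if "r > int k + 1" for r
  proof -
    have "\<not> nat (r - 1) \<le> k"
      using that by auto
    then have "x (nat (r - 1)) \<notin> Poly_Mapping.keys p"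
      using k by auto
    then show ?thesis
      by (simp add: in_keys_iff)
  qed
  then show "\<exists>K. \<forall>r>K. partial_deriv (x (nat (r - 1))) (basis p) = 0"
    by blast
qed

lemma phi_eventually_zero: "\<exists>K. \<forall>r>K. phi j r v = 0"
proof -
  obtain K where "\<forall>r>K. partial_deriv (Phi_star j (nat (r - 1))) v = 0"
    using partial_deriv_eventually_zero[of "Phi_star j" v] by (auto simp: inj_def)
  then have "\<forall>r>max K 0. phi j r v = 0"
    by (simp add: phi_def)
  then show ?thesis
    by blast
qed

lemma phi_star_eventually_zero: "\<exists>K. \<forall>r>K. phi_star j r v = 0"
proof -
  obtain K where "\<forall>r>K. partial_deriv (Phi j (nat (r - 1))) v = 0"
    using partial_deriv_eventually_zero[of "Phi j" v] by (auto simp: inj_def)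
  then have "\<forall>r>max K 0. phi_star j r v = 0"
    by (simp add: phi_star_def)
  then show ?thesis
    by blast
qed


subsection \<open>Fermions\<close>

lemma cocycle_minus_left: "cocycle (- \<alpha>) \<beta> = inverse (cocycle \<alpha> \<beta>)"
  by (simp add: cocycle_def power_int_minus flip: prod_inversef)

lemma cocycle_minus_right: "cocycle \<alpha> (- \<beta>) = inverse (cocycle \<alpha> \<beta>)"
  by (simp add: cocycle_def power_int_minus flip: prod_inversef)

lemma cocycle_unit_vectors:
  assumes "\<alpha> \<in> {lat_e i, - lat_e i}" "\<beta> \<in> {lat_e j, - lat_e j}"
  shows "cocycle \<alpha> \<beta> = (if i \<le> j then 1 else -1)"
  using assms by (auto simp: cocycle_minus_left cocycle_minus_right cocycle_e)

lemma Y_coeff_anticommute_distinct: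
  assumes ij: "i \<noteq> j" and \<alpha>: "\<alpha> \<in> {lat_e i, - lat_e i}" and \<beta>: "\<beta> \<in> {lat_e j, - lat_e j}"
  shows "Y_coeff \<alpha> r (Y_coeff \<beta> s v) = - Y_coeff \<beta> s (Y_coeff \<alpha> r v)"
proof -
  have c: "pairing \<alpha> \<beta> = 0"
    using assms by (auto simp: pairing_minus_left pairing_minus_right pairing_lat_e)
  have "cscale (cocycle \<beta> \<alpha>) (Y_coeff \<alpha> r (Y_coeff \<beta> s v)) = cscale (cocycle \<alpha> \<beta>) (Y_coeff \<beta> s (Y_coeff \<alpha> r v))"
    using Y_coeff_exchange[of \<alpha> \<beta> r s v] c by simp
  moreover have "cocycle \<beta> \<alpha> = - cocycle \<alpha> \<beta>" "cocycle \<alpha> \<beta> * cocycle \<alpha> \<beta> = 1"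
    using ij by (auto simp: cocycle_unit_vectors[OF \<alpha> \<beta>] cocycle_unit_vectors[OF \<beta> \<alpha>])
  ultimately have "cscale (cocycle \<alpha> \<beta>) (- cscale (cocycle \<alpha> \<beta>) (Y_coeff \<alpha> r (Y_coeff \<beta> s v))) =
      cscale (cocycle \<alpha> \<beta>) (cscale (cocycle \<alpha> \<beta>) (Y_coeff \<beta> s (Y_coeff \<alpha> r v)))"
    by simp
  then have "- Y_coeff \<alpha> r (Y_coeff \<beta> s v) = Y_coeff \<beta> s (Y_coeff \<alpha> r v)"
    by (simp add: \<open>cocycle \<alpha> \<beta> * cocycle \<alpha> \<beta> = 1\<close>)
  then show ?thesis
    by (metis minus_minus)
qed

lemma Y_coeff_anticommute_same:
  assumes \<alpha>: "\<alpha> \<in> {lat_e i, - lat_e i}"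
  shows "Y_coeff \<alpha> r (Y_coeff \<alpha> s v) = - Y_coeff \<alpha> s (Y_coeff \<alpha> r v)"
proof -
  have c: "pairing \<alpha> \<alpha> = 1"
    using assms by (auto simp: pairing_minus_left pairing_minus_right pairing_lat_e)
  then show ?thesis
    using Y_coeff_exchange[of \<alpha> \<alpha> r s v] by (simp add: cocycle_unit_vectors[OF \<alpha> \<alpha>])
qed

interpretation fermion: free_fields "\<lambda>_. 1" "\<lambda>i. Y_coeff (lat_e i)" "\<lambda>i. Y_coeff (- lat_e i)"
proof (rule free_fields.intro)
  fix i j :: "'a::{finite,linorder}" and r s v
  have sign: "super_sign 1 1 = -1"
    by (simp add: super_sign_def)
  show "Y_coeff (lat_e i) r (Y_coeff (lat_e j) s v) =
      cscale (super_sign 1 1) (Y_coeff (lat_e j) s (Y_coeff (lat_e i) r v))"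
    using Y_coeff_anticommute_distinct[of i j "lat_e i" "lat_e j" r s v] Y_coeff_anticommute_same[of "lat_e i" i r s v]
    by (cases "i = j") (simp_all add: sign)
  show "Y_coeff (- lat_e i) r (Y_coeff (- lat_e j) s v) =
      cscale (super_sign 1 1) (Y_coeff (- lat_e j) s (Y_coeff (- lat_e i) r v))"
    using Y_coeff_anticommute_distinct[of i j "- lat_e i" "- lat_e j" r s v] Y_coeff_anticommute_same[of "- lat_e i" i r s v]
    by (cases "i = j") (simp_all add: sign)
  show "Y_coeff (lat_e i) r (Y_coeff (- lat_e j) s v) =
      cscale (super_sign 1 1) (Y_coeff (- lat_e j) s (Y_coeff (lat_e i) r v)) +
      (if i = j \<and> r + s = 1 then cscale (- super_sign 1 1) v else 0)"
  proof (cases "i = j")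
    case True
    have "Y_coeff (lat_e i) r (Y_coeff (- lat_e i) s v) + Y_coeff (- lat_e i) s (Y_coeff (lat_e i) r v) =
        (if r + s = 1 then v else 0)"
      by (rule Y_coeff_anticommutator) (simp_all add: pairing_lat_e cocycle_unit_vectors[of _ i _ i])
    then show ?thesis
      using True by (simp add: sign eq_diff_eq)
  next
    case False
    then show ?thesis
      using Y_coeff_anticommute_distinct[of i j "lat_e i" "- lat_e j" r s v] by (simp add: sign)
  qed
qed (intro lin_Y_coeff Y_coeff_eventually_zero)+

text \<open>These two identities are the boson-fermion correspondence.\<close>

lemma fermion_current_diagonal: "fermion.current i i n v = heis (of_lattice (lat_e i)) n v"
proof -
  have "fermion.current i i n v = osc (lat_e i) n v"
  proof (rule lin_eqI[OF fermion.lin_current lin_osc])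
    fix x :: "'a v_basis"
    obtain \<gamma> q where x: "x = (\<gamma>, q)" by force
    have "fermion.current i i n (basis x) = Sum_any (\<lambda>r. if r \<le> n + 1 - r
        then Y_coeff (lat_e i) r (Y_coeff (- lat_e i) (n + 1 - r) (basis x))
        else - Y_coeff (- lat_e i) (n + 1 - r) (Y_coeff (lat_e i) r (basis x)))"
      unfolding fermion.current_def fermion.normal_ordered_def
      by (intro Sum_any.cong) (simp add: super_sign_def)
    also have "\<dots> = osc (lat_e i) n (basis x)"
      unfolding x
      by (rule normal_ordered_sum_graded[OF basis_graded])
         (simp_all add: pairing_lat_e cocycle_unit_vectors[of _ i _ i])
    finally show "fermion.current i i n (basis x) = osc (lat_e i) n (basis x)" .
  qed
  then show ?thesis
    by (simp add: osc_def)
qed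

lemma fermion_current_off_diagonal:
  assumes "i \<noteq> j"
  shows "fermion.current i j n v = cscale (cocycle (lat_e i) (lat_e j)) (X_int (lat_root i j) n v)"
proof (rule lin_eqI[OF fermion.lin_current])
  show "lin (\<lambda>v. cscale (cocycle (lat_e i) (lat_e j)) (X_int (lat_root i j) n v))"
    unfolding X_int_def by (intro lin_scale_map lin_Y_coeff)
next
  fix x :: "'a v_basis"
  obtain \<gamma> q where x: "x = (\<gamma>, q)" by force
  have norm: "pairing (lat_root i j) (lat_root i j) = 2"
    using assms by (simp add: pairing_diff_left pairing_diff_right pairing_lat_e)
  have "fermion.current i j n (basis x) =
      Sum_any (\<lambda>r. Y_coeff (lat_e i) r (Y_coeff (- lat_e j) (n + 1 - r) (basis x)))"
    unfolding fermion.current_def fermion.normal_ordered_eq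
    by (intro Sum_any.cong) (simp add: fermion.contraction_def assms)
  also have "\<dots> = cscale (cocycle (lat_e i) (- lat_e j)) (Y_coeff (lat_e i + - lat_e j) (n + 1) (basis x))"
    unfolding x by (rule product_sum_graded[OF basis_graded]) (simp add: pairing_minus_right pairing_lat_e assms)
  finally show "fermion.current i j n (basis x) =
      cscale (cocycle (lat_e i) (lat_e j)) (X_int (lat_root i j) n (basis x))"
    by (simp add: X_int_def norm cocycle_unit_vectors[of _ i _ j])
qed


subsection \<open>Fields on the tensor product\<close>

fun field_parity :: "'m + 'n \<Rightarrow> bit" where
  "field_parity (Inl i) = 1"
| "field_parity (Inr j) = 0"

fun field :: "'m + 'n \<Rightarrow> int \<Rightarrow>
  (('m::{finite,linorder}, 'n) fock_basis \<Rightarrow>\<^sub>0 complex) \<Rightarrow> (('m, 'n) fock_basis \<Rightarrow>\<^sub>0 complex)" where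
  "field (Inl i) r = tensor_op (Y_coeff (lat_e i) r) (\<lambda>v. v)"
| "field (Inr j) r = tensor_op (\<lambda>v. v) (phi j r)"

fun dual_field :: "'m + 'n \<Rightarrow> int \<Rightarrow>
  (('m::{finite,linorder}, 'n) fock_basis \<Rightarrow>\<^sub>0 complex) \<Rightarrow> (('m, 'n) fock_basis \<Rightarrow>\<^sub>0 complex)" where
  "dual_field (Inl i) r = tensor_op (Y_coeff (- lat_e i) r) (\<lambda>v. v)"
| "dual_field (Inr j) r = tensor_op (\<lambda>v. v) (phi_star j r)"

lemma tensor_op_eventually_zero:
  fixes A :: "int \<Rightarrow> ('b \<Rightarrow>\<^sub>0 complex) \<Rightarrow> ('d \<Rightarrow>\<^sub>0 complex)"
    and B :: "int \<Rightarrow> ('c \<Rightarrow>\<^sub>0 complex) \<Rightarrow> ('e \<Rightarrow>\<^sub>0 complex)"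
  assumes lin: "\<And>r. lin (A r)" "\<And>r. lin (B r)"
    and zero: "(\<forall>v. \<exists>K. \<forall>r>K. A r v = 0) \<or> (\<forall>v. \<exists>K. \<forall>r>K. B r v = 0)"
  shows "\<exists>K::int. \<forall>r>K. tensor_op (A r) (B r) w = 0"
proof (rule eventually_zero_basis[OF lin_tensor_op])
  fix x :: "'b \<times> 'c"
  obtain y z where x: "x = (y, z)" by force
  obtain K where "(\<forall>r>K. A r (basis y) = 0) \<or> (\<forall>r>K. B r (basis z) = 0)"
    using zero by blast
  then have "\<forall>r>K. tensor_op (A r) (B r) (basis x) = 0"
    by (auto simp: x lin_0[OF lin_tensor_left] lin_0[OF lin_tensor_right])
  then show "\<exists>K. \<forall>r>K. tensor_op (A r) (B r) (basis x) = 0" ..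
qed

lemma lin_field: "lin (field A r)"
  by (cases A) (auto intro: lin_tensor_op)

lemma lin_dual_field: "lin (dual_field A r)"
  by (cases A) (auto intro: lin_tensor_op)

lemma tensor_op_uminus_left: "tensor_op (\<lambda>v. - A v) B w = - tensor_op A B w"
  using tensor_op_linear_left(3)[of "-1" A B w] by simp

lemma tensor_op_diff_if:
  "tensor_op (\<lambda>v. - A v + (if P then v else 0)) (\<lambda>v. v) w = - tensor_op A (\<lambda>v. v) w + (if P then w else 0)"
  "tensor_op (\<lambda>v. v) (\<lambda>v. B v + (if P then - v else 0)) w = tensor_op (\<lambda>v. v) B w - (if P then w else 0)"
  using tensor_op_linear_left(1)[of "\<lambda>v. - A v" "\<lambda>v. v" "\<lambda>v. v" w]
    tensor_op_linear_right(2)[of "\<lambda>v. v" B "\<lambda>v. v" w]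
  by (auto simp: tensor_op_id tensor_op_uminus_left)

text \<open>
  The operators \<open>tensor_op\<close> carry no sign, so the two kinds of fields commute with each other; this is
  the required relation because the bosons are even.
\<close>

interpretation fock: free_fields field_parity field dual_field
proof (rule free_fields.intro)
  fix A B :: "'a::{finite,linorder} + 'b" and r s v
  note comp = tensor_op_comp[OF lin_Y_coeff lin_id] tensor_op_comp[OF lin_id lin_Y_coeff]
    tensor_op_comp[OF lin_id lin_phi] tensor_op_comp[OF lin_id lin_phi_star]
    tensor_op_comp[OF lin_Y_coeff lin_phi] tensor_op_comp[OF lin_Y_coeff lin_phi_star]
    tensor_op_comp[OF lin_Y_coeff lin_id]
  have sign: "super_sign 1 1 = -1" "super_sign 0 p = 1" "super_sign p 0 = 1" for p
    by (simp_all add: super_sign_def)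
  show "field A r (field B s v) = cscale (super_sign (field_parity A) (field_parity B)) (field B s (field A r v))"
  proof (cases A; cases B)
    fix i j assume "A = Inl i" "B = Inl j"
    then show ?thesis
      using fermion.a_a[of i r j s] by (simp add: comp sign tensor_op_uminus_left)
  next
    fix i j assume "A = Inr i" "B = Inr j"
    then show ?thesis
      using phi_phi[of i r j s] by (simp add: comp sign)
  qed (simp_all add: comp sign)
  show "dual_field A r (dual_field B s v) =
      cscale (super_sign (field_parity A) (field_parity B)) (dual_field B s (dual_field A r v))"
  proof (cases A; cases B)
    fix i j assume "A = Inl i" "B = Inl j"
    then show ?thesis
      using fermion.ad_ad[of i r j s] by (simp add: comp sign tensor_op_uminus_left)
  next
    fix i j assume "A = Inr i" "B = Inr j"
    then show ?thesis
      using phi_star_phi_star[of i r j s] by (simp add: comp sign)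
  qed (simp_all add: comp sign)
  show "field A r (dual_field B s v) =
      cscale (super_sign (field_parity A) (field_parity B)) (dual_field B s (field A r v)) +
      (if A = B \<and> r + s = 1 then cscale (- super_sign (field_parity A) (field_parity A)) v else 0)"
  proof (cases A; cases B)
    fix i j assume "A = Inl i" "B = Inl j"
    moreover have "tensor_op (\<lambda>v. Y_coeff (lat_e i) r (Y_coeff (- lat_e j) s v)) (\<lambda>v. v) v =
        - tensor_op (\<lambda>v. Y_coeff (- lat_e j) s (Y_coeff (lat_e i) r v)) (\<lambda>v. v) v + (if i = j \<and> r + s = 1 then v else 0)"
      unfolding tensor_op_diff_if(1)[symmetric] by (simp add: fermion.a_ad[of i r j s] sign cong: if_cong)
    ultimately show ?thesis
      by (simp add: comp sign)
  next
    fix i j assume "A = Inr i" "B = Inr j"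
    then show ?thesis
      by (simp add: comp sign phi_phi_star[of i r j s] tensor_op_diff_if)
  qed (simp_all add: comp sign)
  show "lin (field A r)" "lin (dual_field A r)"
    by (rule lin_field lin_dual_field)+
  show "\<exists>K. \<forall>r>K. field A r v = 0"
    by (cases A) (auto intro!: tensor_op_eventually_zero lin_Y_coeff lin_phi lin_id
        simp: Y_coeff_eventually_zero phi_eventually_zero)
  show "\<exists>K. \<forall>r>K. dual_field A r v = 0"
    by (cases A) (auto intro!: tensor_op_eventually_zero lin_Y_coeff lin_phi_star lin_id
        simp: Y_coeff_eventually_zero phi_star_eventually_zero)
qed

lemma fock_current_even:
  "fock.current (Inl i) (Inl j) n v = tensor_op (fermion.current i j n) (\<lambda>v. v) v"
proof (rule tensor_op_eqI[symmetric, OF fock.lin_current])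
  fix x y
  have "fock.normal_ordered (Inl i) r (Inl j) s (basis (x, y)) =
      tensor (fermion.normal_ordered i r j s (basis x)) (basis y)" for r s
    by (simp add: fock.normal_ordered_def fermion.normal_ordered_def tensor_op_tensor[OF lin_Y_coeff lin_id]
        lin_scale[OF lin_tensor_left])
  then show "tensor (fermion.current i j n (basis x)) (basis y) = fock.current (Inl i) (Inl j) n (basis (x, y))"
    unfolding fock.current_def fermion.current_def
    by (simp add: lin_of_Sum_any[OF lin_tensor_left fermion.finite_normal_ordered])
qed


section \<open>The representation\<close>

text \<open>
  The basis vector $T_{ab}$ acts as the current of \<open>a\<close> and \<open>b\<close> up to this sign. It is \<open>1\<close> for \<open>i = j\<close>, in
  accordance with the action of $T_{ii}$ by $e_i(n)$.
\<close>

fun current_sign :: "'m::{finite,linorder} + 'n \<Rightarrow> 'm + 'n \<Rightarrow> complex" where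
  "current_sign (Inl i) (Inl j) = cocycle (lat_e i) (lat_e j)"
| "current_sign _ _ = 1"

lemma fock_action_basis_current:
  "fock_action_basis (Mode (A, B) n) v = cscale (current_sign A B) (fock.current A B n v)"
proof (cases A; cases B)
  fix i j assume AB: "A = Inl i" "B = Inl j"
  show ?thesis
  proof (cases "i = j")
    case True
    have "fermion.current i i n = heis (of_lattice (lat_e i)) n"
      by (rule ext) (rule fermion_current_diagonal)
    then show ?thesis
      using True by (simp add: AB fock_current_even cocycle_e id_def)
  next
    case False
    have "fermion.current i j n = (\<lambda>v. cscale (cocycle (lat_e i) (lat_e j)) (X_int (lat_root i j) n v))"
      by (rule ext) (rule fermion_current_off_diagonal[OF False])
    then show ?thesis
      using False by (simp add: AB fock_current_even tensor_op_linear_left(3) cocycle_e id_def)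
  qed
next
  fix i j assume AB: "A = Inl i" "B = Inr j"
  have "tensor_op (X_half (lat_e i) r) (phi_star j (n - r + 1)) v =
      fock.normal_ordered (Inl i) r (Inr j) (n + 1 - r) v" for r
    by (simp add: fock.normal_ordered_def super_sign_def X_half_def[abs_def] tensor_op_comp[OF lin_Y_coeff lin_id]
        tensor_op_comp[OF lin_id lin_phi_star] add_diff_eq algebra_simps)
  then show ?thesis
    by (simp add: AB S_star_def fock.current_def)
next
  fix j i assume AB: "A = Inr j" "B = Inl i"
  have "tensor_op (X_half (- lat_e i) (n + 1 - r)) (phi j (n - (n + 1 - r) + 1)) v =
      fock.normal_ordered (Inr j) r (Inl i) (n + 1 - r) v" for r
    by (simp add: fock.normal_ordered_def super_sign_def X_half_def[abs_def] tensor_op_comp[OF lin_Y_coeff lin_id]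
        tensor_op_comp[OF lin_id lin_phi])
  then have "S_unstar j i n v = fock.current (Inr j) (Inl i) n v"
    unfolding S_unstar_def fock.current_def
    by (intro Sum_any.reindex_cong[of "\<lambda>r. n + 1 - r"] bij_betw_byWitness[of _ "\<lambda>r. n + 1 - r"]) auto
  then show ?thesis
    by (simp add: AB)
next
  fix i j assume AB: "A = Inr i" "B = Inr j"
  have "tensor_op id (normal_phi i r j (n - r + 1)) v = fock.normal_ordered (Inr i) r (Inr j) (n + 1 - r) v" for r
    by (simp add: fock.normal_ordered_def normal_phi_def super_sign_def tensor_op_comp[OF lin_id lin_phi]
        tensor_op_comp[OF lin_id lin_phi_star] id_def o_def algebra_simps)
  then show ?thesis
    by (simp add: AB S_normal_def fock.current_def)
qed

lemma lin_fock_action_basis: "lin (fock_action_basis x)"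
proof (cases x)
  case (Mode z n)
  obtain A B where "z = (A, B)" by force
  then have "fock_action_basis x = (\<lambda>v. cscale (current_sign A B) (fock.current A B n v))"
    by (simp add: Mode fock_action_basis_current fun_eq_iff)
  then show ?thesis
    by (simp add: lin_scale_map fock.lin_current)
qed (simp add: lin_id')


subsection \<open>Parity\<close>

definition parity_part :: "bit \<Rightarrow> ('m::finite, 'n) fock_basis set" where
  "parity_part p = {w. fock_parity w = p}"

lemma lattice_parity:
  assumes "\<alpha> \<in> {lat_e i, - lat_e i}"
  shows "(of_int (pairing (\<alpha> + \<gamma>) (\<alpha> + \<gamma>)) :: bit) = 1 + of_int (pairing \<gamma> \<gamma>)"
proof -
  have "pairing \<alpha> \<alpha> = 1"
    using assms by (auto simp: pairing_minus_left pairing_minus_right pairing_lat_e)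
  then have "pairing (\<alpha> + \<gamma>) (\<alpha> + \<gamma>) = 1 + 2 * pairing \<alpha> \<gamma> + pairing \<gamma> \<gamma>"
    by (simp add: pairing_add_left pairing_add_right pairing_commute[of \<gamma> \<alpha>])
  then show ?thesis
    by simp
qed

lemma tensor_op_parity_odd:
  assumes \<alpha>: "\<alpha> \<in> {lat_e i, - lat_e i}" and v: "Poly_Mapping.keys v \<subseteq> parity_part p"
  shows "Poly_Mapping.keys (tensor_op (Y_coeff \<alpha> r) (\<lambda>v. v) v) \<subseteq> parity_part (1 + p)"
proof (rule keys_lin_subset[OF lin_tensor_op _ v])
  fix x :: "('a, 'b) fock_basis"
  assume x: "x \<in> parity_part p"
  obtain \<gamma> q f where xq: "x = ((\<gamma>, q), f)"
    by (metis surj_pair)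
  have "Poly_Mapping.keys (tensor_op (Y_coeff \<alpha> r) (\<lambda>v. v) (basis x)) \<subseteq>
      Poly_Mapping.keys (Y_coeff \<alpha> r (basis (\<gamma>, q))) \<times> {f}"
    using keys_tensor[of "Y_coeff \<alpha> r (basis (\<gamma>, q))" "basis f"] by (simp add: xq)
  also have "\<dots> \<subseteq> parity_part (1 + p)"
    using Y_coeff_graded[OF basis_graded[of \<gamma> q], of \<alpha> r] x lattice_parity[OF \<alpha>, of \<gamma>]
    by (auto simp: parity_part_def graded_def xq)
  finally show "Poly_Mapping.keys (tensor_op (Y_coeff \<alpha> r) (\<lambda>v. v) (basis x)) \<subseteq> parity_part (1 + p)" .
qed

lemma tensor_op_parity_even:
  assumes v: "Poly_Mapping.keys v \<subseteq> parity_part p"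
  shows "Poly_Mapping.keys (tensor_op (\<lambda>v. v) B v) \<subseteq> parity_part p"
proof (rule keys_lin_subset[OF lin_tensor_op _ v])
  fix x :: "('a, 'b) fock_basis"
  assume x: "x \<in> parity_part p"
  obtain \<gamma> q f where xq: "x = ((\<gamma>, q), f)"
    by (metis surj_pair)
  show "Poly_Mapping.keys (tensor_op (\<lambda>v. v) B (basis x)) \<subseteq> parity_part p"
    using keys_tensor[of "basis (\<gamma>, q)" "B (basis f)"] x by (auto simp: xq parity_part_def)
qed

lemma field_parity_part:
  assumes "Poly_Mapping.keys v \<subseteq> parity_part p"
  shows "Poly_Mapping.keys (field A r v) \<subseteq> parity_part (field_parity A + p)"
proof (cases A)
  case (Inl i)
  show ?thesis
    unfolding Inl field.simps field_parity.simps by (rule tensor_op_parity_odd[where i = i, OF _ assms]) simp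
next
  case (Inr j)
  show ?thesis
    unfolding Inr field.simps field_parity.simps add_0 by (rule tensor_op_parity_even[OF assms])
qed

lemma dual_field_parity_part:
  assumes "Poly_Mapping.keys v \<subseteq> parity_part p"
  shows "Poly_Mapping.keys (dual_field A r v) \<subseteq> parity_part (field_parity A + p)"
proof (cases A)
  case (Inl i)
  show ?thesis
    unfolding Inl dual_field.simps field_parity.simps by (rule tensor_op_parity_odd[where i = i, OF _ assms]) simp
next
  case (Inr j)
  show ?thesis
    unfolding Inr dual_field.simps field_parity.simps add_0 by (rule tensor_op_parity_even[OF assms])
qed

lemma t_parity_eq: "t_parity (A, B) = field_parity A + field_parity B"
  by (cases A; cases B) (simp_all add: t_parity_def)

lemma current_parity_part:
  assumes "Poly_Mapping.keys v \<subseteq> parity_part p"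
  shows "Poly_Mapping.keys (fock.current A B n v) \<subseteq> parity_part (t_parity (A, B) + p)"
  unfolding fock.current_def Sum_any.expand_set
proof (rule keys_sum_subset)
  fix r
  have "Poly_Mapping.keys (field A r (dual_field B (n + 1 - r) v)) \<subseteq> parity_part (t_parity (A, B) + p)"
    unfolding t_parity_eq add.assoc by (intro field_parity_part dual_field_parity_part assms)
  moreover have "Poly_Mapping.keys (dual_field B (n + 1 - r) (field A r v)) \<subseteq> parity_part (t_parity (A, B) + p)"
    unfolding t_parity_eq add.commute[of "field_parity A" "field_parity B"] add.assoc
    by (intro field_parity_part dual_field_parity_part assms)
  ultimately show "Poly_Mapping.keys (fock.normal_ordered A r B (n + 1 - r) v) \<subseteq> parity_part (t_parity (A, B) + p)"
    unfolding fock.normal_ordered_def by (simp only: keys_cscale_subset split: if_split) blast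
qed

lemma fock_action_basis_parity:
  assumes "Poly_Mapping.keys v \<subseteq> parity_part p"
  shows "Poly_Mapping.keys (fock_action_basis x v) \<subseteq> parity_part (affine_parity x + p)"
proof (cases x)
  case (Mode z n)
  obtain A B where "z = (A, B)" by force
  then show ?thesis
    using current_parity_part[OF assms] by (simp add: Mode fock_action_basis_current keys_cscale_subset)
next
  case Central
  show ?thesis
    unfolding Central affine_parity.simps fock_action_basis.simps id_apply add_0 by (rule assms)
qed


subsection \<open>The brackets\<close>

lemma super_sign_sum:
  "super_sign (p + p') (q + q') = super_sign p q * super_sign p' q * (super_sign p q' * super_sign p' q')"
  by (cases p; cases p'; cases q; cases q') (simp_all add: super_sign_def)

lemma cocycle_e_square: "cocycle (lat_e i) (lat_e j) * cocycle (lat_e i) (lat_e j) = 1"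
  by (simp add: cocycle_e)

lemma cocycle_e_swap: "i \<noteq> j \<Longrightarrow> cocycle (lat_e i) (lat_e j) = - cocycle (lat_e j) (lat_e i)"
  by (auto simp: cocycle_e)

lemma cocycle_root:
  "cocycle (lat_root i j) (lat_root k l) = cocycle (lat_e i) (lat_e k) * cocycle (lat_e i) (lat_e l) *
    (cocycle (lat_e j) (lat_e k) * cocycle (lat_e j) (lat_e l))"
proof -
  have "inverse (cocycle (lat_e a) (lat_e b)) = cocycle (lat_e a) (lat_e b)" for a b :: 'a
    by (simp add: cocycle_e)
  then show ?thesis
    by (simp only: diff_conv_add_uminus cocycle_add_left cocycle_add_right cocycle_minus_left
        cocycle_minus_right inverse_mult_distrib mult_ac)
qed

text \<open>
  The value of the cocycle on two composable roots is a product of three values on unit vectors, one for each of the two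
  factors and one for the result. So multiplying the basis vectors by these signs turns the bracket into that of matrix units.
\<close>

lemma t_bracket_even_eq:
  "t_bracket_even i j k l =
    (if j = k then cscale (cocycle (lat_e i) (lat_e j) * cocycle (lat_e k) (lat_e l) * cocycle (lat_e i) (lat_e l))
       (basis (Inl i, Inl l)) else 0) -
    (if i = l then cscale (cocycle (lat_e i) (lat_e j) * cocycle (lat_e k) (lat_e l) * cocycle (lat_e k) (lat_e j))
       (basis (Inl k, Inl j)) else 0)"
proof -
  have refl1: "cocycle (lat_e a) (lat_e a) = 1" for a :: 'a
    by (simp add: cocycle_e)
  have pair: "pairing (lat_root i j) (lat_root k l) = (if i = k then 1 else 0) - (if i = l then 1 else 0) -
      (if j = k then 1 else 0) + (if j = l then 1 else 0)" for i j k l :: 'a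
    by (simp add: pairing_diff_left pairing_diff_right pairing_lat_e)
  have pair1: "pairing (lat_e i) (lat_root k l) = (if i = k then 1 else 0) - (if i = l then 1 else 0)" for i k l :: 'a
    by (simp add: pairing_diff_right pairing_lat_e)
  consider "i \<noteq> j" "k \<noteq> l" "j = k" "i = l" | "i \<noteq> j" "k \<noteq> l" "j = k" "i \<noteq> l"
    | "i \<noteq> j" "k \<noteq> l" "j \<noteq> k" "i = l" | "i \<noteq> j" "k \<noteq> l" "j \<noteq> k" "i \<noteq> l"
    | "i = j" "k \<noteq> l" | "i \<noteq> j" "k = l" | "i = j" "k = l"
    by blast
  then show ?thesis
  proof cases
    case 3
    \<comment> \<open>The minus sign of the second matrix product comes from reversing three pairs of
      distinct indices.\<close>
    then show ?thesis
      using cocycle_e_swap[of i j] cocycle_e_swap[of i k] cocycle_e_swap[of j k]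
      by (simp add: t_bracket_even_def Let_def pair cocycle_root refl1 mult_ac)
  qed (auto simp: t_bracket_even_def Let_def pair cocycle_root refl1 cocycle_e_square pair1
      mult_ac cs.scale_right_diff_distrib)
qed

text \<open>
  In the basis \<open>current_sign A B\<close> times $T_{AB}$ this is the supercommutator of matrix units.
\<close>

theorem t_bracket_eq:
  "t_bracket (A, B) (C, D) =
    (if B = C then cscale (current_sign A B * current_sign C D * current_sign A D) (basis (A, D)) else 0) -
    (if A = D then cscale (super_sign (t_parity (A, B)) (t_parity (C, D)) *
        (current_sign A B * current_sign C D * current_sign C B)) (basis (C, B)) else 0)"
proof -
  have sign: "super_sign 1 1 = -1" "super_sign 0 p = 1" "super_sign p 0 = 1" for p
    by (simp_all add: super_sign_def)
  show ?thesis
    by (cases A; cases B; cases C; cases D)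
       (auto simp: t_bracket_def t_parity_def sign t_bracket_even_eq cocycle_e)
qed

lemma t_form_eq:
  "t_form (A, B) (C, D) = (if A = D \<and> B = C
    then current_sign A B * current_sign C D * - super_sign (field_parity A) (field_parity A) else 0)"
proof -
  have refl1: "cocycle (lat_e a) (lat_e a) = 1" for a :: 'a
    by (simp add: cocycle_e)
  show ?thesis
    by (cases A; cases B; cases C; cases D) (auto simp: super_sign_def cocycle_root refl1)
qed

lemma lin_fock_action_left: "lin (\<lambda>x. fock_action x v)"
  unfolding fock_action_def by (rule lin_lin_ext)

lemma lin_fock_action: "lin (fock_action x)"
  unfolding fock_action_def[abs_def] by (rule lin_lin_ext_family[OF lin_fock_action_basis])

lemma fock_action_of_basis: "fock_action (basis x) v = fock_action_basis x v"
  by (simp add: fock_action_def)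

lemma fock_action_bracket_basis:
  "fock_action (affine_bracket_basis x y) v = fock_action_basis x (fock_action_basis y v) -
    cscale (super_sign (affine_parity x) (affine_parity y)) (fock_action_basis y (fock_action_basis x v))"
proof (cases "x = Central \<or> y = Central")
  case True
  then show ?thesis
    by (cases x; cases y) (auto simp: super_sign_def lin_0[OF lin_fock_action_left])
next
  case False
  then obtain z m z' n where xy: "x = Mode z m" "y = Mode z' n"
    by (metis affine_basis.exhaust)
  obtain A B C D where z: "z = (A, B)" "z' = (C, D)" by force
  let ?T = "\<lambda>w. lin_ext (\<lambda>z. basis (Mode z (m + n))) w"
  let ?c = "current_sign A B * current_sign C D"
  let ?s = "super_sign (t_parity (A, B)) (t_parity (C, D))"
  have s: "?s = fock.sg A C * fock.sg B C * (fock.sg A D * fock.sg B D)"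
    by (simp only: t_parity_eq super_sign_sum)
  have sq: "current_sign A B * current_sign A B = 1" for A B :: "'a + 'b"
    by (cases A; cases B) (simp_all add: cocycle_e)
  have "fock_action (affine_bracket_basis x y) v =
      (if B = C then cscale (?c * current_sign A D * current_sign A D) (fock.current A D (m + n) v) else 0) -
      (if A = D then cscale (?s * (?c * current_sign C B) * current_sign C B) (fock.current C B (m + n) v) else 0) +
      cscale (if m + n = 0 then t_form (A, B) (C, D) * of_int m else 0) v"
    unfolding xy z affine_bracket_basis.simps t_bracket_eq
    by (simp add: lin_add[OF lin_fock_action_left] lin_diff[OF lin_fock_action_left] lin_scale[OF lin_fock_action_left]
        lin_0[OF lin_fock_action_left] lin_diff[OF lin_lin_ext] lin_scale[OF lin_lin_ext] lin_0[OF lin_lin_ext]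
        fock_action_of_basis fock_action_basis_current)
  also have "\<dots> = cscale ?c ((if B = C then fock.current A D (m + n) v else 0) +
      (if A = D then cscale (- fock.sg A A * fock.sg A B * (fock.sg A C * fock.sg B C)) (fock.current C B (m + n) v) else 0) +
      (if A = D \<and> B = C \<and> m + n = 0 then cscale (- fock.sg A A * of_int m) v else 0))"
    using sq s by (auto simp: t_form_eq cs.scale_right_distrib mult.assoc fock.sg_commute mult_ac)
  also have "\<dots> = cscale ?c (fock.current A B m (fock.current C D n v) - cscale ?s (fock.current C D n (fock.current A B m v)))"
    unfolding fock.current_commutator[of A B m C D n v] s by simp
  also have "\<dots> = fock_action_basis x (fock_action_basis y v) -
      cscale (super_sign (affine_parity x) (affine_parity y)) (fock_action_basis y (fock_action_basis x v))"
    unfolding xy z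
    by (simp add: fock_action_basis_current lin_scale[OF fock.lin_current] cs.scale_right_diff_distrib mult_ac
        del: fock_action_basis.simps)
  finally show ?thesis .
qed

theorem proposition3p3:
  shows "super_representation
           (affine_parity :: ('m::{finite,linorder}, 'n::finite) affine_basis \<Rightarrow> bit)
           affine_bracket
           (fock_parity :: ('m, 'n) fock_basis \<Rightarrow> bit)
           fock_action"
  unfolding super_representation_def
proof (intro conjI allI ballI)
  show "lin (fock_action x)" for x :: "('m, 'n) affine_basis \<Rightarrow>\<^sub>0 complex"
    by (rule lin_fock_action)
  show "lin (\<lambda>x. fock_action x v)" for v :: "('m, 'n) fock_basis \<Rightarrow>\<^sub>0 complex"
    by (rule lin_fock_action_left)
next
  fix p q and x :: "('m, 'n) affine_basis \<Rightarrow>\<^sub>0 complex" and v :: "('m, 'n) fock_basis \<Rightarrow>\<^sub>0 complex"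
  assume x: "x \<in> homogeneous affine_parity p" and v: "v \<in> homogeneous fock_parity q"
  have v': "Poly_Mapping.keys v \<subseteq> parity_part q"
    using v by (auto simp: homogeneous_def parity_part_def)
  have "Poly_Mapping.keys (fock_action x v) \<subseteq> parity_part (p + q)"
    unfolding fock_action_def lin_ext_def
  proof (intro keys_sum_subset keys_cscale_subset)
    fix b assume "b \<in> Poly_Mapping.keys x"
    then have "affine_parity b = p"
      using x by (auto simp: homogeneous_def)
    then show "Poly_Mapping.keys (fock_action_basis b v) \<subseteq> parity_part (p + q)"
      using fock_action_basis_parity[OF v', of b] by simp
  qed
  then show "fock_action x v \<in> homogeneous fock_parity (p + q)"
    by (auto simp: homogeneous_def parity_part_def)
next
  fix p q and x y :: "('m, 'n) affine_basis \<Rightarrow>\<^sub>0 complex" and v :: "('m, 'n) fock_basis \<Rightarrow>\<^sub>0 complex"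
  assume x: "x \<in> homogeneous affine_parity p" and y: "y \<in> homogeneous affine_parity q"
  let ?r = "\<lambda>x y. fock_action x (fock_action y v) - cscale (super_sign p q) (fock_action y (fock_action x v))"
  have lin_left: "lin (\<lambda>x. fock_action (affine_bracket x y) v)" "lin (\<lambda>x. ?r x y)" for y
    unfolding affine_bracket_def
    by (intro lin_compose[OF lin_fock_action_left lin_bilin_ext_left])
       (intro lin_diff_map lin_scale_map lin_fock_action_left lin_compose[OF lin_fock_action lin_fock_action_left])
  have lin_right: "lin (\<lambda>y. fock_action (affine_bracket x y) v)" "lin (\<lambda>y. ?r x y)" for x
    unfolding affine_bracket_def
    by (intro lin_compose[OF lin_fock_action_left lin_bilin_ext_right])
       (intro lin_diff_map lin_scale_map lin_fock_action_left lin_compose[OF lin_fock_action lin_fock_action_left])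
  show "fock_action (affine_bracket x y) v = ?r x y"
  proof (rule lin_eqI_on[OF lin_left, of "Poly_Mapping.keys x"])
    fix b assume "b \<in> Poly_Mapping.keys x"
    then have b: "affine_parity b = p"
      using x by (auto simp: homogeneous_def)
    show "fock_action (affine_bracket (basis b) y) v = ?r (basis b) y"
    proof (rule lin_eqI_on[OF lin_right, of "Poly_Mapping.keys y"])
      fix c assume "c \<in> Poly_Mapping.keys y"
      then have c: "affine_parity c = q"
        using y by (auto simp: homogeneous_def)
      show "fock_action (affine_bracket (basis b) (basis c)) v = ?r (basis b) (basis c)"
        by (simp add: affine_bracket_def fock_action_bracket_basis fock_action_of_basis b c)
    qed simp
  qed simp
qed

end
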